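(* Let $n>1$, let $\varphi(z)=|z_1|^2+\dots+|z_n|^2$ on $\mathbb{C}^n$, and let $0\le q\le n$. The spectrum of the $\overline\partial$-Neumann Laplacian $\square_{\varphi,q}$, acting on $L^2_{(0,q)}(\mathbb{C}^n,e^{-|z|^2})$, consists of all integers $\{q,q+1,q+2,\dots\}$, each of which is an eigenvalue of infinite multiplicity.
   Context: Let $\lambda$ be Lebesgue measure on $\mathbb{C}^n$ and $\varphi(z)=|z|^2=|z_1|^2+\dots+|z_n|^2$. The space $L^2(\mathbb{C}^n,e^{-\varphi})$ consists of the measurable $f:\mathbb{C}^n\to\mathbb{C}$ with $\int|f|^2e^{-\varphi}\,d\lambda<\infty$, with inner product $(f,g)_\varphi=\int f\,\overline g\,e^{-\varphi}\,d\lambda$. The space $L^2_{(0,q)}(\mathbb{C}^n,e^{-\varphi})$ consists of $(0,q)$-forms $u=\sum'_{|J|=q}u_J\,d\overline z_J$ with coefficients $u_J\in L^2(\mathbb{C}^n,e^{-\varphi})$. Here $\sum'$ means summation over strictly increasing multiindices $J=(j_1,\dots,j_q)$, $d\overline z_J=d\overline z_{j_1}\wedge\dots\wedge d\overline z_{j_q}$, and $(u,v)_\varphi=\sum'_{|J|=q}(u_J,v_J)_\varphi$. For $q=0$ this is $L^2(\mathbb{C}^n,e^{-\varphi})$. For non-increasing multiindices, $u_J$ is defined by antisymmetry. The operator $\overline\partial u=\sum'_{|J|=q}\sum_{j=1}^n\frac{\partial u_J}{\partial\overline z_j}\,d\overline z_j\wedge d\overline z_J$ is taken in the sense of distributions,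 with domain all $u\in L^2_{(0,q)}(\mathbb{C}^n,e^{-\varphi})$ such that $\overline\partial u\in L^2_{(0,q+1)}(\mathbb{C}^n,e^{-\varphi})$. Its Hilbert space adjoint is $\overline\partial^*_\varphi$; on $(0,q)$-forms with coefficients in $\mathcal{C}_0^\infty(\mathbb{C}^n)$ it is $\overline\partial^*_\varphi u=-\sum'_{|K|=q-1}\sum_{k=1}^n\left(\frac{\partial}{\partial z_k}-\frac{\partial\varphi}{\partial z_k}\right)u_{kK}\,d\overline z_K$. The $\overline\partial$-Neumann Laplacian is $\square_{\varphi,q}=\overline\partial\,\overline\partial^*_\varphi+\overline\partial^*_\varphi\,\overline\partial$, with $\square_{\varphi,0}=\overline\partial^*_\varphi\overline\partial$ and $\square_{\varphi,n}=\overline\partial\,\overline\partial^*_\varphi$. It is the non-negative self-adjoint operator with the natural composition domain, and is the closure of the operator initially defined on forms with coefficients in $\mathcal{C}_0^\infty(\mathbb{C}^n)$. Explicitly, $$\square_{\varphi,q}u=\sum_{|J|=q}{}^{'}\Big(-\tfrac14\triangle u_J+\sum_{j=1}^n\overline z_j\,\frac{\partial u_J}{\partial\overline z_j}+q\,u_J\Big)\,d\overline z_J,$$ where $\triangle=4\sum_{j=1}^n\frac{\partial^2}{\partial z_j\partial\overline z_j}$ is the Laplacian on $\mathbb{C}^n\cong\mathbb{R}^{2n}$. The multiplicity of an eigenvalue is the dimension of its eigenspace. *)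

theory Defs
  imports "HOL-Analysis.Analysis"
begin

text \<open>
  A point of \<open>\<complex>\<^sup>n\<close> is a vector of type \<open>complex ^ 'n\<close> with \<open>n = CARD('n)\<close>; the order on the index type
  is the order of the coordinates.  A strictly increasing multiindex is identified with the set
  of its entries, so a form has one coefficient function for each subset of the index type.
  Elements of \<open>L\<^sup>2\<close> are represented by functions, not by classes of functions: all identities
  between forms are understood up to equality almost everywhere.  The coefficients are taken to be
  Borel measurable (every Lebesgue measurable function has a Borel measurable representative).
\<close>

type_synonym 'n form = "'n set \<Rightarrow> (complex, 'n) vec \<Rightarrow> complex"

primrec C_k :: "nat \<Rightarrow> ('a::real_normed_vector \<Rightarrow> 'b::real_normed_vector) \<Rightarrow> bool" where
  "C_k 0 f \<longleftrightarrow> continuous_on UNIV f"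
| "C_k (Suc k) f \<longleftrightarrow>
     (\<forall>x. f differentiable (at x)) \<and> (\<forall>v. C_k k (\<lambda>x. frechet_derivative f (at x) v))"

definition test_function :: "('a::real_normed_vector \<Rightarrow> complex) \<Rightarrow> bool" where
  "test_function f \<longleftrightarrow> (\<forall>k. C_k k f) \<and> compact (closure {x. f x \<noteq> 0})"

text \<open>The derivative with respect to the conjugate of \<open>z\<^sub>j\<close>, that is
  \<open>(\<partial>/\<partial>x\<^sub>j + \<i> \<partial>/\<partial>y\<^sub>j) / 2\<close> with \<open>z\<^sub>j = x\<^sub>j + \<i> y\<^sub>j\<close>.\<close>

definition d_zbar :: "'n::finite \<Rightarrow> (complex ^ 'n \<Rightarrow> complex) \<Rightarrow> complex ^ 'n \<Rightarrow> complex" where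
  "d_zbar j f z =
     (frechet_derivative f (at z) (axis j 1) + \<i> * frechet_derivative f (at z) (axis j \<i>)) / 2"

definition weight :: "complex ^ 'n::finite \<Rightarrow> real" where
  "weight z = (\<Sum>j\<in>UNIV. (cmod (z $ j))\<^sup>2)"

definition L2_weighted :: "(complex ^ 'n::finite \<Rightarrow> complex) set" where
  "L2_weighted = {f. f \<in> borel_measurable lborel \<and>
     integrable lborel (\<lambda>z. (cmod (f z))\<^sup>2 * exp (- weight z))}"

definition L2_inner ::
  "(complex ^ 'n::finite \<Rightarrow> complex) \<Rightarrow> (complex ^ 'n \<Rightarrow> complex) \<Rightarrow> complex" where
  "L2_inner f g = (LINT z|lborel. f z * cnj (g z) * of_real (exp (- weight z)))"

definition L2_forms :: "nat \<Rightarrow> 'n::finite form set" where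
  "L2_forms q = {u. \<forall>J. if card J = q then u J \<in> L2_weighted else u J = (\<lambda>z. 0)}"

definition form_inner :: "nat \<Rightarrow> 'n::finite form \<Rightarrow> 'n form \<Rightarrow> complex" where
  "form_inner q u v = (\<Sum>J | card J = q. L2_inner (u J) (v J))"

definition form_norm :: "nat \<Rightarrow> 'n::finite form \<Rightarrow> real" where
  "form_norm q u = sqrt (Re (form_inner q u u))"

definition form_eq :: "'n::finite form \<Rightarrow> 'n form \<Rightarrow> bool" where
  "form_eq u v \<longleftrightarrow> (\<forall>J. AE z in lborel. u J z = v J z)"

definition form_add :: "'n form \<Rightarrow> 'n form \<Rightarrow> 'n form" where
  "form_add u v = (\<lambda>J z. u J z + v J z)"

definition form_scale :: "complex \<Rightarrow> 'n form \<Rightarrow> 'n form" where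
  "form_scale c u = (\<lambda>J z. c * u J z)"

text \<open>
  An unbounded operator \<open>T\<close> is given by its graph, the set of pairs \<open>(u, v)\<close> with \<open>u\<close> in the domain
  and \<open>v\<close> a representative of \<open>T u\<close>.

  The following sum is the value at the test function \<open>\<eta>\<close> of the \<open>K\<close>-th coefficient of the
  distributional \<open>\<partial>\<close>-bar of \<open>u\<close>.  Only \<open>J = K - {j}\<close> with \<open>j \<in> K\<close> contributes to this coefficient, and the
  sign is the one obtained by moving the \<open>j\<close>-th differential to its place in the increasing
  product.  Only the whole sum, not each of its terms, has to be represented by an \<open>L\<^sup>2\<close> function.
\<close>

definition dbar_distribution ::
  "'n::{finite,linorder} form \<Rightarrow> 'n set \<Rightarrow> ((complex, 'n) vec \<Rightarrow> complex) \<Rightarrow> complex" where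
  "dbar_distribution u K \<eta> =
     (\<Sum>j\<in>K. (-1) ^ card {i\<in>K. i < j} *
        (- (LINT z|lborel. u (K - {j}) z * d_zbar j \<eta> z)))"

definition dbar :: "nat \<Rightarrow> 'n::{finite,linorder} form rel" where
  "dbar q = {(u, v). u \<in> L2_forms q \<and> v \<in> L2_forms (Suc q) \<and>
     (\<forall>K \<eta>. card K = Suc q \<and> test_function \<eta> \<longrightarrow>
        dbar_distribution u K \<eta> = (LINT z|lborel. v K z * \<eta> z))}"

text \<open>The Hilbert space adjoint of \<open>dbar q\<close>, an operator from forms of degree \<open>q + 1\<close> to degree \<open>q\<close>.\<close>

definition dbar_adj :: "nat \<Rightarrow> 'n::{finite,linorder} form rel" where
  "dbar_adj q = {(w, v). w \<in> L2_forms (Suc q) \<and> v \<in> L2_forms q \<and>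
     (\<forall>(u, a)\<in>dbar q. form_inner (Suc q) a w = form_inner q u v)}"

definition op_sum :: "'n form rel \<Rightarrow> 'n form rel \<Rightarrow> 'n form rel" where
  "op_sum S T = {(u, form_add v w) | u v w. (u, v) \<in> S \<and> (u, w) \<in> T}"

text \<open>
  With the diagrammatic composition \<open>O\<close>, the operator \<open>S \<circ> T\<close> has the graph \<open>T O S\<close>.  In the top
  degree the first summand of the second equation is zero with domain everything, since there
  are no nonzero forms of degree \<open>n + 1\<close>.
\<close>

fun dbar_Laplacian :: "nat \<Rightarrow> 'n::{finite,linorder} form rel" where
  "dbar_Laplacian 0 = dbar 0 O dbar_adj 0"
| "dbar_Laplacian (Suc p) =
     op_sum (dbar (Suc p) O dbar_adj (Suc p)) (dbar_adj p O dbar p)"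

text \<open>
  \<open>\<mu>\<close> is in the resolvent set if \<open>T - \<mu>\<close> maps its domain bijectively onto the whole space and has a
  bounded inverse; the norm estimate contains injectivity.
\<close>

definition resolvent_set :: "nat \<Rightarrow> 'n::finite form rel \<Rightarrow> complex set" where
  "resolvent_set q T = {\<mu>.
     (\<forall>f\<in>L2_forms q. \<exists>(u, v)\<in>T. form_eq (form_add v (form_scale (- \<mu>) u)) f) \<and>
     (\<exists>C. \<forall>(u, v)\<in>T. form_norm q u \<le> C * form_norm q (form_add v (form_scale (- \<mu>) u)))}"

definition op_spectrum :: "nat \<Rightarrow> 'n::finite form rel \<Rightarrow> complex set" where
  "op_spectrum q T = - resolvent_set q T"

definition eigenspace :: "'n::finite form rel \<Rightarrow> complex \<Rightarrow> 'n form set" where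
  "eigenspace T \<mu> = {u. \<exists>v. (u, v) \<in> T \<and> form_eq v (form_scale \<mu> u)}"

definition eigenvalue :: "'n::finite form rel \<Rightarrow> complex \<Rightarrow> bool" where
  "eigenvalue T \<mu> \<longleftrightarrow> (\<exists>u\<in>eigenspace T \<mu>. \<not> form_eq u (\<lambda>J z. 0))"

text \<open>
  The dimension is that of the space of classes modulo equality almost everywhere: no finite
  subset of \<open>E\<close> spans \<open>E\<close> modulo null forms.
\<close>

definition infinite_dimensional :: "'n::finite form set \<Rightarrow> bool" where
  "infinite_dimensional E \<longleftrightarrow>
     \<not> (\<exists>B. finite B \<and> B \<subseteq> E \<and>
          (\<forall>u\<in>E. \<exists>c. form_eq u (\<lambda>J z. \<Sum>b\<in>B. c b * b J z)))"

end

theory Submission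
  imports Defs "HOL-Computational_Algebra.Polynomial" "HOL-Library.Function_Algebras"
begin

text \<open>
  The proof diagonalizes the Laplacian.  In one variable, the complex Hermite polynomials
  \<open>H\<^sub>a\<^sub>,\<^sub>b = (z\<^sup>* - \<partial>/\<partial>z)\<^sup>a z\<^sup>b\<close> (with \<open>z\<^sup>*\<close> the conjugate of \<open>z\<close>) are an orthogonal basis of \<open>L\<^sup>2\<close> of the Gaussian
  measure.  The operator \<open>\<partial>/\<partial>z\<^sup>*\<close> maps \<open>H\<^sub>a\<^sub>,\<^sub>b\<close> to \<open>a H\<^sub>a\<^sub>-\<^sub>1\<^sub>,\<^sub>b\<close>, and its adjoint maps \<open>H\<^sub>a\<^sub>,\<^sub>b\<close> to \<open>H\<^sub>a\<^sub>+\<^sub>1\<^sub>,\<^sub>b\<close>.  In several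
  variables the products \<open>Hermite \<alpha> \<beta>\<close> of these polynomials take over, and \<open>dbar\<close> lowers \<open>\<alpha>\<close> at an index \<open>j\<close>
  while it adds \<open>j\<close> to the index set \<open>J\<close> of the form.  So it preserves \<open>\<beta>\<close> and \<open>\<gamma> = \<alpha> + 1\<^sub>J\<close>, and \<open>L\<^sup>2\<close> splits into
  finite-dimensional blocks on which \<open>dbar\<close> is the differential of a Koszul complex.  By anticommutation, the
  Laplacian of this complex is multiplication by \<open>\<bar>\<gamma>\<bar> = \<bar>\<alpha>\<bar> + \<bar>J\<bar>\<close>: this is \<open>koszul_Laplacian\<close>.

  The eigenvalues in degree \<open>q = \<bar>J\<bar>\<close> are therefore the integers \<open>k \<ge> q\<close>, and each is attained for infinitely many
  \<open>\<beta>\<close>.  Any other complex number \<open>\<mu>\<close> has positive distance from these integers, so that division of the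
  coefficients by \<open>\<bar>\<gamma>\<bar> - \<mu>\<close> is a bounded inverse.

  What needs analysis is that the unbounded operators, with their maximal domains, really are given by the
  algebra of the coefficients.  A form \<open>v\<close> represents \<open>dbar u\<close> in the sense of distributions if and only if the
  coefficients of \<open>v\<close> are the Koszul differential of those of \<open>u\<close>.  One direction, \<open>dbar_coefficient\<close>, approximates
  polynomials by test functions with cutoffs; the other, \<open>dbarI\<close>, expands test functions in Hermite polynomials
  and uses Parseval's identity.  The adjoint has the corresponding description (\<open>dbar_adj_coefficient\<close> and \<open>dbar_adjI\<close>),
  and the Laplacian then acts on coefficients as multiplication by \<open>\<bar>\<gamma>\<bar>\<close>, with the largest domain on which this is
  possible (\<open>Laplacian_coefficient\<close> and \<open>dbar_LaplacianI\<close>).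

  Completeness of the basis is \<open>Hermite_complete\<close>: a function orthogonal to all polynomials is orthogonal to their
  products with arbitrarily narrow Gaussians with arbitrary centres, and these detect it almost everywhere.
\<close>

section \<open>Square integrable functions and orthogonal expansions\<close>

definition L2 :: "'a measure \<Rightarrow> ('a \<Rightarrow> complex) set" where
  "L2 M = {f. f \<in> borel_measurable M \<and> integrable M (\<lambda>x. (cmod (f x))\<^sup>2)}"

definition inner_L2 :: "'a measure \<Rightarrow> ('a \<Rightarrow> complex) \<Rightarrow> ('a \<Rightarrow> complex) \<Rightarrow> complex" where
  "inner_L2 M f g = (LINT x|M. f x * cnj (g x))"

lemma L2_measurable: "f \<in> L2 M \<Longrightarrow> f \<in> borel_measurable M"
  by (simp add: L2_def)

lemma L2_dominated:
  assumes "g \<in> L2 M" "f \<in> borel_measurable M" "AE x in M. cmod (f x) \<le> cmod (g x)"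
  shows "f \<in> L2 M"
proof -
  have "AE x in M. norm ((cmod (f x))\<^sup>2) \<le> norm ((cmod (g x))\<^sup>2)"
    using assms(3) by eventually_elim (simp add: power_mono)
  moreover have "integrable M (\<lambda>x. (cmod (g x))\<^sup>2)"
    using assms(1) by (simp add: L2_def)
  moreover have "(\<lambda>x. (cmod (f x))\<^sup>2) \<in> borel_measurable M"
    using assms(2) by measurable
  ultimately have "integrable M (\<lambda>x. (cmod (f x))\<^sup>2)"
    using Bochner_Integration.integrable_bound by blast
  then show ?thesis
    using assms(2) by (simp add: L2_def)
qed

lemma L2_zero [simp]: "(\<lambda>x. 0) \<in> L2 M"
  by (simp add: L2_def)

lemma L2_scale [intro]: "f \<in> L2 M \<Longrightarrow> (\<lambda>x. c * f x) \<in> L2 M"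
  by (auto simp: L2_def norm_mult power_mult_distrib)

lemma borel_measurable_cnj: "cnj \<in> borel_measurable borel"
  by (intro borel_measurable_continuous_onI bounded_linear.continuous_on[OF bounded_linear_cnj] continuous_on_id)

lemma borel_measurable_mult_cnj [measurable]:
  fixes f g :: "'a \<Rightarrow> complex"
  assumes "f \<in> borel_measurable M" "g \<in> borel_measurable M"
  shows "(\<lambda>x. f x * cnj (g x)) \<in> borel_measurable M"
  by (rule borel_measurable_times[OF assms(1) measurable_compose[OF assms(2) borel_measurable_cnj]])

lemma L2_cnj: "f \<in> L2 M \<Longrightarrow> (\<lambda>x. cnj (f x)) \<in> L2 M"
  using borel_measurable_cnj by (auto simp: L2_def intro: measurable_compose)

lemma L2_add [intro]:
  assumes "f \<in> L2 M" "g \<in> L2 M"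
  shows "(\<lambda>x. f x + g x) \<in> L2 M"
proof -
  have m [measurable]: "f \<in> borel_measurable M" "g \<in> borel_measurable M"
    using assms by (simp_all add: L2_def)
  have "integrable M (\<lambda>x. 2 * (cmod (f x))\<^sup>2 + 2 * (cmod (g x))\<^sup>2)"
    using assms by (simp add: L2_def)
  then have "integrable M (\<lambda>x. (cmod (f x + g x))\<^sup>2)"
  proof (rule Bochner_Integration.integrable_bound)
    have "(cmod (a + b))\<^sup>2 \<le> 2 * (cmod a)\<^sup>2 + 2 * (cmod b)\<^sup>2" for a b
    proof -
      have "(cmod (a + b))\<^sup>2 \<le> (cmod a + cmod b)\<^sup>2"
        by (intro power_mono norm_triangle_ineq norm_ge_zero)
      also have "\<dots> \<le> 2 * (cmod a)\<^sup>2 + 2 * (cmod b)\<^sup>2"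
        using sum_squares_bound[of "cmod a" "cmod b"] by (simp add: power2_sum)
      finally show ?thesis .
    qed
    then show "AE x in M. norm ((cmod (f x + g x))\<^sup>2) \<le> norm (2 * (cmod (f x))\<^sup>2 + 2 * (cmod (g x))\<^sup>2)"
      by (intro AE_I2) simp
  qed measurable
  then show ?thesis
    by (simp add: L2_def)
qed

lemma L2_sum: "finite I \<Longrightarrow> (\<And>i. i \<in> I \<Longrightarrow> f i \<in> L2 M) \<Longrightarrow> (\<lambda>x. \<Sum>i\<in>I. f i x) \<in> L2 M"
  by (induction I rule: finite_induct) auto

lemma L2_diff [intro]: "f \<in> L2 M \<Longrightarrow> g \<in> L2 M \<Longrightarrow> (\<lambda>x. f x - g x) \<in> L2 M"
  using L2_add[OF _ L2_scale[of g M "-1"], of f] by simp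

lemma mult_cmod_le_sum_squares: "cmod a * cmod b \<le> (cmod a)\<^sup>2 + (cmod b)\<^sup>2"
  using sum_squares_bound[of "cmod a" "cmod b"] mult_nonneg_nonneg[OF norm_ge_zero norm_ge_zero, of a b]
  by linarith

lemma integrable_L2_mult:
  assumes "f \<in> L2 M" "g \<in> L2 M"
  shows "integrable M (\<lambda>x. f x * g x)"
proof -
  have m [measurable]: "f \<in> borel_measurable M" "g \<in> borel_measurable M"
    using assms by (simp_all add: L2_def)
  have "integrable M (\<lambda>x. (cmod (f x))\<^sup>2 + (cmod (g x))\<^sup>2)"
    using assms by (simp add: L2_def)
  then show ?thesis
  proof (rule Bochner_Integration.integrable_bound)
    show "AE x in M. norm (f x * g x) \<le> norm ((cmod (f x))\<^sup>2 + (cmod (g x))\<^sup>2)"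
      by (intro AE_I2) (simp add: norm_mult mult_cmod_le_sum_squares)
  qed measurable
qed

lemma integrable_inner_L2:
  "f \<in> L2 M \<Longrightarrow> g \<in> L2 M \<Longrightarrow> integrable M (\<lambda>x. f x * cnj (g x))"
  by (intro integrable_L2_mult L2_cnj)

lemma inner_L2_add_left:
  "f \<in> L2 M \<Longrightarrow> g \<in> L2 M \<Longrightarrow> h \<in> L2 M \<Longrightarrow>
    inner_L2 M (\<lambda>x. f x + g x) h = inner_L2 M f h + inner_L2 M g h"
  by (simp add: inner_L2_def distrib_right integrable_inner_L2)

lemma inner_L2_diff_left:
  "f \<in> L2 M \<Longrightarrow> g \<in> L2 M \<Longrightarrow> h \<in> L2 M \<Longrightarrow>
    inner_L2 M (\<lambda>x. f x - g x) h = inner_L2 M f h - inner_L2 M g h"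
  by (simp add: inner_L2_def left_diff_distrib integrable_inner_L2)

lemma inner_L2_scale_left: "inner_L2 M (\<lambda>x. c * f x) h = c * inner_L2 M f h"
  by (simp add: inner_L2_def mult.assoc)

lemma inner_L2_cnj: "cnj (inner_L2 M f g) = inner_L2 M g f"
proof -
  have "inner_L2 M g f = (LINT x|M. cnj (f x * cnj (g x)))"
    by (simp add: inner_L2_def mult.commute del: Bochner_Integration.integral_cnj)
  then show ?thesis
    unfolding inner_L2_def by (simp only: Bochner_Integration.integral_cnj)
qed

lemma inner_L2_scale_right: "inner_L2 M f (\<lambda>x. c * h x) = cnj c * inner_L2 M f h"
  unfolding inner_L2_cnj[of M _ f, symmetric] by (simp add: inner_L2_scale_left)

lemma inner_L2_diff_right:
  assumes "f \<in> L2 M" "g \<in> L2 M" "h \<in> L2 M"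
  shows "inner_L2 M f (\<lambda>x. g x - h x) = inner_L2 M f g - inner_L2 M f h"
  unfolding inner_L2_cnj[of M _ f, symmetric] using assms by (simp add: inner_L2_diff_left)

lemma inner_L2_zero [simp]: "inner_L2 M (\<lambda>x. 0) f = 0" "inner_L2 M f (\<lambda>x. 0) = 0"
  by (simp_all add: inner_L2_def)

lemma inner_L2_sum_left:
  "finite I \<Longrightarrow> (\<And>i. i \<in> I \<Longrightarrow> f i \<in> L2 M) \<Longrightarrow> h \<in> L2 M \<Longrightarrow>
    inner_L2 M (\<lambda>x. \<Sum>i\<in>I. f i x) h = (\<Sum>i\<in>I. inner_L2 M (f i) h)"
  by (induction I rule: finite_induct) (auto simp: inner_L2_add_left L2_sum)

lemma inner_L2_self: "inner_L2 M f f = of_real (LINT x|M. (cmod (f x))\<^sup>2)"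
  unfolding inner_L2_def complex_norm_square[symmetric] by (rule integral_complex_of_real)

lemma inner_L2_cong_AE:
  assumes "f \<in> borel_measurable M" "f' \<in> borel_measurable M"
    "g \<in> borel_measurable M" "g' \<in> borel_measurable M"
    "AE x in M. f x = f' x" "AE x in M. g x = g' x"
  shows "inner_L2 M f g = inner_L2 M f' g'"
  unfolding inner_L2_def
proof (rule integral_cong_AE)
  show "(\<lambda>x. f x * cnj (g x)) \<in> borel_measurable M" "(\<lambda>x. f' x * cnj (g' x)) \<in> borel_measurable M"
    by (intro borel_measurable_mult_cnj assms)+
  show "AE x in M. f x * cnj (g x) = f' x * cnj (g' x)"
    using assms(5,6) by eventually_elim simp
qed

lemma norm_L2_eq_0_imp_AE:
  assumes "f \<in> L2 M" "inner_L2 M f f = 0"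
  shows "AE x in M. f x = 0"
proof -
  have "(LINT x|M. (cmod (f x))\<^sup>2) = 0"
    using assms(2) by (simp add: inner_L2_self del: of_real_power)
  then have "AE x in M. (cmod (f x))\<^sup>2 = 0"
    using assms(1) by (subst (asm) integral_nonneg_eq_0_iff_AE) (auto simp: L2_def)
  then show ?thesis
    by simp
qed

text \<open>Completeness of \<open>L\<^sup>2\<close>, in the form of a convergent series: geometric decay of the squared norms
  makes \<open>\<Sum> 2\<^sup>k \<bar>g\<^sub>k\<bar>\<^sup>2\<close> integrable, hence finite almost everywhere, and by the Cauchy-Schwarz inequality
  for sums its square root dominates all partial sums of \<open>\<Sum> g\<^sub>k\<close>.  Dominated convergence then gives
  the limit of the inner products.\<close>

lemma L2_series_limit:
  fixes g :: "nat \<Rightarrow> 'a \<Rightarrow> complex"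
  assumes g: "\<And>k. g k \<in> L2 M" and small: "\<And>k. (LINT x|M. (cmod (g k x))\<^sup>2) \<le> (1/4) ^ k"
  obtains f where "f \<in> L2 M"
    "\<And>h. h \<in> L2 M \<Longrightarrow> (\<lambda>k. inner_L2 M (\<lambda>x. \<Sum>i<k. g i x) h) \<longlonglongrightarrow> inner_L2 M f h"
proof -
  have gm [measurable]: "g k \<in> borel_measurable M" for k
    using g[of k] by (simp add: L2_def)
  have gi: "integrable M (\<lambda>x. (cmod (g k x))\<^sup>2)" for k
    using g[of k] by (simp add: L2_def)
  define w where "w k x = 2 ^ k * (cmod (g k x))\<^sup>2" for k x
  define W where "W x = (\<Sum>k. ennreal (w k x))" for x
  have wm [measurable]: "w k \<in> borel_measurable M" for k
    unfolding w_def by measurable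
  have Wm [measurable]: "W \<in> borel_measurable M"
    unfolding W_def by measurable
  have w0: "0 \<le> w k x" for k x
    by (simp add: w_def)
  have fin: "(\<integral>\<^sup>+x. W x \<partial>M) < \<infinity>"
  proof -
    have "(\<integral>\<^sup>+x. W x \<partial>M) = (\<Sum>k. \<integral>\<^sup>+x. ennreal (w k x) \<partial>M)"
      unfolding W_def by (rule nn_integral_suminf) measurable
    also have "\<dots> \<le> (\<Sum>k. ennreal ((1/2) ^ k))"
    proof (rule suminf_le)
      fix k
      have "(\<integral>\<^sup>+x. ennreal (w k x) \<partial>M) = ennreal (LINT x|M. w k x)"
        by (rule nn_integral_eq_integral) (use gi w0 in \<open>auto simp: w_def\<close>)
      also have "(LINT x|M. w k x) \<le> 2 ^ k * (1/4) ^ k"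
        unfolding w_def using small[of k] by simp
      also have "2 ^ k * (1/4) ^ k = (1/2::real) ^ k"
        by (simp flip: power_mult_distrib)
      finally show "(\<integral>\<^sup>+x. ennreal (w k x) \<partial>M) \<le> ennreal ((1/2) ^ k)"
        by (simp add: ennreal_leI)
    qed auto
    also have "\<dots> = ennreal (\<Sum>k. (1/2) ^ k)"
      by (rule suminf_ennreal2) (auto intro: summable_geometric)
    also have "\<dots> < \<infinity>" by simp
    finally show ?thesis .
  qed
  have AEfin: "AE x in M. W x \<noteq> \<infinity>"
    using nn_integral_PInf_AE[OF Wm] fin by simp
  define V where "V x = enn2real (W x)" for x
  have Vm [measurable]: "V \<in> borel_measurable M"
    unfolding V_def by measurable
  have V0: "0 \<le> V x" for x
    by (simp add: V_def)
  have Vi: "integrable M V"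
  proof (rule integrableI_nonneg)
    have "(\<integral>\<^sup>+x. ennreal (V x) \<partial>M) \<le> (\<integral>\<^sup>+x. W x \<partial>M)"
      unfolding V_def by (intro nn_integral_mono) (simp add: ennreal_enn2real_if)
    also have "\<dots> < \<infinity>" by (rule fin)
    finally show "(\<integral>\<^sup>+x. ennreal (V x) \<partial>M) < \<infinity>" .
  qed (auto simp: V0)
  have wV: "(\<Sum>i<k. w i x) \<le> V x" if "W x \<noteq> \<infinity>" for k x
  proof -
    have "ennreal (\<Sum>i<k. w i x) = (\<Sum>i<k. ennreal (w i x))"
      by (simp add: w0 sum_ennreal)
    also have "\<dots> \<le> W x"
      unfolding W_def by (rule sum_le_suminf) auto
    also have "W x = ennreal (V x)"
      using that by (simp add: V_def ennreal_enn2real_if)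
    finally show ?thesis
      by (simp add: V0)
  qed
  have sumbound: "(\<Sum>i<k. cmod (g i x)) \<le> sqrt (2 * V x)" if "W x \<noteq> \<infinity>" for k x
  proof (rule real_le_rsqrt)
    have "(\<Sum>i<k. cmod (g i x)) = (\<Sum>i<k. sqrt ((1/2) ^ i) * (sqrt (2 ^ i) * cmod (g i x)))"
      by (intro sum.cong refl) (simp flip: real_sqrt_mult mult.assoc power_mult_distrib)
    also have "\<dots>\<^sup>2 \<le> (\<Sum>i<k. (sqrt ((1/2) ^ i))\<^sup>2) * (\<Sum>i<k. (sqrt (2 ^ i) * cmod (g i x))\<^sup>2)"
      by (rule Cauchy_Schwarz_ineq_sum)
    also have "\<dots> = (\<Sum>i<k. (1/2) ^ i) * (\<Sum>i<k. w i x)"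
      by (simp add: w_def power_mult_distrib)
    also have "\<dots> \<le> 2 * V x"
    proof (rule mult_mono)
      have "(\<Sum>i<k. (1/2::real) ^ i) \<le> (\<Sum>i. (1/2) ^ i)"
        by (rule sum_le_suminf) (auto intro: summable_geometric)
      also have "\<dots> = 2"
        by (simp add: suminf_geometric)
      finally show "(\<Sum>i<k. (1/2::real) ^ i) \<le> 2" .
    qed (use wV[OF that] w0 in \<open>auto simp: sum_nonneg\<close>)
    finally show "(\<Sum>i<k. cmod (g i x))\<^sup>2 \<le> 2 * V x" .
  qed
  define S where "S k x = (\<Sum>i<k. g i x)" for k x
  have Sm [measurable]: "S k \<in> borel_measurable M" for k
    unfolding S_def by measurable
  have bound: "cmod (S k x) \<le> sqrt (2 * V x)" if "W x \<noteq> \<infinity>" for k x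
    unfolding S_def by (rule order_trans[OF norm_sum sumbound[OF that]])
  have conv: "convergent (\<lambda>k. S k x)" if "W x \<noteq> \<infinity>" for x
  proof -
    have "summable (\<lambda>i. cmod (g i x))"
      by (rule bounded_imp_summable[where B = "sqrt (2 * V x)"])
        (use sumbound[OF that, of "Suc k" for k] in \<open>auto simp: lessThan_Suc_atMost\<close>)
    then have "summable (\<lambda>i. g i x)"
      by (rule summable_norm_cancel)
    then show ?thesis
      unfolding S_def convergent_def summable_def sums_def by blast
  qed
  define f where "f x = (if convergent (\<lambda>k. S k x) then lim (\<lambda>k. S k x) else 0)" for x
  have lim: "(\<lambda>k. S k x) \<longlonglongrightarrow> f x" if "W x \<noteq> \<infinity>" for x
    using conv[OF that] by (simp add: f_def convergent_LIMSEQ_iff)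
  have fm [measurable]: "f \<in> borel_measurable M"
  proof -
    have "f = (\<lambda>x. if Cauchy (\<lambda>k. S k x) then lim (\<lambda>k. S k x) else 0)"
      by (auto simp: f_def fun_eq_iff Cauchy_convergent_iff)
    then show ?thesis
      by simp
  qed
  have AEf: "AE x in M. cmod (f x) \<le> cmod (of_real (sqrt (2 * V x)))"
    using AEfin
  proof eventually_elim
    case (elim x)
    have "cmod (f x) \<le> sqrt (2 * V x)"
      by (rule LIMSEQ_le_const2[OF tendsto_norm[OF lim[OF elim]]]) (use bound[OF elim] in auto)
    then show ?case
      by (simp add: V0)
  qed
  have dom: "(\<lambda>x. of_real (sqrt (2 * V x))) \<in> L2 M"
    using Vi by (simp add: L2_def V0 power_mult_distrib)
  have fL2: "f \<in> L2 M"
    by (rule L2_dominated[OF dom fm AEf])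
  have "(\<lambda>k. inner_L2 M (S k) h) \<longlonglongrightarrow> inner_L2 M f h" if h: "h \<in> L2 M" for h
    unfolding inner_L2_def
  proof (rule integral_dominated_convergence)
    have [measurable]: "h \<in> borel_measurable M"
      using h by (simp add: L2_def)
    show "(\<lambda>x. f x * cnj (h x)) \<in> borel_measurable M" "(\<lambda>x. S k x * cnj (h x)) \<in> borel_measurable M" for k
      by measurable
    show "integrable M (\<lambda>x. cmod (of_real (sqrt (2 * V x)) * h x))"
      by (intro integrable_norm integrable_L2_mult dom h)
    show "AE x in M. (\<lambda>k. S k x * cnj (h x)) \<longlonglongrightarrow> f x * cnj (h x)"
      using AEfin by eventually_elim (intro tendsto_intros lim)
    show "AE x in M. norm (S k x * cnj (h x)) \<le> cmod (of_real (sqrt (2 * V x)) * h x)" for k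
      using AEfin
    proof eventually_elim
      case (elim x)
      then show ?case
        using bound[OF elim, of k] by (simp add: norm_mult mult_right_mono V0)
    qed
  qed
  then show thesis
    using that fL2 by (simp add: S_def[abs_def])
qed

text \<open>Vectors are only assumed orthogonal, with squared norms \<open>N i\<close>: this keeps square roots out of
  the computations with Hermite polynomials.\<close>

locale orthogonal_family =
  fixes M :: "'a measure" and e :: "'i::countable \<Rightarrow> 'a \<Rightarrow> complex" and N :: "'i \<Rightarrow> real"
  assumes e_L2: "e i \<in> L2 M"
    and inner_e: "inner_L2 M (e i) (e j) = (if i = j then of_real (N i) else 0)"
    and N_pos: "N i > 0"
begin

lemma N_neq_0 [simp]: "N i \<noteq> 0"
  using N_pos[of i] by simp

lemma divide_N_mult_N: "c / complex_of_real (N i) * complex_of_real (N i) = c"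
  by simp

lemma inner_finite_sum:
  "finite F \<Longrightarrow> inner_L2 M (\<lambda>x. \<Sum>i\<in>F. c i * e i x) (e j) = (if j \<in> F then c j * of_real (N j) else 0)"
  by (subst inner_L2_sum_left)
    (auto simp: e_L2 L2_scale inner_L2_scale_left inner_e if_distrib cong: if_cong)

lemma norm_finite_sum:
  assumes "finite F"
  shows "(LINT x|M. (cmod (\<Sum>i\<in>F. c i * e i x))\<^sup>2) = (\<Sum>i\<in>F. (cmod (c i))\<^sup>2 * N i)"
proof -
  let ?s = "\<lambda>x. \<Sum>i\<in>F. c i * e i x"
  have s: "?s \<in> L2 M"
    using assms by (intro L2_sum L2_scale e_L2)
  have "inner_L2 M ?s ?s = (\<Sum>i\<in>F. c i * inner_L2 M (e i) ?s)"
    using assms s by (subst inner_L2_sum_left) (auto simp: e_L2 L2_scale inner_L2_scale_left)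
  also have "\<dots> = (\<Sum>i\<in>F. c i * cnj (inner_L2 M ?s (e i)))"
    by (simp add: inner_L2_cnj)
  also have "\<dots> = (\<Sum>i\<in>F. c i * cnj (c i) * of_real (N i))"
    by (intro sum.cong refl) (simp add: inner_finite_sum assms)
  also have "\<dots> = of_real (\<Sum>i\<in>F. (cmod (c i))\<^sup>2 * N i)"
    by (simp add: complex_norm_square del: of_real_power)
  finally show ?thesis
    by (simp only: inner_L2_self of_real_eq_iff)
qed

lemma Bessel_finite:
  assumes "f \<in> L2 M" "finite F"
  shows "(\<Sum>i\<in>F. (cmod (inner_L2 M f (e i)))\<^sup>2 / N i) \<le> (LINT x|M. (cmod (f x))\<^sup>2)"
proof -
  define c where "c i = inner_L2 M f (e i) / of_real (N i)" for i
  let ?s = "\<lambda>x. \<Sum>i\<in>F. c i * e i x"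
  let ?B = "\<Sum>i\<in>F. (cmod (inner_L2 M f (e i)))\<^sup>2 / N i"
  have s: "?s \<in> L2 M"
    using assms by (intro L2_sum L2_scale e_L2)
  have ss: "inner_L2 M ?s ?s = of_real ?B"
    unfolding inner_L2_self norm_finite_sum[OF assms(2)] of_real_eq_iff
    by (intro sum.cong refl) (simp add: c_def norm_divide power_divide power2_eq_square)
  have "inner_L2 M ?s f = (\<Sum>i\<in>F. c i * inner_L2 M (e i) f)"
    using assms s by (subst inner_L2_sum_left) (auto simp: e_L2 L2_scale inner_L2_scale_left)
  also have "\<dots> = of_real ?B"
    unfolding of_real_sum
  proof (intro sum.cong refl)
    fix i
    have "c i * inner_L2 M (e i) f = inner_L2 M f (e i) * cnj (inner_L2 M f (e i)) / of_real (N i)"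
      by (simp add: c_def inner_L2_cnj)
    then show "c i * inner_L2 M (e i) f = of_real ((cmod (inner_L2 M f (e i)))\<^sup>2 / N i)"
      by (simp add: complex_norm_square del: of_real_power)
  qed
  finally have sf: "inner_L2 M ?s f = of_real ?B" .
  then have fs: "inner_L2 M f ?s = of_real ?B"
    using inner_L2_cnj[of M ?s f] by simp
  have fsL: "(\<lambda>x. f x - ?s x) \<in> L2 M"
    using assms(1) s by (rule L2_diff)
  have "inner_L2 M (\<lambda>x. f x - ?s x) (\<lambda>x. f x - ?s x) = inner_L2 M f f - of_real ?B"
    using assms s fsL by (simp add: inner_L2_diff_left inner_L2_diff_right ss sf fs)
  then have "(LINT x|M. (cmod (f x - ?s x))\<^sup>2) = (LINT x|M. (cmod (f x))\<^sup>2) - ?B"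
    unfolding inner_L2_self of_real_diff[symmetric] of_real_eq_iff .
  moreover have "0 \<le> (LINT x|M. (cmod (f x - ?s x))\<^sup>2)"
    by (intro integral_nonneg_AE) simp
  ultimately show ?thesis
    by simp
qed

lemma Bessel:
  assumes "f \<in> L2 M"
  shows "(\<lambda>i. (cmod (inner_L2 M f (e i)))\<^sup>2 / N i) summable_on UNIV"
proof -
  have "(\<lambda>i. norm ((cmod (inner_L2 M f (e i)))\<^sup>2 / N i)) summable_on UNIV"
    unfolding abs_summable_iff_bdd_above
    by (rule bdd_aboveI2[where M = "LINT x|M. (cmod (f x))\<^sup>2"])
      (use Bessel_finite[OF assms] N_pos in \<open>auto simp: less_imp_le\<close>)
  then show ?thesis
    by (rule abs_summable_summable)
qed

text \<open>The Riesz-Fischer theorem.  The finite sets \<open>F k\<close> grow so fast that the blocks of the series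
  between them satisfy the hypothesis of the completeness lemma.\<close>

lemma Riesz_Fischer_sets:
  assumes "(\<lambda>i. (cmod (c i))\<^sup>2 / N i) summable_on UNIV"
  obtains f F where "f \<in> L2 M" "\<And>k. finite (F k)" "filterlim F (finite_subsets_at_top UNIV) sequentially"
    "\<And>h. h \<in> L2 M \<Longrightarrow>
       (\<lambda>k. inner_L2 M (\<lambda>x. \<Sum>i\<in>F k. c i / of_real (N i) * e i x) h) \<longlonglongrightarrow> inner_L2 M f h"
proof -
  let ?a = "\<lambda>i. (cmod (c i))\<^sup>2 / N i"
  have a0: "0 \<le> ?a i" for i
    using N_pos[of i] by simp
  have "\<exists>X. finite X \<and> (\<forall>Y. finite Y \<longrightarrow> X \<inter> Y = {} \<longrightarrow> sum ?a Y \<le> (1/4) ^ k)" for k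
  proof -
    obtain X where X: "finite X" "dist (sum ?a X) (infsum ?a UNIV) \<le> (1/4) ^ k"
      using infsum_finite_approximation[OF assms, of "(1/4) ^ k"] by auto
    have "sum ?a Y \<le> (1/4) ^ k" if "finite Y" "X \<inter> Y = {}" for Y
    proof -
      have "sum ?a X + sum ?a Y = sum ?a (X \<union> Y)"
        using that X by (simp add: sum.union_disjoint)
      also have "\<dots> \<le> infsum ?a UNIV"
        using that X assms a0 by (intro finite_sum_le_infsum) auto
      finally show ?thesis
        using X(2) by (simp add: dist_real_def)
    qed
    then show ?thesis
      using X(1) by blast
  qed
  then obtain X where X: "\<And>k. finite (X k)"
    "\<And>k Y. finite Y \<Longrightarrow> X k \<inter> Y = {} \<Longrightarrow> sum ?a Y \<le> (1/4) ^ k"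
    by metis
  define F where "F k = (case k of 0 \<Rightarrow> {} | Suc m \<Rightarrow> (\<Union>l\<le>m. X l) \<union> {i. to_nat i \<le> m})" for k
  have fin_le: "finite {i::'i. to_nat i \<le> m}" for m
    by (rule finite_imageD[of to_nat]) (auto intro: finite_subset[of _ "{..m}"] inj_on_subset[OF inj_to_nat])
  have F_fin: "finite (F k)" for k
    using X(1) fin_le by (auto simp: F_def split: nat.split)
  have F0: "F 0 = {}"
    by (simp add: F_def)
  have F_Suc: "F k \<subseteq> F (Suc k)" for k
    by (cases k) (auto simp: F_def le_Suc_eq)
  have F_mono: "F k \<subseteq> F l" if "k \<le> l" for k l
    using that F_Suc by (rule lift_Suc_mono_le[of F, rotated])
  have F_lim: "filterlim F (finite_subsets_at_top UNIV) sequentially"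
    unfolding filterlim_finite_subsets_at_top
  proof (intro allI impI)
    fix Y :: "'i set" assume "finite Y \<and> Y \<subseteq> UNIV"
    then obtain m where m: "\<And>i. i \<in> Y \<Longrightarrow> to_nat i \<le> m"
      by (meson finite_imageI finite_nat_set_iff_bounded_le imageI)
    then have "Y \<subseteq> F (Suc m)"
      by (auto simp: F_def)
    then have "Y \<subseteq> F k" if "k \<ge> Suc m" for k
      using F_mono[OF that] by blast
    then show "\<forall>\<^sub>F k in sequentially. finite (F k) \<and> Y \<subseteq> F k \<and> F k \<subseteq> UNIV"
      using F_fin by (auto simp: eventually_sequentially)
  qed
  \<comment> \<open>The block between \<open>F 0 = {}\<close> and \<open>F 1\<close> may have a large norm, so it is split off.\<close>
  define b where "b i = c i / of_real (N i)" for i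
  define g where "g k x = (\<Sum>i\<in>F (Suc (Suc k)) - F (Suc k). b i * e i x)" for k x
  have bN: "(\<Sum>i\<in>Y. (cmod (b i))\<^sup>2 * N i) = sum ?a Y" for Y
    by (intro sum.cong refl) (simp add: b_def norm_divide power_divide power2_eq_square)
  have gL2: "g k \<in> L2 M" for k
    unfolding g_def using F_fin by (intro L2_sum L2_scale e_L2) auto
  have "(LINT x|M. (cmod (g k x))\<^sup>2) \<le> (1/4) ^ k" for k
  proof -
    have fin: "finite (F (Suc (Suc k)) - F (Suc k))"
      using F_fin by simp
    have "X k \<subseteq> F (Suc k)"
      by (auto simp: F_def)
    then have "sum ?a (F (Suc (Suc k)) - F (Suc k)) \<le> (1/4) ^ k"
      using fin by (intro X(2)) auto
    then show ?thesis
      unfolding g_def norm_finite_sum[OF fin] bN .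
  qed
  then obtain f0 where f0: "f0 \<in> L2 M"
    "\<And>h. h \<in> L2 M \<Longrightarrow> (\<lambda>k. inner_L2 M (\<lambda>x. \<Sum>i<k. g i x) h) \<longlonglongrightarrow> inner_L2 M f0 h"
    by (rule L2_series_limit[OF gL2]) (rule that)
  define s where "s k x = (\<Sum>i\<in>F k. b i * e i x)" for k x
  have sL2: "s k \<in> L2 M" for k
    unfolding s_def using F_fin by (intro L2_sum L2_scale e_L2) auto
  have part: "(\<lambda>x. s (Suc k) x) = (\<lambda>x. s 1 x + (\<Sum>i<k. g i x))" for k
  proof (induction k)
    case (Suc k)
    have "s (Suc (Suc k)) x = s (Suc k) x + g k x" for x
      unfolding s_def g_def using sum.subset_diff[OF F_Suc[of "Suc k"] F_fin]
      by (simp add: add.commute)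
    then show ?case
      using Suc by (auto simp: fun_eq_iff)
  qed simp
  define f where "f x = s 1 x + f0 x" for x
  have fL2: "f \<in> L2 M"
    unfolding f_def by (intro L2_add sL2 f0)
  have "(\<lambda>k. inner_L2 M (s k) h) \<longlonglongrightarrow> inner_L2 M f h" if h: "h \<in> L2 M" for h
  proof (rule LIMSEQ_imp_Suc)
    have "inner_L2 M (s (Suc k)) h = inner_L2 M (s 1) h + inner_L2 M (\<lambda>x. \<Sum>i<k. g i x) h" for k
      unfolding part[of k] by (intro inner_L2_add_left sL2 h L2_sum gL2) auto
    moreover have "inner_L2 M f h = inner_L2 M (s 1) h + inner_L2 M f0 h"
      unfolding f_def by (intro inner_L2_add_left sL2 f0 h)
    ultimately show "(\<lambda>k. inner_L2 M (s (Suc k)) h) \<longlonglongrightarrow> inner_L2 M f h"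
      by (simp only:) (intro tendsto_add tendsto_const f0(2) h)
  qed
  then show thesis
    using that[OF fL2 F_fin F_lim] by (simp add: s_def[abs_def] b_def)
qed

lemma Riesz_Fischer:
  assumes "(\<lambda>i. (cmod (c i))\<^sup>2 / N i) summable_on UNIV"
  obtains f where "f \<in> L2 M" "\<And>i. inner_L2 M f (e i) = c i"
proof -
  obtain f F where f: "f \<in> L2 M" and F: "\<And>k. finite (F k)"
      "filterlim F (finite_subsets_at_top UNIV) sequentially"
    and lim: "\<And>h. h \<in> L2 M \<Longrightarrow>
      (\<lambda>k. inner_L2 M (\<lambda>x. \<Sum>i\<in>F k. c i / of_real (N i) * e i x) h) \<longlonglongrightarrow> inner_L2 M f h"
    by (rule Riesz_Fischer_sets[OF assms], rule that)
  have "inner_L2 M f (e i) = c i" for i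
  proof (rule LIMSEQ_unique[OF lim[OF e_L2]])
    have "\<forall>\<^sub>F k in sequentially. i \<in> F k"
      using F(2) unfolding filterlim_finite_subsets_at_top
      by (elim allE[of _ "{i}"]) (auto elim: eventually_mono)
    then have "\<forall>\<^sub>F k in sequentially.
        inner_L2 M (\<lambda>x. \<Sum>i\<in>F k. c i / of_real (N i) * e i x) (e i) = c i"
      by eventually_elim (use F(1) in \<open>simp add: inner_finite_sum divide_N_mult_N del: times_divide_eq_left\<close>)
    then show "(\<lambda>k. inner_L2 M (\<lambda>x. \<Sum>i\<in>F k. c i / of_real (N i) * e i x) (e i)) \<longlonglongrightarrow> c i"
      by (rule tendsto_eventually)
  qed
  with f show thesis
    using that by blast
qed

end

locale orthogonal_basis = orthogonal_family +
  assumes complete: "f \<in> L2 M \<Longrightarrow> (\<And>i. inner_L2 M f (e i) = 0) \<Longrightarrow> AE x in M. f x = 0"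
begin

lemma AE_eq_if_coefficients_eq:
  assumes "f \<in> L2 M" "g \<in> L2 M" "\<And>i. inner_L2 M f (e i) = inner_L2 M g (e i)"
  shows "AE x in M. f x = g x"
proof -
  have "AE x in M. f x - g x = 0"
    by (rule complete) (use assms in \<open>auto simp: inner_L2_diff_left e_L2\<close>)
  then show ?thesis by simp
qed

text \<open>The function that Riesz-Fischer constructs from the coefficients of \<open>f\<close> has the same coefficients, hence it
  is \<open>f\<close>; so \<open>f\<close> is the weak limit of the partial sums of its expansion.\<close>

lemma Parseval:
  assumes f: "f \<in> L2 M" and g: "g \<in> L2 M"
  shows "((\<lambda>i. inner_L2 M f (e i) * cnj (inner_L2 M g (e i)) / of_real (N i))
    has_sum inner_L2 M f g) UNIV"
proof -
  let ?x = "\<lambda>i. inner_L2 M f (e i) * cnj (inner_L2 M g (e i)) / of_real (N i)"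
  obtain f' F where f': "f' \<in> L2 M" and F: "\<And>k. finite (F k)"
      "filterlim F (finite_subsets_at_top UNIV) sequentially"
    and lim: "\<And>h. h \<in> L2 M \<Longrightarrow>
      (\<lambda>k. inner_L2 M (\<lambda>x. \<Sum>i\<in>F k. inner_L2 M f (e i) / of_real (N i) * e i x) h) \<longlonglongrightarrow> inner_L2 M f' h"
    by (rule Riesz_Fischer_sets[OF Bessel[OF f]], rule that)
  have "inner_L2 M f (e i) = inner_L2 M f' (e i)" for i
  proof (rule LIMSEQ_unique[OF _ lim[OF e_L2]])
    have "\<forall>\<^sub>F k in sequentially. i \<in> F k"
      using F(2) unfolding filterlim_finite_subsets_at_top
      by (elim allE[of _ "{i}"]) (auto elim: eventually_mono)
    then have "\<forall>\<^sub>F k in sequentially. inner_L2 M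
        (\<lambda>x. \<Sum>i\<in>F k. inner_L2 M f (e i) / of_real (N i) * e i x) (e i) = inner_L2 M f (e i)"
      by eventually_elim (use F(1) in \<open>simp add: inner_finite_sum divide_N_mult_N del: times_divide_eq_left\<close>)
    then show "(\<lambda>k. inner_L2 M (\<lambda>x. \<Sum>i\<in>F k. inner_L2 M f (e i) / of_real (N i) * e i x) (e i))
        \<longlonglongrightarrow> inner_L2 M f (e i)"
      by (rule tendsto_eventually)
  qed
  then have "AE x in M. f x = f' x"
    by (intro AE_eq_if_coefficients_eq f f')
  then have ff': "inner_L2 M f' g = inner_L2 M f g"
    using f f' g by (intro inner_L2_cong_AE) (auto simp: L2_measurable)
  have "inner_L2 M (\<lambda>x. \<Sum>i\<in>F k. inner_L2 M f (e i) / of_real (N i) * e i x) g = sum ?x (F k)" for k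
    using F(1) g
    by (subst inner_L2_sum_left)
      (simp_all add: e_L2 L2_scale inner_L2_scale_left inner_L2_cnj del: times_divide_eq_left, simp)
  then have lim_x: "(\<lambda>k. sum ?x (F k)) \<longlonglongrightarrow> inner_L2 M f g"
    using lim[OF g] ff' by simp
  have "(\<lambda>i. norm (?x i)) summable_on UNIV"
  proof (rule Infinite_Sum.abs_summable_on_comparison_test)
    let ?y = "\<lambda>i. (cmod (inner_L2 M f (e i)))\<^sup>2 / N i + (cmod (inner_L2 M g (e i)))\<^sup>2 / N i"
    have "?y summable_on UNIV"
      by (intro summable_on_add Bessel f g)
    then show "(\<lambda>i. norm (?y i)) summable_on UNIV"
      by (rule summable_on_iff_abs_summable_on_real[THEN iffD1])
    fix i
    show "norm (?x i) \<le> norm (?y i)"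
      unfolding add_divide_distrib[symmetric] using N_pos[of i]
      by (simp add: norm_mult norm_divide divide_right_mono mult_cmod_le_sum_squares)
  qed
  then have sx: "(?x has_sum infsum ?x UNIV) UNIV"
    by (rule has_sum_infsum[OF abs_summable_summable])
  then have "(\<lambda>k. sum ?x (F k)) \<longlonglongrightarrow> infsum ?x UNIV"
    unfolding has_sum_def by (rule filterlim_compose[OF _ F(2)])
  then have "infsum ?x UNIV = inner_L2 M f g"
    by (rule LIMSEQ_unique[OF _ lim_x])
  with sx show ?thesis
    by simp
qed

end

section \<open>Smooth functions and test functions\<close>

lemma C_k_SucI:
  assumes "\<And>x. (f has_derivative f' x) (at x)" "\<And>v. C_k k (\<lambda>x. f' x v)"
  shows "C_k (Suc k) f"
proof -
  have "frechet_derivative f (at x) = f' x" for x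
    using frechet_derivative_at[OF assms(1)] by simp
  then show ?thesis
    using assms by (auto simp: differentiable_def)
qed

lemma C_k_Suc_has_derivative:
  "C_k (Suc k) f \<Longrightarrow> (f has_derivative frechet_derivative f (at x)) (at x)"
  by (simp add: frechet_derivative_works[symmetric])

lemma C_k_Suc_imp: "C_k (Suc k) f \<Longrightarrow> C_k k f"
proof (induction k arbitrary: f)
  case 0
  then show ?case
    by (auto simp: continuous_on_eq_continuous_at intro: differentiable_imp_continuous_within)
next
  case (Suc k)
  then show ?case
    by (metis C_k.simps(2))
qed

lemma C_k_imp_continuous: "C_k k f \<Longrightarrow> continuous_on UNIV f"
  by (induction k) (use C_k_Suc_imp in auto)

lemma C_k_const: "C_k k (\<lambda>x. c)"
proof (induction k arbitrary: c)
  case (Suc k)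
  show ?case
    by (rule C_k_SucI[where f' = "\<lambda>_ _. 0"]) (auto intro: Suc)
qed simp

lemma C_k_bounded_linear:
  assumes "bounded_linear f"
  shows "C_k k f"
proof (cases k)
  case 0
  then show ?thesis
    by (simp add: assms linear_continuous_on)
next
  case (Suc m)
  show ?thesis
    unfolding Suc
    by (rule C_k_SucI[where f' = "\<lambda>_. f"]) (auto intro: bounded_linear_imp_has_derivative assms C_k_const)
qed

lemma C_k_compose_bounded_linear:
  assumes "bounded_linear L"
  shows "C_k k f \<Longrightarrow> C_k k (\<lambda>x. L (f x))"
proof (induction k arbitrary: f)
  case 0
  then show ?case
    by (simp add: assms bounded_linear.continuous_on)
next
  case (Suc k)
  show ?case
  proof (rule C_k_SucI[where f' = "\<lambda>x v. L (frechet_derivative f (at x) v)"])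
    show "((\<lambda>x. L (f x)) has_derivative (\<lambda>v. L (frechet_derivative f (at x) v))) (at x)" for x
      by (rule bounded_linear.has_derivative[OF assms C_k_Suc_has_derivative[OF Suc.prems]])
    show "C_k k (\<lambda>x. L (frechet_derivative f (at x) v))" for v
      using Suc by simp
  qed
qed

lemma C_k_add: "C_k k f \<Longrightarrow> C_k k g \<Longrightarrow> C_k k (\<lambda>x. f x + g x)"
proof (induction k arbitrary: f g)
  case 0
  then show ?case
    by (simp add: continuous_on_add)
next
  case (Suc k)
  show ?case
  proof (rule C_k_SucI)
    show "((\<lambda>x. f x + g x) has_derivative
        (\<lambda>v. frechet_derivative f (at x) v + frechet_derivative g (at x) v)) (at x)" for x
      by (rule has_derivative_add[OF C_k_Suc_has_derivative[OF Suc.prems(1)] C_k_Suc_has_derivative[OF Suc.prems(2)]])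
    show "C_k k (\<lambda>x. frechet_derivative f (at x) v + frechet_derivative g (at x) v)" for v
      using Suc by simp
  qed
qed

lemma C_k_mult:
  fixes f g :: "'a::real_normed_vector \<Rightarrow> 'b::real_normed_algebra"
  shows "C_k k f \<Longrightarrow> C_k k g \<Longrightarrow> C_k k (\<lambda>x. f x * g x)"
proof (induction k arbitrary: f g)
  case 0
  then show ?case
    by (simp add: continuous_on_mult)
next
  case (Suc k)
  show ?case
  proof (rule C_k_SucI)
    show "((\<lambda>x. f x * g x) has_derivative
        (\<lambda>v. f x * frechet_derivative g (at x) v + frechet_derivative f (at x) v * g x)) (at x)" for x
      by (rule has_derivative_mult[OF C_k_Suc_has_derivative[OF Suc.prems(1)] C_k_Suc_has_derivative[OF Suc.prems(2)]])
    show "C_k k (\<lambda>x. f x * frechet_derivative g (at x) v + frechet_derivative f (at x) v * g x)" for v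
      using Suc.prems C_k_Suc_imp[OF Suc.prems(1)] C_k_Suc_imp[OF Suc.prems(2)]
      by (intro C_k_add Suc.IH) auto
  qed
qed

definition smooth :: "('a::real_normed_vector \<Rightarrow> 'b::real_normed_vector) \<Rightarrow> bool" where
  "smooth f \<longleftrightarrow> (\<forall>k. C_k k f)"

lemma smooth_const [simp]: "smooth (\<lambda>x. c)"
  by (simp add: smooth_def C_k_const)

lemma smooth_bounded_linear: "bounded_linear f \<Longrightarrow> smooth f"
  by (simp add: smooth_def C_k_bounded_linear)

lemma smooth_compose_bounded_linear: "bounded_linear L \<Longrightarrow> smooth f \<Longrightarrow> smooth (\<lambda>x. L (f x))"
  by (simp add: smooth_def C_k_compose_bounded_linear)

lemma smooth_add: "smooth f \<Longrightarrow> smooth g \<Longrightarrow> smooth (\<lambda>x. f x + g x)"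
  by (simp add: smooth_def C_k_add)

lemma smooth_mult:
  fixes f g :: "'a::real_normed_vector \<Rightarrow> 'b::real_normed_algebra"
  shows "smooth f \<Longrightarrow> smooth g \<Longrightarrow> smooth (\<lambda>x. f x * g x)"
  by (simp add: smooth_def C_k_mult)

lemma smooth_diff:
  fixes f g :: "'a::real_normed_vector \<Rightarrow> 'b::real_normed_algebra_1"
  assumes "smooth f" "smooth g"
  shows "smooth (\<lambda>x. f x - g x)"
  using smooth_add[OF assms(1) smooth_mult[OF smooth_const[of "-1"] assms(2)]] by simp

lemma smooth_sum: "finite I \<Longrightarrow> (\<And>i. i \<in> I \<Longrightarrow> smooth (f i)) \<Longrightarrow> smooth (\<lambda>x. \<Sum>i\<in>I. f i x)"
  by (induction I rule: finite_induct) (auto intro: smooth_add)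

lemma smooth_prod:
  fixes f :: "'i \<Rightarrow> 'a::real_normed_vector \<Rightarrow> 'b::{real_normed_algebra, comm_ring_1}"
  shows "finite I \<Longrightarrow> (\<And>i. i \<in> I \<Longrightarrow> smooth (f i)) \<Longrightarrow> smooth (\<lambda>x. \<Prod>i\<in>I. f i x)"
  by (induction I rule: finite_induct) (auto intro: smooth_mult)

lemma smooth_power:
  fixes f :: "'a::real_normed_vector \<Rightarrow> 'b::real_normed_algebra_1"
  shows "smooth f \<Longrightarrow> smooth (\<lambda>x. f x ^ n)"
  by (induction n) (auto intro: smooth_mult)

lemma smooth_imp_differentiable: "smooth f \<Longrightarrow> f differentiable (at x)"
  unfolding smooth_def by (metis C_k.simps(2))

lemma smooth_has_derivative: "smooth f \<Longrightarrow> (f has_derivative frechet_derivative f (at x)) (at x)"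
  using smooth_imp_differentiable frechet_derivative_works by blast

lemma smooth_frechet_derivative: "smooth f \<Longrightarrow> smooth (\<lambda>x. frechet_derivative f (at x) v)"
  unfolding smooth_def by (metis C_k.simps(2))

lemma smooth_imp_continuous: "smooth f \<Longrightarrow> continuous_on UNIV f"
  by (auto simp: smooth_def dest: C_k_imp_continuous)

lemma smooth_measurable: "smooth f \<Longrightarrow> f \<in> borel_measurable borel"
  by (intro borel_measurable_continuous_onI smooth_imp_continuous)

lemma smooth_exp:
  fixes f :: "'a::real_normed_vector \<Rightarrow> complex"
  assumes "smooth f"
  shows "smooth (\<lambda>x. exp (f x))"
  unfolding smooth_def
proof
  fix k
  show "C_k k (\<lambda>x. exp (f x))"
  proof (induction k)
    case 0
    then show ?case
      using smooth_imp_continuous[OF assms] by (auto intro: continuous_intros)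
  next
    case (Suc k)
    show ?case
    proof (rule C_k_SucI)
      show "((\<lambda>x. exp (f x)) has_derivative (\<lambda>v. exp (f x) * frechet_derivative f (at x) v)) (at x)" for x
      proof -
        have "(exp has_derivative (\<lambda>h. exp (f x) * h)) (at (f x))"
          using DERIV_exp[of "f x"] by (simp add: has_field_derivative_def)
        from has_derivative_compose[OF smooth_has_derivative[OF assms, of x] this]
        show ?thesis .
      qed
      show "C_k k (\<lambda>x. exp (f x) * frechet_derivative f (at x) v)" for v
        using Suc smooth_frechet_derivative[OF assms] by (intro C_k_mult) (auto simp: smooth_def)
    qed
  qed
qed

text \<open>The derivative of \<open>P(1/t) exp(-1/t)\<close> is again of this form; so the family of these functions,
  extended by zero to \<open>t \<le> 0\<close>, consists of smooth functions.\<close>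

definition flat_exp :: "real poly \<Rightarrow> real \<Rightarrow> real" where
  "flat_exp P t = (if t \<le> 0 then 0 else poly P (1 / t) * exp (- (1 / t)))"

lemma poly_times_exp_minus_tendsto_0: "((\<lambda>x. poly P x * exp (- x)) \<longlongrightarrow> 0) at_top" for P :: "real poly"
proof -
  have "((\<lambda>x. \<Sum>i\<le>degree P. coeff P i * (x ^ i / exp x)) \<longlongrightarrow> (\<Sum>i\<le>degree P. coeff P i * 0)) at_top"
    by (intro tendsto_intros tendsto_power_div_exp_0)
  moreover have "(\<lambda>x. poly P x * exp (- x)) = (\<lambda>x. \<Sum>i\<le>degree P. coeff P i * (x ^ i / exp x))"
    by (simp add: fun_eq_iff poly_altdef exp_minus divide_inverse sum_distrib_right mult.assoc)
  ultimately show ?thesis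
    by simp
qed

lemma flat_exp_has_derivative:
  "(flat_exp P has_real_derivative flat_exp ([:0, 0, 1:] * (P - pderiv P)) t) (at t)"
proof -
  consider "t < 0" | "t > 0" | "t = 0" by linarith
  then show ?thesis
  proof cases
    case 1
    have "((\<lambda>t. 0) has_real_derivative 0) (at t)" by simp
    then have "(flat_exp P has_real_derivative 0) (at t)"
      by (rule DERIV_cong_ev[THEN iffD1, rotated 3])
        (use 1 in \<open>auto simp: flat_exp_def eventually_at_topological intro!: exI[of _ "{..<0}"] eventually_nhds[THEN iffD2]\<close>)
    then show ?thesis
      using 1 by (simp add: flat_exp_def)
  next
    case 2
    have "((\<lambda>t. poly P (1 / t) * exp (- (1 / t))) has_real_derivative
        poly ([:0, 0, 1:] * (P - pderiv P)) (1 / t) * exp (- (1 / t))) (at t)"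
      using 2 by (auto intro!: derivative_eq_intros poly_DERIV[THEN DERIV_chain2]
          simp: field_simps power2_eq_square)
    then have "(flat_exp P has_real_derivative
        poly ([:0, 0, 1:] * (P - pderiv P)) (1 / t) * exp (- (1 / t))) (at t)"
      by (rule DERIV_cong_ev[THEN iffD1, rotated 3])
        (use 2 in \<open>auto simp: flat_exp_def intro!: exI[of _ "{0<..}"] eventually_nhds[THEN iffD2]\<close>)
    then show ?thesis
      using 2 by (simp add: flat_exp_def)
  next
    case 3
    have "((\<lambda>y. flat_exp P y / y) \<longlongrightarrow> 0) (at 0)"
    proof (rule filterlim_split_at)
      show "((\<lambda>y. flat_exp P y / y) \<longlongrightarrow> 0) (at_left 0)"
        by (rule tendsto_eventually) (auto simp: eventually_at_left_field flat_exp_def intro: exI[of _ "-1"])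
      have "\<forall>\<^sub>F x in at_top. poly (pCons 0 P) x * exp (- x) = flat_exp P (inverse x) / inverse x"
        using eventually_gt_at_top[of "0::real"]
        by eventually_elim (simp add: flat_exp_def field_simps)
      then have "((\<lambda>x. flat_exp P (inverse x) / inverse x) \<longlongrightarrow> 0) at_top"
        using poly_times_exp_minus_tendsto_0[of "pCons 0 P"] by (rule Lim_transform_eventually[rotated])
      then show "((\<lambda>y. flat_exp P y / y) \<longlongrightarrow> 0) (at_right 0)"
        by (simp add: filterlim_at_right_to_top)
    qed
    then show ?thesis
      using 3 by (simp add: has_field_derivative_iff flat_exp_def)
  qed
qed

lemma smooth_flat_exp:
  fixes r :: "'a::real_normed_vector \<Rightarrow> real"
  assumes "smooth r"
  shows "smooth (\<lambda>x. flat_exp P (r x))"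
  unfolding smooth_def
proof
  fix k
  show "C_k k (\<lambda>x. flat_exp P (r x))"
  proof (induction k arbitrary: P)
    case 0
    have "continuous_on UNIV (flat_exp P)"
      using flat_exp_has_derivative by (intro DERIV_continuous_on) (auto intro: has_field_derivative_at_within)
    then show ?case
      using smooth_imp_continuous[OF assms] by (auto intro: continuous_on_compose2)
  next
    case (Suc k)
    let ?Q = "[:0, 0, 1:] * (P - pderiv P)"
    show ?case
    proof (rule C_k_SucI)
      show "((\<lambda>x. flat_exp P (r x)) has_derivative (\<lambda>v. flat_exp ?Q (r x) * frechet_derivative r (at x) v)) (at x)" for x
      proof -
        have "(flat_exp P has_derivative (\<lambda>h. flat_exp ?Q (r x) * h)) (at (r x))"
          using flat_exp_has_derivative[of P "r x"] by (simp add: has_field_derivative_def)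
        from has_derivative_compose[OF smooth_has_derivative[OF assms, of x] this]
        show ?thesis .
      qed
      show "C_k k (\<lambda>x. flat_exp ?Q (r x) * frechet_derivative r (at x) v)" for v
        using Suc smooth_frechet_derivative[OF assms] by (intro C_k_mult) (auto simp: smooth_def)
    qed
  qed
qed

lemma test_function_smooth: "test_function f \<Longrightarrow> smooth f"
  by (simp add: test_function_def smooth_def)

lemma test_functionI:
  fixes f :: "'a::euclidean_space \<Rightarrow> complex"
  assumes "smooth f" "compact K" "\<And>x. x \<notin> K \<Longrightarrow> f x = 0"
  shows "test_function f"
proof -
  have "closure {x. f x \<noteq> 0} \<subseteq> K"
    using assms(2,3) by (intro closure_minimal) (auto intro: compact_imp_closed)
  then have "compact (closure {x. f x \<noteq> 0})"
    using assms(2) by (metis closed_closure closed_subset closedin_compact)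
  then show ?thesis
    using assms(1) by (simp add: test_function_def smooth_def)
qed

lemma test_function_support:
  "test_function f \<Longrightarrow> compact (closure {x. f x \<noteq> 0})"
  by (simp add: test_function_def)

lemma notin_support_imp_0: "x \<notin> closure {x. f x \<noteq> 0} \<Longrightarrow> f x = 0"
  using closure_subset[of "{x. f x \<noteq> 0}"] by auto

lemma test_function_mult_smooth:
  fixes f :: "'a::euclidean_space \<Rightarrow> complex"
  assumes "test_function f" "smooth g"
  shows "test_function (\<lambda>x. f x * g x)"
  by (rule test_functionI[OF smooth_mult[OF test_function_smooth[OF assms(1)] assms(2)]
        test_function_support[OF assms(1)]]) (drule notin_support_imp_0, simp)

lemma has_derivative_0_outside_support:
  assumes "x \<notin> closure {x. f x \<noteq> 0}"
  shows "(f has_derivative (\<lambda>_. 0)) (at x)"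
proof (rule has_derivative_transform_within_open[of "\<lambda>_. 0"])
  show "((\<lambda>_. 0) has_derivative (\<lambda>_. 0)) (at x)"
    by (rule has_derivative_const)
  show "open (- closure {x. f x \<noteq> 0})"
    by (rule open_Compl[OF closed_closure])
  show "x \<in> - closure {x. f x \<noteq> 0}"
    unfolding Compl_iff by (rule assms)
  show "0 = f y" if "y \<in> - closure {x. f x \<noteq> 0}" for y
    using notin_support_imp_0[OF that[unfolded Compl_iff]] by (rule sym)
qed

lemma test_function_frechet_derivative:
  fixes f :: "'a::euclidean_space \<Rightarrow> complex"
  assumes "test_function f"
  shows "test_function (\<lambda>x. frechet_derivative f (at x) v)"
proof (rule test_functionI[OF smooth_frechet_derivative test_function_support[OF assms]])
  show "smooth f"
    by (rule test_function_smooth[OF assms])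
  fix x assume x: "x \<notin> closure {x. f x \<noteq> 0}"
  have hd: "(f has_derivative (\<lambda>_. 0)) (at x)"
    by (rule has_derivative_0_outside_support[OF x])
  show "frechet_derivative f (at x) v = 0"
    using fun_cong[OF frechet_derivative_at[OF hd], of v] by simp
qed

lemma test_function_bounded:
  fixes f :: "'a::euclidean_space \<Rightarrow> complex"
  assumes "test_function f"
  obtains B where "\<And>x. cmod (f x) \<le> B"
proof -
  let ?K = "closure {x. f x \<noteq> 0}"
  have "compact (f ` ?K)"
    using test_function_support[OF assms] smooth_imp_continuous[OF test_function_smooth[OF assms]]
    by (meson compact_continuous_image continuous_on_subset subset_UNIV)
  then have "\<exists>B>0. \<forall>y\<in>f ` ?K. cmod y \<le> B"
    by (rule bounded_pos[THEN iffD1, OF compact_imp_bounded])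
  then obtain B where B: "B > 0" "\<forall>y\<in>f ` ?K. cmod y \<le> B"
    by (elim exE conjE) (rule that)
  have "cmod (f x) \<le> B" for x
  proof (cases "x \<in> ?K")
    case True
    then show ?thesis
      using B(2) by blast
  next
    case False
    then have "f x = 0"
      by (rule notin_support_imp_0)
    then show ?thesis
      using B(1) by simp
  qed
  then show thesis
    by (rule that)
qed

lemma test_function_integrable:
  fixes f :: "'a::euclidean_space \<Rightarrow> complex"
  assumes "test_function f"
  shows "integrable lborel f"
proof -
  let ?K = "closure {x. f x \<noteq> 0}"
  have "integrable lborel (\<lambda>x. indicator ?K x *\<^sub>R f x)"
    by (rule borel_integrable_compact)
      (use test_function_support[OF assms] smooth_imp_continuous[OF test_function_smooth[OF assms]] in
        \<open>auto intro: continuous_on_subset\<close>)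
  moreover have "(\<lambda>x. indicator ?K x *\<^sub>R f x) = f"
  proof
    show "indicator ?K x *\<^sub>R f x = f x" for x
      using notin_support_imp_0[of x f] by (cases "x \<in> ?K") simp_all
  qed
  ultimately show ?thesis
    by simp
qed

lemma lborel_integral_translate:
  fixes f :: "'a::euclidean_space \<Rightarrow> 'b::{banach, second_countable_topology}"
  assumes "f \<in> borel_measurable borel"
  shows "(LINT x|lborel. f (c + x)) = (LINT x|lborel. f x)"
    and "integrable lborel f \<Longrightarrow> integrable lborel (\<lambda>x. f (c + x))"
proof -
  have "(LINT x|lborel. f x) = (LINT x|distr lborel borel ((+) c). f x)"
    by (simp add: lborel_distr_plus)
  also have "\<dots> = (LINT x|lborel. f (c + x))"
    using assms by (subst integral_distr) auto
  finally show "(LINT x|lborel. f (c + x)) = (LINT x|lborel. f x)" ..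
  assume "integrable lborel f"
  then have "integrable (distr lborel borel ((+) c)) f"
    by (simp add: lborel_distr_plus)
  then show "integrable lborel (\<lambda>x. f (c + x))"
    using assms by (subst (asm) integrable_distr_eq) auto
qed

text \<open>The difference quotients have integral zero by translation invariance, and they are dominated
  by a constant on a fixed ball.\<close>

lemma integral_derivative_test_function:
  fixes f :: "'a::euclidean_space \<Rightarrow> complex"
  assumes "test_function f"
  shows "(LINT x|lborel. frechet_derivative f (at x) v) = 0"
proof -
  let ?g = "\<lambda>x. frechet_derivative f (at x) v"
  have sm: "smooth f"
    by (rule test_function_smooth[OF assms])
  have fm [measurable]: "f \<in> borel_measurable borel"
    by (rule smooth_measurable[OF sm])
  have gm [measurable]: "?g \<in> borel_measurable borel"
    by (intro smooth_measurable smooth_frechet_derivative sm)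
  obtain B where B: "\<And>x. cmod (?g x) \<le> B"
    using test_function_bounded[OF test_function_frechet_derivative[OF assms]] by blast
  obtain R where R: "\<And>x. f x \<noteq> 0 \<Longrightarrow> norm x \<le> R"
    using compact_imp_bounded[OF test_function_support[OF assms]] closure_subset[of "{x. f x \<noteq> 0}"]
    unfolding bounded_iff by blast
  define h where "h n = 1 / real (Suc n)" for n
  have h: "0 < h n" "h n \<le> 1" for n
    by (auto simp: h_def)
  define q where "q n x = (f (h n *\<^sub>R v + x) - f x) /\<^sub>R h n" for n x
  have line: "((\<lambda>t. f (t *\<^sub>R v + x)) has_vector_derivative ?g (t *\<^sub>R v + x)) (at t)" for t x
  proof -
    have "((\<lambda>t. t *\<^sub>R v + x) has_derivative (\<lambda>s. s *\<^sub>R v)) (at t)"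
      by (auto intro!: derivative_eq_intros)
    from has_derivative_compose[OF this smooth_has_derivative[OF sm]]
    have "((\<lambda>t. f (t *\<^sub>R v + x)) has_derivative (\<lambda>s. frechet_derivative f (at (t *\<^sub>R v + x)) (s *\<^sub>R v))) (at t)" .
    moreover have "frechet_derivative f (at y) (s *\<^sub>R v) = s *\<^sub>R ?g y" for s y
      using linear_scale[OF linear_frechet_derivative[OF smooth_imp_differentiable[OF sm]]] by blast
    ultimately show ?thesis
      by (simp add: has_vector_derivative_def)
  qed
  have qB: "cmod (q n x) \<le> B" for n x
  proof -
    have "norm (f (h n *\<^sub>R v + x) - f (0 *\<^sub>R v + x)) \<le> B * h n - B * 0"
    proof (rule differentiable_bound_general[of 0 "h n" "\<lambda>t. f (t *\<^sub>R v + x)" "\<lambda>t. B * t"])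
      show "continuous_on {0..h n} (\<lambda>t. f (t *\<^sub>R v + x))"
        using line by (meson continuous_at_imp_continuous_on has_vector_derivative_continuous)
      show "((*) B has_vector_derivative B) (at t)" for t
        by (auto intro!: derivative_eq_intros simp flip: has_real_derivative_iff_has_vector_derivative)
    qed (use h B line in \<open>auto intro!: continuous_intros\<close>)
    moreover have "cmod (q n x) = cmod (f (h n *\<^sub>R v + x) - f x) / h n"
      using h(1)[of n] by (simp add: q_def divide_inverse_commute)
    ultimately show ?thesis
      using h(1)[of n] by (simp add: pos_divide_le_eq)
  qed
  have q0: "q n x = 0" if "norm x > R + norm v" for n x
  proof -
    have "norm (h n *\<^sub>R v) \<le> norm v"
      using h[of n] by (simp add: mult_left_le_one_le)
    moreover have "norm x \<le> norm (h n *\<^sub>R v + x) + norm (h n *\<^sub>R v)"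
      by (metis add_diff_cancel_left' norm_triangle_ineq4 add.commute)
    ultimately have "norm (h n *\<^sub>R v + x) > R"
      using that by linarith
    moreover have "norm x > R"
      using that norm_ge_zero[of v] by linarith
    ultimately have "f (h n *\<^sub>R v + x) = 0" "f x = 0"
      using R[of "h n *\<^sub>R v + x"] R[of x] by (meson leD)+
    then show ?thesis
      by (simp add: q_def)
  qed
  have "(\<lambda>n. LINT x|lborel. q n x) \<longlonglongrightarrow> (LINT x|lborel. ?g x)"
  proof (rule integral_dominated_convergence)
    show "q n \<in> borel_measurable lborel" for n
      unfolding q_def by measurable
    show "integrable lborel (\<lambda>x. indicator (cball 0 (R + norm v)) x *\<^sub>R B)"
      by (rule borel_integrable_compact) auto
    show "AE x in lborel. norm (q n x) \<le> indicator (cball 0 (R + norm v)) x *\<^sub>R B" for n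
      using qB q0 by (intro AE_I2) (auto simp: indicator_def)
    have "(\<lambda>n. q n x) \<longlonglongrightarrow> ?g x" for x
    proof -
      have "((\<lambda>t. norm (f ((0 + t) *\<^sub>R v + x) - f (0 *\<^sub>R v + x) - t *\<^sub>R ?g (0 *\<^sub>R v + x)) / norm t)
          \<longlongrightarrow> 0) (at 0)"
        using line[of x 0] unfolding has_vector_derivative_def has_derivative_at by blast
      moreover have "filterlim h (at 0) sequentially"
        unfolding filterlim_at using h LIMSEQ_inverse_real_of_nat
        by (auto simp: h_def[abs_def] inverse_eq_divide)
      ultimately have "(\<lambda>n. norm (f ((0 + h n) *\<^sub>R v + x) - f (0 *\<^sub>R v + x) - h n *\<^sub>R ?g (0 *\<^sub>R v + x))
          / norm (h n)) \<longlonglongrightarrow> 0"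
        by (rule filterlim_compose)
      moreover have "norm (f ((0 + h n) *\<^sub>R v + x) - f (0 *\<^sub>R v + x) - h n *\<^sub>R ?g (0 *\<^sub>R v + x))
          / norm (h n) = norm (q n x - ?g x)" for n
      proof -
        have "q n x - ?g x = (f (h n *\<^sub>R v + x) - f x - h n *\<^sub>R ?g x) /\<^sub>R h n"
          using h(1)[of n] by (simp add: q_def scaleR_diff_right)
        then have "norm (q n x - ?g x) = norm (f (h n *\<^sub>R v + x) - f x - h n *\<^sub>R ?g x) / h n"
          using h(1)[of n] by (simp add: divide_inverse_commute)
        then show ?thesis
          using h(1)[of n] by simp
      qed
      ultimately show ?thesis
        by (simp add: tendsto_norm_zero_iff LIM_zero_iff)
    qed
    then show "AE x in lborel. (\<lambda>n. q n x) \<longlonglongrightarrow> ?g x"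
      by simp
  qed (use gm in measurable)
  moreover have "(LINT x|lborel. q n x) = 0" for n
    using test_function_integrable[OF assms] lborel_integral_translate[OF fm]
    by (simp add: q_def)
  ultimately show ?thesis
    by (simp add: LIMSEQ_const_iff)
qed

lemma d_zbar_eqI:
  assumes "(f has_derivative f') (at z)"
  shows "d_zbar j f z = (f' (axis j 1) + \<i> * f' (axis j \<i>)) / 2"
  unfolding d_zbar_def using frechet_derivative_at[OF assms] by simp

lemma d_zbar_const [simp]: "d_zbar j (\<lambda>z. c) z = 0"
  by (subst d_zbar_eqI[where f' = "\<lambda>_. 0"]) auto

lemma d_zbar_add:
  "f differentiable (at z) \<Longrightarrow> g differentiable (at z) \<Longrightarrow>
    d_zbar j (\<lambda>z. f z + g z) z = d_zbar j f z + d_zbar j g z"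
  unfolding frechet_derivative_works
  by (subst d_zbar_eqI[OF has_derivative_add]) (auto simp: d_zbar_def algebra_simps add_divide_distrib)

lemma d_zbar_mult:
  "f differentiable (at z) \<Longrightarrow> g differentiable (at z) \<Longrightarrow>
    d_zbar j (\<lambda>z. f z * g z) z = d_zbar j f z * g z + f z * d_zbar j g z"
  unfolding frechet_derivative_works
  by (subst d_zbar_eqI[OF has_derivative_mult]) (auto simp: d_zbar_def algebra_simps add_divide_distrib)

lemma smooth_cnj: "smooth f \<Longrightarrow> smooth (\<lambda>z. cnj (f z))"
  using smooth_compose_bounded_linear[OF bounded_linear_cnj] by blast

lemma has_derivative_component: "((\<lambda>z. z $ k) has_derivative (\<lambda>v. v $ k)) (at z)"
  by (rule bounded_linear_imp_has_derivative[OF bounded_linear_vec_nth])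

lemma smooth_component [simp]: "smooth (\<lambda>z::complex^'n::finite. z $ k)"
  by (rule smooth_bounded_linear[OF bounded_linear_vec_nth])

lemma d_zbar_component [simp]: "d_zbar j (\<lambda>z. z $ k) z = 0"
  by (subst d_zbar_eqI[OF has_derivative_component]) (auto simp: axis_def)

lemma d_zbar_cnj_component: "d_zbar j (\<lambda>z. cnj (z $ k)) z = (if k = j then 1 else 0)"
proof -
  have "((\<lambda>z. cnj (z $ k)) has_derivative (\<lambda>v. cnj (v $ k))) (at z)"
    by (rule bounded_linear.has_derivative[OF bounded_linear_cnj has_derivative_component])
  then show ?thesis
    by (subst d_zbar_eqI) (auto simp: axis_def)
qed

lemma smooth_d_zbar: "smooth f \<Longrightarrow> smooth (d_zbar j f)"
  unfolding d_zbar_def[abs_def] divide_inverse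
  by (intro smooth_mult smooth_add smooth_frechet_derivative smooth_const)

lemma test_function_d_zbar:
  assumes "test_function f"
  shows "test_function (d_zbar j f)"
proof (rule test_functionI[OF smooth_d_zbar test_function_support[OF assms]])
  show "smooth f"
    by (rule test_function_smooth[OF assms])
  fix x assume x: "x \<notin> closure {x. f x \<noteq> 0}"
  have hd: "(f has_derivative (\<lambda>_. 0)) (at x)"
    by (rule has_derivative_0_outside_support[OF x])
  show "d_zbar j f x = 0"
    by (subst d_zbar_eqI[OF hd]) simp
qed

lemma integral_d_zbar_test_function:
  assumes "test_function f"
  shows "(LINT z|lborel. d_zbar j f z) = 0"
  unfolding d_zbar_def
  using integral_derivative_test_function[OF assms]
    test_function_integrable[OF test_function_frechet_derivative[OF assms]]
  by simp

lemma integration_by_parts_d_zbar: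
  assumes "test_function f" "smooth g"
  shows "(LINT z|lborel. g z * d_zbar j f z) = - (LINT z|lborel. f z * d_zbar j g z)"
proof -
  have "d_zbar j (\<lambda>z. f z * g z) z = d_zbar j f z * g z + f z * d_zbar j g z" for z
    using assms(2) test_function_smooth[OF assms(1)] by (intro d_zbar_mult smooth_imp_differentiable)
  moreover have "integrable lborel (\<lambda>z. d_zbar j f z * g z)" "integrable lborel (\<lambda>z. f z * d_zbar j g z)"
    using assms by (auto intro!: test_function_integrable test_function_mult_smooth test_function_d_zbar smooth_d_zbar)
  moreover have "(LINT z|lborel. d_zbar j (\<lambda>z. f z * g z) z) = 0"
    by (rule integral_d_zbar_test_function[OF test_function_mult_smooth[OF assms]])
  ultimately have "(LINT z|lborel. d_zbar j f z * g z) + (LINT z|lborel. f z * d_zbar j g z) = 0"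
    by simp
  then show ?thesis
    by (simp add: mult.commute add_eq_0_iff)
qed

section \<open>The Gaussian measure\<close>

lemma power_le_fact_exp:
  assumes "0 \<le> (x::real)"
  shows "x ^ k \<le> fact k * exp x"
proof -
  have "(\<Sum>i\<in>{k}. x ^ i /\<^sub>R fact i) \<le> (\<Sum>i. x ^ i /\<^sub>R fact i)"
    using assms by (intro sum_le_suminf sums_summable[OF exp_converges]) auto
  then have "x ^ k / fact k \<le> exp x"
    using sums_unique[OF exp_converges[of x]] by (simp add: divide_inverse_commute)
  then show ?thesis
    by (simp add: pos_divide_le_eq mult.commute)
qed

lemma nn_integral_inverse_one_plus_square_finite:
  "(\<integral>\<^sup>+t. ennreal (1 / (1 + t\<^sup>2)) \<partial>lborel) < \<infinity>"
proof -
  let ?f = "\<lambda>t::real. 1 / (1 + t\<^sup>2)"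
  have half: "(\<integral>\<^sup>+t. ennreal (?f t) * indicator {0..} t \<partial>lborel) = ennreal (pi / 2 - arctan 0)"
  proof (rule nn_integral_FTC_atLeast)
    show "(arctan has_real_derivative ?f t) (at t)" for t
      by (rule DERIV_cong[OF DERIV_arctan]) (simp add: inverse_eq_divide)
    show "(arctan \<longlongrightarrow> pi / 2) at_top"
      by (rule tendsto_arctan_at_top)
  qed auto
  have "(\<integral>\<^sup>+t. ennreal (?f t) * indicator {..0} t \<partial>lborel)
      = ennreal \<bar>-1\<bar> * (\<integral>\<^sup>+t. ennreal (?f (0 + (-1) * t)) * indicator {..0} (0 + (-1) * t) \<partial>lborel)"
    by (rule nn_integral_real_affine) auto
  also have "\<dots> = (\<integral>\<^sup>+t. ennreal (?f t) * indicator {0..} t \<partial>lborel)"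
    by (auto intro!: nn_integral_cong simp: indicator_def)
  finally have half': "(\<integral>\<^sup>+t. ennreal (?f t) * indicator {..0} t \<partial>lborel) < \<infinity>"
    using half by simp
  have "(\<integral>\<^sup>+t. ennreal (?f t) \<partial>lborel)
      \<le> (\<integral>\<^sup>+t. ennreal (?f t) * indicator {0..} t + ennreal (?f t) * indicator {..0} t \<partial>lborel)"
    by (intro nn_integral_mono) (auto simp: indicator_def)
  also have "\<dots> = (\<integral>\<^sup>+t. ennreal (?f t) * indicator {0..} t \<partial>lborel)
      + (\<integral>\<^sup>+t. ennreal (?f t) * indicator {..0} t \<partial>lborel)"
    by (rule nn_integral_add) auto
  also have "\<dots> < \<infinity>"
    using half half' by simp
  finally show ?thesis .
qed

text \<open>The Gaussian is compared with a product of one-dimensional functions \<open>1/(1+t\<^sup>2)\<close>.\<close>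

lemma integrable_power_times_Gaussian:
  assumes "c > 0"
  shows "integrable lborel (\<lambda>z::'a::euclidean_space. (1 + norm z) ^ m * exp (- (c * (norm z)\<^sup>2)))"
proof -
  define N where "N = m + DIM('a)"
  define K where "K = 2 ^ m * (fact N * exp c / c ^ N)"
  let ?P = "\<lambda>z::'a. \<Prod>b\<in>Basis. 1 / (1 + (z \<bullet> b)\<^sup>2)"
  have "(\<integral>\<^sup>+z. ennreal (?P z) \<partial>lborel) = (\<integral>\<^sup>+z. (\<Prod>b\<in>Basis. ennreal (1 / (1 + ((z::'a) \<bullet> b)\<^sup>2))) \<partial>lborel)"
    by (simp add: prod_ennreal)
  also have "\<dots> = (\<Prod>b\<in>(Basis::'a set). \<integral>\<^sup>+t. ennreal (1 / (1 + t\<^sup>2)) \<partial>lborel)"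
    by (rule nn_integral_lborel_prod) auto
  also have "\<dots> < \<infinity>"
    using nn_integral_inverse_one_plus_square_finite by (simp add: power_less_top_ennreal)
  finally have P: "integrable lborel (\<lambda>z. K * ?P z)"
    by (intro integrable_mult_right integrableI_nonneg) (auto intro!: prod_nonneg)
  show ?thesis
  proof (rule Bochner_Integration.integrable_bound[OF P])
    have "(1 + norm z) ^ m * exp (- (c * (norm z)\<^sup>2)) \<le> K * ?P z" for z :: 'a
    proof -
      let ?s = "1 + (norm z)\<^sup>2"
      have "1 + norm z \<le> 2 * ?s"
        using zero_le_power2[of "norm z - 1/4"] by (simp add: power2_eq_square algebra_simps)
      then have "(1 + norm z) ^ m \<le> 2 ^ m * ?s ^ m"
        unfolding power_mult_distrib[symmetric] by (intro power_mono) auto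
      moreover have "(\<Prod>b\<in>Basis. 1 + (z \<bullet> b)\<^sup>2) \<le> (\<Prod>b\<in>(Basis::'a set). ?s)"
        using Basis_le_norm[of _ z] by (intro prod_mono) (auto simp: abs_le_square_iff[symmetric])
      ultimately have "(1 + norm z) ^ m * (\<Prod>b\<in>Basis. 1 + (z \<bullet> b)\<^sup>2) \<le> 2 ^ m * ?s ^ m * ?s ^ DIM('a)"
        by (intro mult_mono) (auto intro!: prod_nonneg)
      also have "\<dots> = 2 ^ m * ((c * ?s) ^ N / c ^ N)"
        using assms by (simp add: N_def power_add power_mult_distrib)
      also have "\<dots> \<le> 2 ^ m * (fact N * exp (c * ?s) / c ^ N)"
        using assms by (intro mult_left_mono divide_right_mono power_le_fact_exp) auto
      also have "\<dots> = K * exp (c * (norm z)\<^sup>2)"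
        by (simp add: K_def distrib_left exp_add)
      finally have "(1 + norm z) ^ m * (\<Prod>b\<in>Basis. 1 + (z \<bullet> b)\<^sup>2) \<le> K * exp (c * (norm z)\<^sup>2)" .
      moreover have "(\<Prod>b\<in>Basis. 1 + (z \<bullet> b)\<^sup>2) > 0"
        by (intro prod_pos) (auto intro: add_pos_nonneg)
      ultimately show ?thesis
        by (simp add: prod_dividef exp_minus field_simps)
    qed
    moreover have "0 \<le> K * ?P z" for z
    proof (rule mult_nonneg_nonneg)
      show "0 \<le> K"
        using assms by (simp add: K_def)
      show "0 \<le> ?P z"
        by (intro prod_nonneg) simp
    qed
    ultimately show "AE z in lborel. norm ((1 + norm z) ^ m * exp (- (c * (norm z)\<^sup>2))) \<le> norm (K * ?P z)"
      by (intro AE_I2) simp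
  qed measurable
qed

definition gauss :: "(complex ^ 'n::finite) measure" where
  "gauss = density lborel (\<lambda>z. ennreal (exp (- weight z)))"

lemma weight_eq_norm: "weight z = (norm z)\<^sup>2"
  by (simp add: weight_def norm_vec_def L2_set_def sum_nonneg)

lemma weight_eq_complex: "complex_of_real (weight z) = (\<Sum>k\<in>UNIV. z $ k * cnj (z $ k))"
  by (simp add: weight_def complex_norm_square del: of_real_power)

lemma weight_measurable [measurable]: "weight \<in> borel_measurable borel"
  unfolding weight_eq_norm[abs_def] by measurable

lemma sets_gauss [measurable_cong, simp]: "sets gauss = sets borel"
  by (simp add: gauss_def)

lemma space_gauss [simp]: "space gauss = UNIV"
  by (simp add: gauss_def)

lemma borel_measurable_gauss [simp]: "borel_measurable gauss = borel_measurable borel"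
  by (rule measurable_cong_sets) simp_all

lemma integral_gauss:
  fixes f :: "complex ^ 'n::finite \<Rightarrow> complex"
  shows "f \<in> borel_measurable borel \<Longrightarrow>
    (LINT z|gauss. f z) = (LINT z|lborel. f z * of_real (exp (- weight z)))"
  unfolding gauss_def by (subst integral_density) (auto simp: scaleR_conv_of_real mult.commute)

lemma integrable_gauss:
  fixes f :: "complex ^ 'n::finite \<Rightarrow> 'b::{banach, second_countable_topology}"
  shows "f \<in> borel_measurable borel \<Longrightarrow>
    integrable gauss f \<longleftrightarrow> integrable lborel (\<lambda>z. exp (- weight z) *\<^sub>R f z)"
  unfolding gauss_def by (subst integrable_density) auto

lemma AE_gauss:
  fixes P :: "complex ^ 'n::finite \<Rightarrow> bool"
  shows "(AE z in gauss. P z) \<longleftrightarrow> (AE z in lborel. P z)"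
  unfolding gauss_def by (subst AE_density) auto

lemma L2_weighted_eq: "L2_weighted = L2 gauss"
proof -
  have "(\<lambda>z. (cmod (f z))\<^sup>2) \<in> borel_measurable borel" if "f \<in> borel_measurable borel"
    for f :: "complex ^ 'n \<Rightarrow> complex"
    using that by measurable
  then show ?thesis
    by (auto simp: L2_weighted_def L2_def integrable_gauss mult.commute)
qed

lemma L2_gauss_measurable: "f \<in> L2 gauss \<Longrightarrow> f \<in> borel_measurable borel"
  using L2_measurable[of f gauss] by simp

lemma L2_inner_eq:
  "f \<in> L2 gauss \<Longrightarrow> g \<in> L2 gauss \<Longrightarrow> L2_inner f g = inner_L2 gauss f g"
  unfolding L2_inner_def inner_L2_def
  by (subst integral_gauss) (auto intro: borel_measurable_mult_cnj L2_gauss_measurable)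

definition poly_bounded :: "('a::real_normed_vector \<Rightarrow> complex) \<Rightarrow> bool" where
  "poly_bounded f \<longleftrightarrow> (\<exists>C m. \<forall>z. cmod (f z) \<le> C * (1 + norm z) ^ m)"

lemma poly_boundedI: "(\<And>z. cmod (f z) \<le> C * (1 + norm z) ^ m) \<Longrightarrow> poly_bounded f"
  unfolding poly_bounded_def by blast

lemma poly_bounded_const: "poly_bounded (\<lambda>z. c)"
  by (rule poly_boundedI[where C = "cmod c" and m = 0]) simp

lemma poly_bounded_component: "poly_bounded (\<lambda>z. z $ k)"
proof (rule poly_boundedI[where C = 1 and m = 1])
  fix z :: "complex ^ 'a"
  show "cmod (z $ k) \<le> 1 * (1 + norm z) ^ 1"
    using Finite_Cartesian_Product.norm_nth_le[of z k] by simp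
qed

lemma poly_bounded_cnj: "poly_bounded f \<Longrightarrow> poly_bounded (\<lambda>z. cnj (f z))"
  by (simp add: poly_bounded_def)

lemma poly_bounded_mult:
  assumes "poly_bounded f" "poly_bounded g"
  shows "poly_bounded (\<lambda>z. f z * g z)"
proof -
  obtain C m D k where "\<And>z. cmod (f z) \<le> C * (1 + norm z) ^ m" "\<And>z. cmod (g z) \<le> D * (1 + norm z) ^ k"
    using assms unfolding poly_bounded_def by metis
  then have "cmod (f z * g z) \<le> (C * (1 + norm z) ^ m) * (D * (1 + norm z) ^ k)" for z
    unfolding norm_mult by (meson mult_mono norm_ge_zero order_trans)
  then show ?thesis
    by (intro poly_boundedI[where C = "C * D" and m = "m + k"]) (simp add: power_add mult_ac)
qed

lemma poly_bounded_add:
  assumes "poly_bounded f" "poly_bounded g"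
  shows "poly_bounded (\<lambda>z. f z + g z)"
proof -
  obtain C m D k where fg: "\<And>z. cmod (f z) \<le> C * (1 + norm z) ^ m" "\<And>z. cmod (g z) \<le> D * (1 + norm z) ^ k"
    using assms unfolding poly_bounded_def by metis
  have "cmod (f z + g z) \<le> (\<bar>C\<bar> + \<bar>D\<bar>) * (1 + norm z) ^ (m + k)" for z
  proof -
    have "C * (1 + norm z) ^ m \<le> \<bar>C\<bar> * (1 + norm z) ^ (m + k)"
      by (intro mult_mono power_increasing) auto
    moreover have "D * (1 + norm z) ^ k \<le> \<bar>D\<bar> * (1 + norm z) ^ (m + k)"
      by (intro mult_mono power_increasing) auto
    ultimately show ?thesis
      using fg[of z] norm_triangle_ineq[of "f z" "g z"] by (simp add: distrib_right)
  qed
  then show ?thesis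
    by (rule poly_boundedI)
qed

lemma poly_bounded_diff: "poly_bounded f \<Longrightarrow> poly_bounded g \<Longrightarrow> poly_bounded (\<lambda>z. f z - g z)"
  using poly_bounded_add[OF _ poly_bounded_mult[OF poly_bounded_const[of "-1"]], of f g] by simp

lemma poly_bounded_power: "poly_bounded f \<Longrightarrow> poly_bounded (\<lambda>z. f z ^ k)"
  by (induction k) (auto intro: poly_bounded_mult poly_bounded_const)

lemma poly_bounded_prod:
  "finite I \<Longrightarrow> (\<And>i. i \<in> I \<Longrightarrow> poly_bounded (f i)) \<Longrightarrow> poly_bounded (\<lambda>z. \<Prod>i\<in>I. f i z)"
  by (induction I rule: finite_induct) (auto intro: poly_bounded_mult poly_bounded_const)

lemma poly_bounded_times_Gaussian_L2:
  fixes f :: "complex ^ 'n::finite \<Rightarrow> complex"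
  assumes f: "poly_bounded f" "f \<in> borel_measurable borel" and c: "c < 1 / 2"
  shows "(\<lambda>z. f z * of_real (exp (c * weight z))) \<in> L2 gauss"
proof -
  obtain C m where C: "\<And>z. cmod (f z) \<le> C * (1 + norm z) ^ m"
    using f(1) unfolding poly_bounded_def by blast
  note [measurable] = f(2)
  have e: "exp (- weight z) * (exp (c * weight z))\<^sup>2 = exp (- ((1 - 2 * c) * (norm z)\<^sup>2))"
    for z :: "complex ^ 'n"
    unfolding weight_eq_norm power2_eq_square[of "exp _"] exp_add[symmetric] by (simp add: algebra_simps)
  have "integrable lborel (\<lambda>z::complex ^ 'n. C\<^sup>2 * ((1 + norm z) ^ (2 * m) * exp (- ((1 - 2 * c) * (norm z)\<^sup>2))))"
    using c by (intro integrable_mult_right integrable_power_times_Gaussian) simp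
  then have "integrable lborel (\<lambda>z. exp (- weight z) *\<^sub>R (cmod (f z * of_real (exp (c * weight z))))\<^sup>2)"
  proof (rule Bochner_Integration.integrable_bound)
    have "exp (- weight z) *\<^sub>R (cmod (f z * of_real (exp (c * weight z))))\<^sup>2
        = (cmod (f z))\<^sup>2 * exp (- ((1 - 2 * c) * (norm z)\<^sup>2))" for z
      unfolding e[symmetric] by (simp add: norm_mult power_mult_distrib)
    moreover have "(cmod (f z))\<^sup>2 \<le> C\<^sup>2 * (1 + norm z) ^ (2 * m)" for z
      using power_mono[OF C[of z], of 2] by (simp add: power_mult_distrib power_even_eq)
    ultimately show "AE z in lborel. norm (exp (- weight z) *\<^sub>R (cmod (f z * of_real (exp (c * weight z))))\<^sup>2)
        \<le> norm (C\<^sup>2 * ((1 + norm z) ^ (2 * m) * exp (- ((1 - 2 * c) * (norm z)\<^sup>2))))"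
      by (intro AE_I2) (simp add: mult_right_mono flip: mult.assoc)
  qed measurable
  then show ?thesis
    using f(2) by (simp add: L2_def integrable_gauss)
qed

lemma poly_bounded_L2:
  fixes f :: "complex ^ 'n::finite \<Rightarrow> complex"
  shows "poly_bounded f \<Longrightarrow> f \<in> borel_measurable borel \<Longrightarrow> f \<in> L2 gauss"
  using poly_bounded_times_Gaussian_L2[of f 0] by simp

section \<open>Complex Hermite polynomials\<close>

text \<open>In one variable these are the polynomials \<open>(z\<^sup>* - \<partial>/\<partial>z)\<^sup>a z\<^sup>b\<close>, where \<open>z\<^sup>*\<close> is the conjugate:
  the operator \<open>z\<^sup>* - \<partial>/\<partial>z\<close> is the adjoint of \<open>\<partial>/\<partial>z\<^sup>*\<close> for the Gaussian measure, and it raises \<open>a\<close>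
  in the same way as \<open>\<partial>/\<partial>z\<^sup>*\<close> lowers it.\<close>

fun hermite :: "nat \<Rightarrow> nat \<Rightarrow> complex \<Rightarrow> complex" where
  "hermite 0 b z = z ^ b"
| "hermite (Suc a) b z = cnj z * hermite a b z - of_nat b * hermite a (b - 1) z"

text \<open>The commutator of multiplication by \<open>z\<close> with \<open>z\<^sup>* - \<partial>/\<partial>z\<close> is 1.  It follows that the conjugate of the recursion
  for \<open>a\<close> is a recursion for \<open>b\<close>, so that the two indices play symmetric roles.\<close>

lemma mult_hermite: "z * hermite a b z = hermite a (Suc b) z + of_nat a * hermite (a - 1) b z"
proof (induction a arbitrary: b)
  case (Suc a)
  have b: "of_nat b * (z * hermite a (b - 1) z) =
      of_nat b * (hermite a b z + of_nat a * hermite (a - 1) (b - 1) z)"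
    using Suc[of "b - 1"] by (cases b) auto
  have a: "of_nat a * (cnj z * hermite (a - 1) b z - of_nat b * hermite (a - 1) (b - 1) z)
      = of_nat a * hermite a b z"
    by (cases a) auto
  have "z * hermite (Suc a) b z = cnj z * (z * hermite a b z) - of_nat b * (z * hermite a (b - 1) z)"
    by (simp add: algebra_simps)
  also have "\<dots> = cnj z * hermite a (Suc b) z - of_nat b * hermite a b z
      + of_nat a * (cnj z * hermite (a - 1) b z - of_nat b * hermite (a - 1) (b - 1) z)"
    unfolding Suc[of b] b by (simp add: algebra_simps)
  also have "\<dots> = hermite (Suc a) (Suc b) z + of_nat (Suc a) * hermite (Suc a - 1) b z"
    unfolding a by (simp add: algebra_simps)
  finally show ?case .
qed simp

lemma cnj_hermite: "cnj (hermite a b z) = hermite b a z"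
proof (induction a arbitrary: b)
  case 0
  then show ?case
    by (induction b) auto
next
  case (Suc a)
  have "cnj (hermite (Suc a) b z) = z * hermite b a z - of_nat b * hermite (b - 1) a z"
    by (simp add: Suc)
  then show ?case
    by (simp add: mult_hermite)
qed

lemma smooth_hermite_component: "smooth (\<lambda>z::complex ^ 'n::finite. hermite a b (z $ k))"
proof (induction a arbitrary: b)
  case 0
  then show ?case
    by (simp add: smooth_power)
next
  case (Suc a)
  then show ?case
    by (auto intro!: smooth_diff smooth_mult smooth_cnj)
qed

lemma poly_bounded_hermite_component: "poly_bounded (\<lambda>z. hermite a b (z $ k))"
proof (induction a arbitrary: b)
  case 0
  then show ?case
    by (simp add: poly_bounded_power poly_bounded_component)
next
  case (Suc a)
  then show ?case
    by (auto intro!: poly_bounded_diff poly_bounded_mult poly_bounded_cnj poly_bounded_const poly_bounded_component)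
qed

lemma d_zbar_smooth_mult:
  "smooth f \<Longrightarrow> smooth g \<Longrightarrow> d_zbar j (\<lambda>z. f z * g z) z = d_zbar j f z * g z + f z * d_zbar j g z"
  by (intro d_zbar_mult smooth_imp_differentiable)

lemma d_zbar_smooth_diff:
  assumes "smooth f" "smooth g"
  shows "d_zbar j (\<lambda>z. f z - g z) z = d_zbar j f z - d_zbar j g z"
proof -
  have "d_zbar j (\<lambda>z. f z + (-1) * g z) z = d_zbar j f z + d_zbar j (\<lambda>z. (-1) * g z) z"
    using assms by (intro d_zbar_add smooth_imp_differentiable smooth_mult smooth_const)
  also have "d_zbar j (\<lambda>z. (-1) * g z) z = - d_zbar j g z"
    using assms by (subst d_zbar_smooth_mult) auto
  finally show ?thesis
    by simp
qed

lemma d_zbar_hermite_component: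
  "d_zbar j (\<lambda>z::complex ^ 'n::finite. hermite a b (z $ k)) z =
    (if k = j then of_nat a * hermite (a - 1) b (z $ k) else 0)"
proof (induction a arbitrary: b)
  case 0
  have "d_zbar j (\<lambda>z::complex ^ 'n. (z $ k) ^ b) z = 0"
    by (induction b) (auto simp: d_zbar_smooth_mult smooth_power)
  then show ?case
    by simp
next
  case (Suc a)
  have c: "of_nat a * (cnj w * hermite (a - 1) b w - of_nat b * hermite (a - 1) (b - 1) w)
      = of_nat a * hermite a b w" for w
    by (cases a) auto
  have "d_zbar j (\<lambda>z::complex ^ 'n. hermite (Suc a) b (z $ k)) z =
      (if k = j then hermite a b (z $ k) +
        of_nat a * (cnj (z $ k) * hermite (a - 1) b (z $ k) - of_nat b * hermite (a - 1) (b - 1) (z $ k)) else 0)"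
    by (simp add: d_zbar_smooth_diff d_zbar_smooth_mult smooth_mult smooth_cnj smooth_hermite_component
        d_zbar_cnj_component Suc algebra_simps)
  then show ?case
    unfolding c by (simp add: algebra_simps)
qed

definition Hermite :: "('n \<Rightarrow> nat) \<Rightarrow> ('n \<Rightarrow> nat) \<Rightarrow> complex ^ 'n::finite \<Rightarrow> complex" where
  "Hermite \<alpha> \<beta> z = (\<Prod>k\<in>UNIV. hermite (\<alpha> k) (\<beta> k) (z $ k))"

lemma smooth_Hermite: "smooth (Hermite \<alpha> \<beta>)"
  unfolding Hermite_def[abs_def] by (intro smooth_prod smooth_hermite_component) simp

lemma poly_bounded_Hermite: "poly_bounded (Hermite \<alpha> \<beta>)"
  unfolding Hermite_def[abs_def] by (intro poly_bounded_prod poly_bounded_hermite_component) simp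

lemma Hermite_L2: "Hermite \<alpha> \<beta> \<in> L2 gauss"
  by (intro poly_bounded_L2 poly_bounded_Hermite smooth_measurable smooth_Hermite)

lemma cnj_Hermite: "cnj (Hermite \<alpha> \<beta> z) = Hermite \<beta> \<alpha> z"
  by (simp add: Hermite_def cnj_hermite)

lemma Hermite_split:
  "Hermite \<alpha> \<beta> z = hermite (\<alpha> j) (\<beta> j) (z $ j) * (\<Prod>k\<in>UNIV - {j}. hermite (\<alpha> k) (\<beta> k) (z $ k))"
  unfolding Hermite_def by (rule prod.remove) auto

lemma mult_Hermite:
  "z $ j * Hermite \<alpha> \<beta> z = Hermite \<alpha> (\<beta>(j := Suc (\<beta> j))) z + of_nat (\<alpha> j) * Hermite (\<alpha>(j := \<alpha> j - 1)) \<beta> z"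
proof -
  let ?R = "\<Prod>k\<in>UNIV - {j}. hermite (\<alpha> k) (\<beta> k) (z $ k)"
  have "Hermite \<alpha> (\<beta>(j := Suc (\<beta> j))) z = hermite (\<alpha> j) (Suc (\<beta> j)) (z $ j) * ?R"
    "Hermite (\<alpha>(j := \<alpha> j - 1)) \<beta> z = hermite (\<alpha> j - 1) (\<beta> j) (z $ j) * ?R"
    by (simp_all add: Hermite_split[of _ _ z j])
  then show ?thesis
    using mult_hermite[of "z $ j" "\<alpha> j" "\<beta> j"]
    by (simp add: Hermite_split[of \<alpha> \<beta> z j] flip: mult.assoc distrib_right)
qed

lemma cnj_mult_Hermite:
  "cnj (z $ j) * Hermite \<alpha> \<beta> z = Hermite (\<alpha>(j := Suc (\<alpha> j))) \<beta> z + of_nat (\<beta> j) * Hermite \<alpha> (\<beta>(j := \<beta> j - 1)) z"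
  using arg_cong[OF mult_Hermite[of z j \<beta> \<alpha>], of cnj] by (simp add: cnj_Hermite)

lemma d_zbar_prod_zero:
  "finite I \<Longrightarrow> (\<And>i. i \<in> I \<Longrightarrow> smooth (f i)) \<Longrightarrow> (\<And>i. i \<in> I \<Longrightarrow> d_zbar j (f i) z = 0) \<Longrightarrow>
    d_zbar j (\<lambda>z. \<Prod>i\<in>I. f i z) z = 0"
  by (induction I rule: finite_induct) (auto simp: d_zbar_smooth_mult smooth_prod)

lemma d_zbar_Hermite:
  "d_zbar j (Hermite \<alpha> \<beta>) z = of_nat (\<alpha> j) * Hermite (\<alpha>(j := \<alpha> j - 1)) \<beta> z"
proof -
  let ?R = "\<lambda>z. \<Prod>k\<in>UNIV - {j}. hermite (\<alpha> k) (\<beta> k) (z $ k)"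
  have "Hermite \<alpha> \<beta> = (\<lambda>z. hermite (\<alpha> j) (\<beta> j) (z $ j) * ?R z)"
    using Hermite_split[of \<alpha> \<beta> _ j] by blast
  moreover have "d_zbar j (\<lambda>z. hermite (\<alpha> j) (\<beta> j) (z $ j) * ?R z) z =
      d_zbar j (\<lambda>z. hermite (\<alpha> j) (\<beta> j) (z $ j)) z * ?R z + hermite (\<alpha> j) (\<beta> j) (z $ j) * d_zbar j ?R z"
    by (intro d_zbar_smooth_mult smooth_prod smooth_hermite_component) simp
  moreover have "d_zbar j ?R z = 0"
    by (intro d_zbar_prod_zero smooth_hermite_component) (auto simp: d_zbar_hermite_component)
  moreover have "Hermite (\<alpha>(j := \<alpha> j - 1)) \<beta> z = hermite (\<alpha> j - 1) (\<beta> j) (z $ j) * ?R z"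
    by (simp add: Hermite_split[of _ _ z j])
  ultimately show ?thesis
    by (simp add: d_zbar_hermite_component)
qed

lemma d_zbar_cnj_Hermite:
  "d_zbar j (\<lambda>z. cnj (Hermite \<alpha> \<beta> z)) z = of_nat (\<beta> j) * cnj (Hermite \<alpha> (\<beta>(j := \<beta> j - 1)) z)"
  unfolding cnj_Hermite by (simp add: d_zbar_Hermite)

section \<open>The adjoint of the weak derivative\<close>

lemma d_zbar_exp:
  assumes "smooth f"
  shows "d_zbar j (\<lambda>z. exp (f z)) z = exp (f z) * d_zbar j f z"
proof -
  have "(exp has_derivative (\<lambda>h. exp (f z) * h)) (at (f z))"
    using DERIV_exp[of "f z"] by (simp add: has_field_derivative_def)
  from has_derivative_compose[OF smooth_has_derivative[OF assms, of z] this]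
  show ?thesis
    by (subst d_zbar_eqI) (auto simp: d_zbar_def algebra_simps)
qed

lemma d_zbar_of_real_compose:
  assumes r: "smooth r" and g: "(g has_real_derivative g') (at (r z))"
  shows "d_zbar j (\<lambda>z. complex_of_real (g (r z))) z = of_real g' * d_zbar j (\<lambda>z. complex_of_real (r z)) z"
proof -
  have rd: "(r has_derivative frechet_derivative r (at z)) (at z)"
    by (rule smooth_has_derivative[OF r])
  have "(g has_derivative (\<lambda>h. g' * h)) (at (r z))"
    using g by (simp add: has_field_derivative_def)
  from bounded_linear.has_derivative[OF bounded_linear_of_real has_derivative_compose[OF rd this]]
  have 1: "((\<lambda>z. complex_of_real (g (r z))) has_derivative (\<lambda>v. of_real (g' * frechet_derivative r (at z) v))) (at z)" .
  have 2: "((\<lambda>z. complex_of_real (r z)) has_derivative (\<lambda>v. of_real (frechet_derivative r (at z) v))) (at z)"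
    by (rule bounded_linear.has_derivative[OF bounded_linear_of_real rd])
  show ?thesis
    unfolding d_zbar_eqI[OF 1] d_zbar_eqI[OF 2] by (simp add: algebra_simps)
qed

lemma smooth_weight_complex: "smooth (\<lambda>z. \<Sum>k\<in>UNIV. z $ k * cnj (z $ k))"
  by (intro smooth_sum smooth_mult smooth_cnj smooth_component) simp

lemma d_zbar_weight: "d_zbar j (\<lambda>z. \<Sum>k\<in>UNIV. z $ k * cnj (z $ k)) z = z $ j"
proof -
  have "d_zbar j (\<lambda>z. \<Sum>k\<in>I. z $ k * cnj (z $ k)) z = (if j \<in> I then z $ j else 0)" if "finite I" for I
    using that
  proof (induction I rule: finite_induct)
    case (insert k I)
    have "d_zbar j (\<lambda>z. z $ k * cnj (z $ k) + (\<Sum>k\<in>I. z $ k * cnj (z $ k))) z =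
        d_zbar j (\<lambda>z. z $ k * cnj (z $ k)) z + d_zbar j (\<lambda>z. \<Sum>k\<in>I. z $ k * cnj (z $ k)) z"
      using insert.hyps(1)
      by (intro d_zbar_add smooth_imp_differentiable smooth_sum smooth_mult smooth_cnj smooth_component)
    moreover have "d_zbar j (\<lambda>z. z $ k * cnj (z $ k)) z = (if k = j then z $ j else 0)"
      by (simp add: d_zbar_smooth_mult smooth_cnj d_zbar_cnj_component)
    ultimately show ?case
      using insert by auto
  qed simp
  from this[of UNIV] show ?thesis
    by simp
qed

lemma smooth_weight: "smooth weight"
proof -
  have 1: "smooth (\<lambda>z. Re (\<Sum>k\<in>UNIV. z $ k * cnj (z $ k)))"
    by (rule smooth_compose_bounded_linear[OF bounded_linear_Re smooth_weight_complex])
  have 2: "(\<lambda>z. Re (\<Sum>k\<in>UNIV. z $ k * cnj (z $ k))) = weight"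
    unfolding weight_eq_complex[symmetric] by (rule ext) (rule Re_complex_of_real)
  show ?thesis
    by (rule 1[unfolded 2])
qed

lemma smooth_Gaussian: "smooth (\<lambda>z. complex_of_real (exp (- weight z)))"
proof -
  have "complex_of_real (exp (- weight z)) = exp (- 1 * (\<Sum>k\<in>UNIV. z $ k * cnj (z $ k)))" for z :: "complex ^ 'a"
    unfolding weight_eq_complex[symmetric] by (simp flip: exp_of_real)
  then show ?thesis
    by (simp only:) (intro smooth_exp smooth_mult smooth_const smooth_weight_complex)
qed

lemma d_zbar_Gaussian:
  "d_zbar j (\<lambda>z. complex_of_real (exp (- weight z))) z = - z $ j * of_real (exp (- weight z))"
proof -
  have eq: "complex_of_real (exp (- weight z)) = exp (- 1 * (\<Sum>k\<in>UNIV. z $ k * cnj (z $ k)))" for z :: "complex ^ 'a"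
    unfolding weight_eq_complex[symmetric] by (simp flip: exp_of_real)
  have d: "d_zbar j (\<lambda>z. - 1 * (\<Sum>k\<in>UNIV. z $ k * cnj (z $ k))) z = - z $ j"
    by (subst d_zbar_smooth_mult) (auto simp: smooth_weight_complex d_zbar_weight)
  have sm: "smooth (\<lambda>z. - 1 * (\<Sum>k\<in>UNIV. z $ k * cnj (z $ k)))"
    by (intro smooth_mult smooth_const smooth_weight_complex)
  show ?thesis
    unfolding eq d_zbar_exp[OF sm] d by (rule mult.commute)
qed

text \<open>The smooth cutoff functions \<open>exp(1 - 1/(1 - \<bar>z\<bar>\<^sup>2/R\<^sup>2))\<close> on the ball of radius \<open>R\<close> tend to 1, without
  being constant on smaller balls, and their derivatives are \<open>O(\<bar>z\<bar>/R\<^sup>2)\<close>.\<close>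

definition cutoff :: "real \<Rightarrow> complex ^ 'n::finite \<Rightarrow> complex" where
  "cutoff R z = of_real (exp 1 * flat_exp 1 (1 - weight z / R\<^sup>2))"

definition cutoff' :: "real \<Rightarrow> complex ^ 'n::finite \<Rightarrow> complex" where
  "cutoff' R z = of_real (exp 1 * flat_exp [:0, 0, 1:] (1 - weight z / R\<^sup>2) / R\<^sup>2)"

lemma smooth_cutoff_argument: "smooth (\<lambda>z. 1 - weight z / R\<^sup>2)"
  unfolding divide_inverse by (intro smooth_diff smooth_mult smooth_weight smooth_const)

lemma smooth_cutoff: "smooth (cutoff R)"
  unfolding cutoff_def[abs_def]
  by (intro smooth_compose_bounded_linear[OF bounded_linear_of_real] smooth_mult smooth_const
      smooth_flat_exp smooth_cutoff_argument)

lemma d_zbar_cutoff: "d_zbar j (cutoff R) z = - z $ j * cutoff' R z"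
proof -
  have "d_zbar j (\<lambda>z. complex_of_real (1 - weight z / R\<^sup>2)) z
      = d_zbar j (\<lambda>z. 1 - of_real (1 / R\<^sup>2) * (\<Sum>k\<in>UNIV. z $ k * cnj (z $ k))) z"
    unfolding weight_eq_complex[symmetric] by simp
  also have "\<dots> = - of_real (1 / R\<^sup>2) * z $ j"
    by (simp add: d_zbar_smooth_diff d_zbar_smooth_mult smooth_mult smooth_weight_complex d_zbar_weight
        del: of_real_divide of_real_power)
  finally have r: "d_zbar j (\<lambda>z. complex_of_real (1 - weight z / R\<^sup>2)) z = - of_real (1 / R\<^sup>2) * z $ j" .
  have "((\<lambda>t. exp 1 * flat_exp 1 t) has_real_derivative
      exp 1 * flat_exp [:0, 0, 1:] (1 - weight z / R\<^sup>2)) (at (1 - weight z / R\<^sup>2))"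
    using DERIV_cmult[OF flat_exp_has_derivative[of 1]] by (simp add: pderiv_1)
  from d_zbar_of_real_compose[OF smooth_cutoff_argument this, of j, unfolded r]
  show ?thesis
    unfolding cutoff_def[abs_def] cutoff'_def by simp
qed

lemma cutoff_outside: "R > 0 \<Longrightarrow> norm z > R \<Longrightarrow> cutoff R z = 0"
proof -
  assume "R > 0" "norm z > R"
  then have "R\<^sup>2 \<le> weight z"
    by (simp add: weight_eq_norm power_mono)
  then have "1 - weight z / R\<^sup>2 \<le> 0"
    using \<open>R > 0\<close> by (simp add: field_simps)
  then show ?thesis
    by (simp add: cutoff_def flat_exp_def)
qed

lemma cutoff_bounded: "cmod (cutoff R z) \<le> 1"
proof -
  let ?t = "1 - weight z / R\<^sup>2"
  have "0 \<le> weight z / R\<^sup>2"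
    by (simp add: weight_eq_norm)
  then have "1 \<le> 1 / ?t" if "?t > 0"
    using that by (simp add: pos_le_divide_eq)
  then have "exp 1 * exp (- (1 / ?t)) \<le> 1" if "?t > 0"
    using that by (simp flip: exp_add)
  then show ?thesis
    by (auto simp: cutoff_def flat_exp_def norm_mult)
qed

lemma cutoff'_bounded: "R \<ge> 1 \<Longrightarrow> cmod (cutoff' R z) \<le> 2 * exp 1 / R"
proof -
  assume R: "R \<ge> 1"
  have sq: "x\<^sup>2 * exp (- x) \<le> 2" if "x \<ge> 0" for x :: real
    using power_le_fact_exp[OF that, of 2] by (simp add: exp_minus field_simps)
  let ?t = "1 - weight z / R\<^sup>2"
  have "(1 / ?t)\<^sup>2 * exp (- (1 / ?t)) \<le> 2" if "?t > 0"
    using that by (intro sq) simp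
  then have "\<bar>flat_exp [:0, 0, 1:] ?t\<bar> \<le> 2"
    by (auto simp: flat_exp_def power2_eq_square)
  then have "exp 1 * \<bar>flat_exp [:0, 0, 1:] ?t\<bar> / R\<^sup>2 \<le> exp 1 * 2 / R"
    using R by (intro frac_le mult_left_mono) (auto simp: power2_eq_square)
  then show ?thesis
    by (simp add: cutoff'_def norm_mult norm_divide norm_power mult.commute)
qed

lemma cutoff_tendsto_1: "(\<lambda>k. cutoff (real (Suc k)) z) \<longlonglongrightarrow> 1"
proof -
  have lim: "(\<lambda>k. weight z / (real (Suc k))\<^sup>2) \<longlonglongrightarrow> 0"
    using tendsto_mult[OF tendsto_const[of "weight z"]
        tendsto_power[OF LIMSEQ_inverse_real_of_nat, of 2]]
    by (simp add: divide_inverse power_inverse)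
  have "isCont (flat_exp 1) 1"
    using flat_exp_has_derivative DERIV_isCont by blast
  from isCont_tendsto_compose[OF this, of "\<lambda>k. 1 - weight z / (real (Suc k))\<^sup>2"]
  have "(\<lambda>k. flat_exp 1 (1 - weight z / (real (Suc k))\<^sup>2)) \<longlonglongrightarrow> flat_exp 1 1"
    using tendsto_diff[OF tendsto_const lim, of 1] by simp
  then have "(\<lambda>k. complex_of_real (exp 1 * flat_exp 1 (1 - weight z / (real (Suc k))\<^sup>2)))
      \<longlonglongrightarrow> complex_of_real (exp 1 * flat_exp 1 1)"
    by (intro tendsto_of_real tendsto_mult tendsto_const)
  moreover have "exp 1 * flat_exp 1 1 = (1::real)"
    by (simp add: flat_exp_def flip: exp_add)
  ultimately show ?thesis
    by (simp add: cutoff_def)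
qed

lemma cutoff_measurable [measurable]: "cutoff R \<in> borel_measurable borel"
  by (rule smooth_measurable[OF smooth_cutoff])

lemma cutoff'_measurable [measurable]: "cutoff' R \<in> borel_measurable borel"
  unfolding cutoff'_def[abs_def] divide_inverse
  by (intro smooth_measurable smooth_compose_bounded_linear[OF bounded_linear_of_real] smooth_mult
      smooth_const smooth_flat_exp smooth_diff smooth_weight)

lemma test_function_cutoff_mult:
  assumes "smooth f" "R > 0"
  shows "test_function (\<lambda>z. cutoff R z * f z)"
proof (rule test_functionI)
  show "compact (cball (0::complex ^ 'a) R)" by (rule compact_cball)
  show "smooth (\<lambda>z. cutoff R z * f z)"
    by (rule smooth_mult[OF smooth_cutoff assms(1)])
  show "cutoff R z * f z = 0" if "z \<notin> cball 0 R" for z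
    using cutoff_outside[OF assms(2), of z] that by (simp add: not_le)
qed

text \<open>The adjoint of \<open>\<partial>/\<partial>z\<^sub>j\<^sup>*\<close> for the Gaussian measure raises \<open>\<alpha> j\<close>, and this remains true against functions
  that have derivatives only in the weak sense: the product of the conjugate of \<open>Hermite \<alpha> \<beta>\<close>, the Gaussian
  and a cutoff function is a test function, and the cutoff may tend to 1.  The statement is about a combination
  of derivatives of several functions, since in \<open>dbar\<close> only such combinations are square integrable.\<close>

lemma weak_derivative_inner_Hermite:
  fixes u :: "'n::finite \<Rightarrow> complex ^ 'n \<Rightarrow> complex"
  assumes u: "\<And>j. j \<in> J \<Longrightarrow> u j \<in> L2 gauss" and v: "v \<in> L2 gauss"
    and weak: "\<And>\<eta>. test_function \<eta> \<Longrightarrow>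
      (\<Sum>j\<in>J. c j * (- (LINT z|lborel. u j z * d_zbar j \<eta> z))) = (LINT z|lborel. v z * \<eta> z)"
  shows "inner_L2 gauss v (Hermite \<alpha> \<beta>) =
    (\<Sum>j\<in>J. c j * inner_L2 gauss (u j) (Hermite (\<alpha>(j := Suc (\<alpha> j))) \<beta>))"
proof -
  let ?p = "Hermite \<alpha> \<beta>"
  let ?p' = "\<lambda>j. Hermite (\<alpha>(j := Suc (\<alpha> j))) \<beta>"
  let ?E = "\<lambda>z. complex_of_real (exp (- weight z))"
  have pm [measurable]: "Hermite a b \<in> borel_measurable borel" for a b :: "'n \<Rightarrow> nat"
    by (rule smooth_measurable[OF smooth_Hermite])
  have vm [measurable]: "v \<in> borel_measurable borel"
    using L2_measurable[OF v] by simp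
  have um: "u j \<in> borel_measurable borel" if "j \<in> J" for j
    using L2_measurable[OF u[OF that]] by simp
  have comp_m [measurable]: "(\<lambda>z::complex ^ 'n. z $ j) \<in> borel_measurable borel" for j
    by (rule smooth_measurable[OF smooth_component])
  define \<eta> where "\<eta> R z = cutoff R z * (cnj (?p z) * ?E z)" for R :: real and z :: "complex ^ 'n"
  have smE: "smooth (\<lambda>z. cnj (?p z) * ?E z)"
    by (intro smooth_mult smooth_cnj smooth_Hermite smooth_Gaussian)
  have test: "test_function (\<eta> R)" if "R > 0" for R
    unfolding \<eta>_def[abs_def] by (rule test_function_cutoff_mult[OF smE that])
  have dE: "d_zbar j (\<lambda>z. cnj (?p z) * ?E z) z = - (cnj (?p' j z) * ?E z)" for j z
  proof -
    have "d_zbar j (\<lambda>z. cnj (?p z) * ?E z) z =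
        cnj (of_nat (\<beta> j) * Hermite \<alpha> (\<beta>(j := \<beta> j - 1)) z - cnj (z $ j) * ?p z) * ?E z"
      by (subst d_zbar_smooth_mult)
        (auto simp: smooth_cnj smooth_Hermite smooth_Gaussian d_zbar_cnj_Hermite d_zbar_Gaussian algebra_simps)
    then show ?thesis
      unfolding cnj_mult_Hermite by simp
  qed
  have d\<eta>: "d_zbar j (\<eta> R) z = - (z $ j * cutoff' R z * cnj (?p z) + cutoff R z * cnj (?p' j z)) * ?E z" for j R z
  proof -
    have "d_zbar j (\<eta> R) z = d_zbar j (cutoff R) z * (cnj (?p z) * ?E z)
        + cutoff R z * d_zbar j (\<lambda>z. cnj (?p z) * ?E z) z"
      unfolding \<eta>_def[abs_def] by (rule d_zbar_smooth_mult[OF smooth_cutoff smE])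
    then show ?thesis
      unfolding dE d_zbar_cutoff by (simp add: algebra_simps)
  qed
  \<comment> \<open>Integrals of products with \<open>\<eta>\<close> over the Lebesgue measure are integrals over \<open>gauss\<close>, where
    \<open>u j\<close> and \<open>v\<close> times polynomials are integrable; there, dominated convergence applies.\<close>
  have limv: "(\<lambda>k. LINT z|lborel. v z * \<eta> (real (Suc k)) z) \<longlonglongrightarrow> inner_L2 gauss v ?p"
  proof -
    have "(LINT z|lborel. v z * \<eta> R z) = (LINT z|gauss. cutoff R z * (v z * cnj (?p z)))" for R
      by (subst integral_gauss) (auto simp: \<eta>_def mult_ac intro!: borel_measurable_times borel_measurable_mult_cnj)
    moreover have "(\<lambda>k. LINT z|gauss. cutoff (real (Suc k)) z * (v z * cnj (?p z))) \<longlonglongrightarrow> inner_L2 gauss v ?p"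
      unfolding inner_L2_def
    proof (rule integral_dominated_convergence)
      show "integrable gauss (\<lambda>z. norm (v z * cnj (?p z)))"
        by (intro integrable_norm integrable_inner_L2 v Hermite_L2)
      show "AE z in gauss. (\<lambda>k. cutoff (real (Suc k)) z * (v z * cnj (?p z))) \<longlonglongrightarrow> v z * cnj (?p z)"
      proof (rule AE_I2)
        fix z
        show "(\<lambda>k. cutoff (real (Suc k)) z * (v z * cnj (?p z))) \<longlonglongrightarrow> v z * cnj (?p z)"
          using tendsto_mult[OF cutoff_tendsto_1 tendsto_const[of "v z * cnj (?p z)"], of z] by simp
      qed
      show "AE z in gauss. norm (cutoff (real (Suc k)) z * (v z * cnj (?p z))) \<le> norm (v z * cnj (?p z))" for k
        by (intro AE_I2) (simp add: norm_mult mult_left_le_one_le cutoff_bounded)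
    qed (auto intro!: borel_measurable_times borel_measurable_mult_cnj)
    ultimately show ?thesis
      by simp
  qed
  have limu: "(\<lambda>k. - (LINT z|lborel. u j z * d_zbar j (\<eta> (real (Suc k))) z)) \<longlonglongrightarrow> inner_L2 gauss (u j) (?p' j)"
    if j: "j \<in> J" for j
  proof -
    note [measurable] = um[OF j]
    let ?w = "\<lambda>z. cnj (z $ j) * ?p z"
    have wL: "?w \<in> L2 gauss"
      by (intro poly_bounded_L2 poly_bounded_mult poly_bounded_cnj poly_bounded_component poly_bounded_Hermite
          smooth_measurable smooth_mult smooth_cnj smooth_component smooth_Hermite)
    let ?F = "\<lambda>R z. cutoff' R z * (u j z * cnj (?w z)) + cutoff R z * (u j z * cnj (?p' j z))"
    have [measurable]: "(\<lambda>z. u j z * cnj (?w z)) \<in> borel_measurable borel"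
      "(\<lambda>z. u j z * cnj (?p' j z)) \<in> borel_measurable borel"
      using L2_measurable[OF wL] by (auto intro!: borel_measurable_mult_cnj)
    have "- (LINT z|lborel. u j z * d_zbar j (\<eta> R) z) = (LINT z|gauss. ?F R z)" for R
      unfolding d\<eta> integral_minus[symmetric]
      by (subst integral_gauss) (measurable, auto simp: algebra_simps intro!: Bochner_Integration.integral_cong)
    moreover have "(\<lambda>k. LINT z|gauss. ?F (real (Suc k)) z) \<longlonglongrightarrow> inner_L2 gauss (u j) (?p' j)"
      unfolding inner_L2_def
    proof (rule integral_dominated_convergence)
      show "integrable gauss (\<lambda>z. 2 * exp 1 * norm (u j z * cnj (?w z)) + norm (u j z * cnj (?p' j z)))"
        by (intro Bochner_Integration.integrable_add integrable_mult_right integrable_norm integrable_inner_L2 u[OF j] wL Hermite_L2)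
      have "(\<lambda>k. cutoff' (real (Suc k)) z) \<longlonglongrightarrow> 0" for z :: "complex ^ 'n"
      proof (rule Lim_null_comparison)
        show "\<forall>\<^sub>F k in sequentially. norm (cutoff' (real (Suc k)) z) \<le> 2 * exp 1 * inverse (real (Suc k))"
          using cutoff'_bounded[of "real (Suc k)" z for k] by (simp add: divide_inverse)
        show "(\<lambda>k. 2 * exp 1 * inverse (real (Suc k))) \<longlonglongrightarrow> 0"
          using tendsto_mult[OF tendsto_const[of "2 * exp 1"] LIMSEQ_inverse_real_of_nat] by simp
      qed
      then have "(\<lambda>k. ?F (real (Suc k)) z) \<longlonglongrightarrow> 0 * (u j z * cnj (?w z)) + 1 * (u j z * cnj (?p' j z))" for z
        by (intro tendsto_add tendsto_mult tendsto_const cutoff_tendsto_1)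
      then show "AE z in gauss. (\<lambda>k. ?F (real (Suc k)) z) \<longlonglongrightarrow> u j z * cnj (?p' j z)"
        by simp
      have "norm (?F R z) \<le> 2 * exp 1 * norm (u j z * cnj (?w z)) + norm (u j z * cnj (?p' j z))"
        if "R \<ge> 1" for R z
      proof -
        have "2 * exp 1 / R \<le> 2 * exp 1"
          using that by (simp add: divide_le_eq)
        then have "norm (cutoff' R z) * norm (u j z * cnj (?w z)) \<le> 2 * exp 1 * norm (u j z * cnj (?w z))"
          using cutoff'_bounded[OF that, of z] by (intro mult_right_mono) auto
        moreover have "norm (cutoff R z) * norm (u j z * cnj (?p' j z)) \<le> 1 * norm (u j z * cnj (?p' j z))"
          by (intro mult_right_mono cutoff_bounded norm_ge_zero)
        ultimately show ?thesis
          using norm_triangle_ineq[of "cutoff' R z * (u j z * cnj (?w z))" "cutoff R z * (u j z * cnj (?p' j z))"]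
          unfolding norm_mult[of "cutoff R z"] norm_mult[of "cutoff' R z"] by linarith
      qed
      then show "AE z in gauss. norm (?F (real (Suc k)) z)
          \<le> 2 * exp 1 * norm (u j z * cnj (?w z)) + norm (u j z * cnj (?p' j z))" for k
        by (intro AE_I2) simp
    qed measurable
    ultimately show ?thesis
      by simp
  qed
  have "(\<lambda>k. \<Sum>j\<in>J. c j * (- (LINT z|lborel. u j z * d_zbar j (\<eta> (real (Suc k))) z)))
      \<longlonglongrightarrow> (\<Sum>j\<in>J. c j * inner_L2 gauss (u j) (?p' j))"
    by (intro tendsto_sum tendsto_mult tendsto_const limu)
  moreover have "(\<Sum>j\<in>J. c j * (- (LINT z|lborel. u j z * d_zbar j (\<eta> (real (Suc k))) z)))
      = (LINT z|lborel. v z * \<eta> (real (Suc k)) z)" for k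
    by (rule weak[OF test]) simp
  ultimately show ?thesis
    using LIMSEQ_unique[OF limv] by simp
qed

section \<open>Orthogonality of the Hermite polynomials\<close>

lemma Hermite_lower_raise:
  "of_nat (\<alpha>' j) * inner_L2 gauss (Hermite (\<alpha>'(j := \<alpha>' j - 1)) \<beta>') (Hermite \<alpha> \<beta>)
    = inner_L2 gauss (Hermite \<alpha>' \<beta>') (Hermite (\<alpha>(j := Suc (\<alpha> j))) \<beta>)"
proof -
  have "inner_L2 gauss (\<lambda>z. of_nat (\<alpha>' j) * Hermite (\<alpha>'(j := \<alpha>' j - 1)) \<beta>' z) (Hermite \<alpha> \<beta>)
      = (\<Sum>i\<in>{j}. 1 * inner_L2 gauss (Hermite \<alpha>' \<beta>') (Hermite (\<alpha>(i := Suc (\<alpha> i))) \<beta>))"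
  proof (rule weak_derivative_inner_Hermite)
    fix \<eta> :: "complex ^ 'a \<Rightarrow> complex" assume "test_function \<eta>"
    from integration_by_parts_d_zbar[OF this smooth_Hermite, of \<alpha>' \<beta>' j]
    show "(\<Sum>i\<in>{j}. 1 * (- (LINT z|lborel. Hermite \<alpha>' \<beta>' z * d_zbar i \<eta> z)))
        = (LINT z|lborel. of_nat (\<alpha>' j) * Hermite (\<alpha>'(j := \<alpha>' j - 1)) \<beta>' z * \<eta> z)"
      by (simp add: d_zbar_Hermite mult_ac)
  qed (auto intro: Hermite_L2)
  then show ?thesis
    by (simp add: inner_L2_scale_left)
qed

definition multi_fact :: "('n::finite \<Rightarrow> nat) \<Rightarrow> nat" where
  "multi_fact \<alpha> = (\<Prod>k\<in>UNIV. fact (\<alpha> k))"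

lemma multi_fact_Suc: "multi_fact (\<alpha>(j := Suc (\<alpha> j))) = Suc (\<alpha> j) * multi_fact \<alpha>"
proof -
  have "multi_fact \<alpha> = fact (\<alpha> j) * (\<Prod>k\<in>UNIV - {j}. fact (\<alpha> k))" for \<alpha> :: "'a \<Rightarrow> nat"
    unfolding multi_fact_def by (rule prod.remove) auto
  from this[of "\<alpha>(j := Suc (\<alpha> j))"] this[of \<alpha>] show ?thesis
    by (simp add: algebra_simps)
qed

text \<open>Moving the raising operators from the second argument to the first, where they lower the degree, removes \<open>\<alpha>\<close>.
  Since conjugation exchanges \<open>\<alpha>\<close> and \<open>\<beta>\<close>, a second application removes \<open>\<beta>\<close>.\<close>

lemma inner_Hermite_reduce:
  "inner_L2 gauss (Hermite \<alpha>' \<beta>') (Hermite \<alpha> \<beta>) =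
    (if \<alpha>' = \<alpha> then of_nat (multi_fact \<alpha>) * inner_L2 gauss (Hermite (\<lambda>_. 0) \<beta>') (Hermite (\<lambda>_. 0) \<beta>) else 0)"
proof (induction "\<Sum>k\<in>UNIV. \<alpha> k" arbitrary: \<alpha> \<alpha>')
  case 0
  then have \<alpha>: "\<alpha> = (\<lambda>_. 0)"
    by (auto simp: fun_eq_iff)
  show ?case
  proof (cases "\<alpha>' = \<alpha>")
    case False
    then obtain j where j: "\<alpha>' j > 0"
      using \<alpha> by (auto simp: fun_eq_iff)
    have "of_nat (\<alpha> j) * inner_L2 gauss (Hermite (\<alpha>(j := \<alpha> j - 1)) \<beta>) (Hermite (\<alpha>'(j := \<alpha>' j - 1)) \<beta>')
        = inner_L2 gauss (Hermite \<alpha> \<beta>) (Hermite \<alpha>' \<beta>')"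
      using j by (subst Hermite_lower_raise) simp
    then have "inner_L2 gauss (Hermite \<alpha> \<beta>) (Hermite \<alpha>' \<beta>') = 0"
      by (simp add: \<alpha>)
    then show ?thesis
      using False inner_L2_cnj[of gauss "Hermite \<alpha> \<beta>" "Hermite \<alpha>' \<beta>'"] by simp
  qed (simp add: \<alpha> multi_fact_def)
next
  case (Suc m)
  then obtain j where "\<alpha> j > 0"
    by (metis Zero_not_Suc gr0I sum.neutral)
  define \<gamma> where "\<gamma> = \<alpha>(j := \<alpha> j - 1)"
  have \<alpha>: "\<alpha> = \<gamma>(j := Suc (\<gamma> j))"
    using \<open>\<alpha> j > 0\<close> by (simp add: \<gamma>_def)
  have "(\<Sum>k\<in>UNIV. \<alpha> k) = Suc (\<gamma> j) + (\<Sum>k\<in>UNIV - {j}. \<gamma> k)"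
    by (subst sum.remove[of _ j]) (auto simp: \<alpha>)
  moreover have "(\<Sum>k\<in>UNIV. \<gamma> k) = \<gamma> j + (\<Sum>k\<in>UNIV - {j}. \<gamma> k)"
    by (rule sum.remove) auto
  ultimately have m: "m = (\<Sum>k\<in>UNIV. \<gamma> k)"
    using Suc.hyps(2) by simp
  have *: "inner_L2 gauss (Hermite \<alpha>' \<beta>') (Hermite \<alpha> \<beta>) =
      of_nat (\<alpha>' j) * inner_L2 gauss (Hermite (\<alpha>'(j := \<alpha>' j - 1)) \<beta>') (Hermite \<gamma> \<beta>)"
    by (subst Hermite_lower_raise) (simp add: \<alpha>)
  have eq: "\<alpha>'(j := \<alpha>' j - 1) = \<gamma> \<longleftrightarrow> \<alpha>' = \<alpha>" if "\<alpha>' j \<noteq> 0"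
  proof
    assume e: "\<alpha>'(j := \<alpha>' j - 1) = \<gamma>"
    have j: "\<alpha>' j = Suc (\<gamma> j)"
      using fun_cong[OF e, of j] that by simp
    have "\<alpha>' = \<gamma>(j := \<alpha>' j)"
      unfolding e[symmetric] by simp
    also have "\<dots> = \<gamma>(j := Suc (\<gamma> j))"
      by (simp only: j)
    also have "\<dots> = \<alpha>"
      by (rule \<alpha>[symmetric])
    finally show "\<alpha>' = \<alpha>" .
  next
    assume "\<alpha>' = \<alpha>"
    then show "\<alpha>'(j := \<alpha>' j - 1) = \<gamma>"
      by (simp only: \<gamma>_def)
  qed
  show ?case
  proof (cases "\<alpha>' j = 0")
    case True
    then have "\<alpha>' \<noteq> \<alpha>"
      using \<open>\<alpha> j > 0\<close> by auto
    then show ?thesis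
      by (simp add: * True)
  next
    case False
    have "multi_fact \<alpha> = \<alpha> j * multi_fact \<gamma>"
      unfolding \<alpha> multi_fact_Suc by simp
    then show ?thesis
      unfolding * Suc.hyps(1)[OF m] eq[OF False] by simp
  qed
qed

definition gauss_mass :: "'n::finite itself \<Rightarrow> real" where
  "gauss_mass _ = (LINT z::complex ^ 'n|gauss. 1)"

lemma inner_Hermite_zero:
  "inner_L2 gauss (Hermite (\<lambda>_. 0) (\<lambda>_. 0)) (Hermite (\<lambda>_::'n::finite. 0) (\<lambda>_. 0)) =
    of_real (gauss_mass TYPE('n))"
  by (simp add: inner_L2_def Hermite_def gauss_mass_def scaleR_conv_of_real)

lemma gauss_mass_pos: "gauss_mass TYPE('n::finite) > 0"
proof -
  have one: "(\<lambda>z::complex ^ 'n. 1) \<in> L2 gauss"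
    by (intro poly_bounded_L2 poly_bounded_const) simp
  have "(LINT z::complex ^ 'n|gauss. (1::real)) \<ge> 0"
    by (rule integral_nonneg_AE) simp
  moreover have "(LINT z::complex ^ 'n|gauss. (1::real)) \<noteq> 0"
  proof
    assume "(LINT z::complex ^ 'n|gauss. (1::real)) = 0"
    then have "AE z::complex ^ 'n in gauss. (1::complex) = 0"
      by (intro norm_L2_eq_0_imp_AE[OF one]) (simp add: inner_L2_self)
    then show False
      by (simp add: AE_gauss AE_iff_null null_sets_def emeasure_lborel_UNIV)
  qed
  ultimately show ?thesis
    unfolding gauss_mass_def less_le by metis
qed

definition Hermite_norm :: "('n::finite \<Rightarrow> nat) \<Rightarrow> ('n \<Rightarrow> nat) \<Rightarrow> real" where
  "Hermite_norm \<alpha> \<beta> = multi_fact \<alpha> * multi_fact \<beta> * gauss_mass TYPE('n)"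

lemma inner_Hermite:
  "inner_L2 gauss (Hermite \<alpha>' \<beta>') (Hermite \<alpha> \<beta>) =
    (if \<alpha>' = \<alpha> \<and> \<beta>' = \<beta> then of_real (Hermite_norm \<alpha> \<beta>) else 0)"
proof -
  have "inner_L2 gauss (Hermite (\<lambda>_. 0) \<beta>') (Hermite (\<lambda>_. 0) \<beta>)
      = inner_L2 gauss (Hermite \<beta> (\<lambda>_. 0)) (Hermite \<beta>' (\<lambda>_. 0))"
    by (simp add: inner_L2_def cnj_Hermite mult.commute)
  also have "\<dots> = (if \<beta> = \<beta>' then of_nat (multi_fact \<beta>') * of_real (gauss_mass TYPE('a)) else 0)"
    by (subst inner_Hermite_reduce) (simp add: inner_Hermite_zero)
  finally show ?thesis
    by (subst inner_Hermite_reduce) (auto simp: Hermite_norm_def)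
qed

lemma Hermite_norm_pos: "Hermite_norm \<alpha> \<beta> > 0"
  by (simp add: Hermite_norm_def multi_fact_def gauss_mass_pos prod_pos)

section \<open>Completeness of the Hermite polynomials\<close>

text \<open>The sets over which \<open>F\<close> has integral zero form a Dynkin system, and the closed sets are an
  intersection-stable generator of the Borel sets.\<close>

lemma integral_closed_zero_imp_AE_zero:
  fixes F :: "'a::euclidean_space \<Rightarrow> complex"
  assumes F: "integrable lborel F"
    and closed: "\<And>A. closed A \<Longrightarrow> (LINT z:A|lborel. F z) = 0"
  shows "AE z in lborel. F z = 0"
proof (rule sigma_finite_measure.density_zero[OF sigma_finite_lborel F])
  have set_int: "set_integrable lborel A F" if "A \<in> sets borel" for A
    unfolding set_integrable_def using that by (intro integrable_mult_indicator F) simp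
  fix A :: "'a set" assume "A \<in> sets lborel"
  then have A: "A \<in> sigma_sets UNIV (Collect closed)"
    by (simp add: borel_eq_closed)
  have sets: "sigma_sets UNIV (Collect closed) = sets (borel :: 'a measure)"
    by (simp add: borel_eq_closed)
  have "Int_stable (Collect closed :: 'a set set)"
    by (auto simp: Int_stable_def)
  moreover have "Collect closed \<subseteq> Pow (UNIV :: 'a set)"
    by simp
  ultimately show "(LINT z:A|lborel. F z) = 0"
    using A
  proof (induction rule: sigma_sets_induct_disjoint)
    case (basic A)
    then show ?case
      using closed by simp
  next
    case empty
    then show ?case
      by (simp add: set_lebesgue_integral_def)
  next
    case (compl A)
    then have A: "A \<in> sets borel"
      using sets by simp
    have "(LINT z:UNIV|lborel. F z) = (LINT z:(UNIV - A) \<union> A|lborel. F z)"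
      by simp
    also have "\<dots> = (LINT z:UNIV - A|lborel. F z) + (LINT z:A|lborel. F z)"
      using A by (intro set_integral_Un set_int) auto
    finally show ?case
      using closed[of UNIV] compl by simp
  next
    case (union A)
    have A: "A i \<in> sets borel" for i
      using union.hyps sets by blast
    then have "(LINT z:(\<Union>i. A i)|lborel. F z) = (\<Sum>i. (LINT z:A i|lborel. F z))"
      using union.hyps(1)
      by (intro lebesgue_integral_countable_add set_int) (auto simp: disjoint_family_on_def)
    then show ?case
      using union by simp
  qed
qed

lemma integrable_Gaussian:
  "c > 0 \<Longrightarrow> integrable lborel (\<lambda>z::'a::euclidean_space. exp (- (c * (norm z)\<^sup>2)))"
  using integrable_power_times_Gaussian[of c 0] by simp

lemma integral_lborel_affine:
  fixes f :: "'a::euclidean_space \<Rightarrow> real"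
  assumes [measurable]: "f \<in> borel_measurable borel" and "c \<noteq> 0"
  shows "(LINT y|lborel. f y) = \<bar>c\<bar> ^ DIM('a) * (LINT w|lborel. f (t + c *\<^sub>R w))"
proof -
  have "(LINT y|lborel. f y) = (LINT y|density (distr lborel borel (\<lambda>x. t + c *\<^sub>R x)) (\<lambda>_. \<bar>c\<bar> ^ DIM('a)). f y)"
    using lborel_affine[OF assms(2), of t] by simp
  also have "\<dots> = (LINT y|distr lborel borel (\<lambda>x. t + c *\<^sub>R x). \<bar>c\<bar> ^ DIM('a) *\<^sub>R f y)"
    by (subst integral_density) auto
  also have "\<dots> = (LINT w|lborel. \<bar>c\<bar> ^ DIM('a) *\<^sub>R f (t + c *\<^sub>R w))"
    by (subst integral_distr) auto
  finally show ?thesis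
    by simp
qed

text \<open>When \<open>F\<close> is convolved with a narrow Gaussian and the result is integrated against a continuous bounded
  function \<open>h\<close>, Fubini's theorem lets the Gaussian mollify \<open>h\<close>
  instead, and the mollified functions converge pointwise to a multiple of \<open>h\<close>.\<close>

lemma Gaussian_convolutions_zero_imp_AE_zero:
  fixes F :: "'a::euclidean_space \<Rightarrow> complex"
  assumes F: "integrable lborel F"
    and conv: "\<And>m y. m > 0 \<Longrightarrow> (LINT z|lborel. F z * of_real (exp (- (real m / 4 * (norm (z - y))\<^sup>2)))) = 0"
  shows "AE z in lborel. F z = 0"
proof (rule integral_closed_zero_imp_AE_zero[OF F])
  have Fm [measurable]: "F \<in> borel_measurable borel"
    using borel_measurable_integrable[OF F] by simp
  let ?g = "\<lambda>w::'a. exp (- (1 / 4 * (norm w)\<^sup>2))"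
  have gi: "integrable lborel ?g"
    by (rule integrable_Gaussian) simp
  define C where "C = (LINT w|lborel. ?g w)"
  have Cpos: "C \<noteq> 0"
  proof
    assume "C = 0"
    then have "AE w in lborel. ?g w = 0"
      unfolding C_def using integral_nonneg_eq_0_iff_AE[OF gi] by simp
    then show False
      by (simp add: AE_iff_null null_sets_def emeasure_lborel_UNIV)
  qed
  have bounded_continuous: "(LINT z|lborel. F z * of_real (h z)) = 0"
    if h: "continuous_on UNIV h" "\<And>z. 0 \<le> h z" "\<And>z. h z \<le> 1" for h :: "'a \<Rightarrow> real"
  proof -
    have hm [measurable]: "h \<in> borel_measurable borel"
      by (rule borel_measurable_continuous_onI[OF h(1)])
    define A where "A k z = (LINT w|lborel. h (z + (1 / real (Suc k)) *\<^sub>R w) * ?g w)" for k z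
    have Am [measurable]: "A k \<in> borel_measurable borel" for k
      unfolding A_def by measurable
    have int: "integrable lborel (\<lambda>w. h (f w) * ?g w)" if [measurable]: "f \<in> borel \<rightarrow>\<^sub>M borel" for f :: "'a \<Rightarrow> 'a"
      by (rule Bochner_Integration.integrable_bound[OF gi])
        (use h in \<open>auto simp: abs_mult mult_left_le_one_le\<close>)
    have A_bound: "\<bar>A k z\<bar> \<le> C" for k z
    proof -
      have "A k z \<le> C"
        unfolding A_def C_def by (intro integral_mono int gi) (use h in \<open>auto simp: mult_left_le_one_le\<close>)
      moreover have "0 \<le> A k z"
        unfolding A_def by (intro integral_nonneg_AE) (use h in auto)
      ultimately show ?thesis by simp
    qed
    have A_lim: "(\<lambda>k. A k z) \<longlonglongrightarrow> h z * C" for z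
    proof -
      have "(\<lambda>k. A k z) \<longlonglongrightarrow> (LINT w|lborel. h z * ?g w)"
        unfolding A_def
      proof (rule integral_dominated_convergence[OF _ _ gi])
        have "(\<lambda>k. z + (1 / real (Suc k)) *\<^sub>R w) \<longlonglongrightarrow> z" for w
          using tendsto_add[OF tendsto_const tendsto_scaleR[OF LIMSEQ_inverse_real_of_nat tendsto_const[of w]], of z]
          by (simp add: inverse_eq_divide)
        then have "(\<lambda>k. h (z + (1 / real (Suc k)) *\<^sub>R w)) \<longlonglongrightarrow> h z" for w
          by (rule continuous_on_tendsto_compose[OF h(1) _ UNIV_I]) simp
        then show "AE w in lborel. (\<lambda>k. h (z + (1 / real (Suc k)) *\<^sub>R w) * ?g w) \<longlonglongrightarrow> h z * ?g w"
          by (intro AE_I2 tendsto_mult tendsto_const)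
        show "AE w in lborel. norm (h (z + (1 / real (Suc k)) *\<^sub>R w) * ?g w) \<le> ?g w" for k
          using h by (intro AE_I2) (auto simp: abs_mult mult_left_le_one_le)
      qed auto
      then show ?thesis
        by (simp add: C_def)
    qed
    have zero: "(LINT z|lborel. F z * of_real (A k z)) = 0" for k
    proof -
      \<comment> \<open>The parameter of this Gaussian makes it \<open>?g w\<close> when \<open>y = z + w / Suc k\<close>.\<close>
      define e where "e z y = exp (- (real ((Suc k)\<^sup>2) / 4 * (norm (z - y))\<^sup>2))" for z y :: 'a
      have em [measurable]: "(\<lambda>p. e (fst p) (snd p)) \<in> borel_measurable (borel \<Otimes>\<^sub>M borel)"
        unfolding e_def by measurable
      have em1 [measurable]: "(\<lambda>y. e z y) \<in> borel_measurable borel" "(\<lambda>z. e z y) \<in> borel_measurable borel" for z y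
        unfolding e_def by measurable
      define c where "c = (1 / real (Suc k)) ^ DIM('a)"
      have c: "c > 0"
        by (simp add: c_def)
      have eA: "(LINT y|lborel. h y * e z y) = c * A k z" for z
      proof -
        have "(LINT y|lborel. h y * e z y) = \<bar>1 / real (Suc k)\<bar> ^ DIM('a) *
            (LINT w|lborel. h (z + (1 / real (Suc k)) *\<^sub>R w) * e z (z + (1 / real (Suc k)) *\<^sub>R w))"
          by (rule integral_lborel_affine) auto
        moreover have "e z (z + (1 / real (Suc k)) *\<^sub>R w) = ?g w" for w
        proof -
          have "real ((Suc k)\<^sup>2) / 4 * (norm (z - (z + (1 / real (Suc k)) *\<^sub>R w)))\<^sup>2
              = real ((Suc k)\<^sup>2) / 4 * ((1 / real (Suc k))\<^sup>2 * (norm w)\<^sup>2)"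
            by (simp add: power_mult_distrib power_divide del: of_nat_Suc)
          also have "\<dots> = 1 / 4 * (norm w)\<^sup>2"
            by (simp add: power_divide del: of_nat_Suc)
          finally show ?thesis
            unfolding e_def by (simp only:)
        qed
        ultimately show ?thesis
          by (simp add: A_def c_def)
      qed
      have eint: "integrable lborel (\<lambda>y. h y * e z y)" for z
      proof -
        have "integrable lborel (\<lambda>y. exp (- (real ((Suc k)\<^sup>2) / 4 * (norm (- z + y))\<^sup>2)))"
          by (rule lborel_integral_translate(2)[of "\<lambda>y. exp (- (real ((Suc k)\<^sup>2) / 4 * (norm y)\<^sup>2))"])
            (measurable, rule integrable_Gaussian, simp)
        moreover have "norm (- z + y) = norm (z - y)" for y
          by (metis minus_diff_eq norm_minus_cancel uminus_add_conv_diff)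
        ultimately have "integrable lborel (\<lambda>y. e z y)"
          by (simp add: e_def)
        then show ?thesis
          by (rule Bochner_Integration.integrable_bound)
            (use h in \<open>auto simp: abs_mult mult_left_le_one_le e_def\<close>)
      qed
      let ?f = "\<lambda>z y. F z * of_real (h y * e z y)"
      have prod: "integrable (lborel \<Otimes>\<^sub>M lborel) (case_prod ?f)"
      proof (rule lborel_pair.Fubini_integrable)
        show "case_prod ?f \<in> borel_measurable (lborel \<Otimes>\<^sub>M lborel)"
          unfolding case_prod_beta by measurable
        have "(LINT y|lborel. norm (case_prod ?f (z, y))) = cmod (F z) * (c * A k z)" for z
        proof -
          have "norm (case_prod ?f (z, y)) = cmod (F z) * (h y * e z y)" for y
            using h(2)[of y] by (simp add: norm_mult e_def)
          then show ?thesis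
            using eA[of z] by simp
        qed
        moreover have "integrable lborel (\<lambda>z. cmod (F z) * (c * A k z))"
        proof (rule Bochner_Integration.integrable_bound)
          show "integrable lborel (\<lambda>z. cmod (F z) * (c * C))"
            using F by simp
          show "AE z in lborel. norm (cmod (F z) * (c * A k z)) \<le> norm (cmod (F z) * (c * C))"
            using order_trans[OF A_bound abs_ge_self[of C]] c
            by (intro AE_I2) (auto simp: abs_mult intro!: mult_left_mono)
        qed measurable
        ultimately show "integrable lborel (\<lambda>z. LINT y|lborel. norm (case_prod ?f (z, y)))"
          by simp
        show "AE z in lborel. integrable lborel (\<lambda>y. case_prod ?f (z, y))"
          unfolding prod.case by (intro AE_I2 integrable_mult_right integrable_of_real eint)
      qed
      have swap: "(LINT z|lborel. LINT y|lborel. ?f z y) = (LINT y|lborel. LINT z|lborel. ?f z y)"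
        by (rule lborel_pair.Fubini_integral[OF prod, symmetric])
      have inner_z: "(LINT z|lborel. ?f z y) = 0" for y
      proof -
        have "(LINT z|lborel. ?f z y) = (LINT z|lborel. of_real (h y) *
            (F z * of_real (exp (- (real ((Suc k)\<^sup>2) / 4 * (norm (z - y))\<^sup>2)))))"
          by (intro Bochner_Integration.integral_cong refl) (simp add: e_def mult_ac)
        also have "\<dots> = of_real (h y) * 0"
          unfolding integral_mult_right_zero by (subst conv) auto
        finally show ?thesis by simp
      qed
      have inner_y: "(LINT y|lborel. ?f z y) = F z * of_real (c * A k z)" for z
        unfolding eA[symmetric] by (simp only: integral_mult_right_zero integral_complex_of_real)
      have "(LINT z|lborel. of_real c * (F z * of_real (A k z))) = 0"
        using swap unfolding inner_z inner_y by (simp add: mult_ac)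
      then have "of_real c * (LINT z|lborel. F z * of_real (A k z)) = 0"
        by (simp only: integral_mult_right_zero)
      then show ?thesis
        using c by simp
    qed
    have "(\<lambda>k. LINT z|lborel. F z * of_real (A k z)) \<longlonglongrightarrow> (LINT z|lborel. F z * of_real (h z * C))"
    proof (rule integral_dominated_convergence)
      show "integrable lborel (\<lambda>z. norm (F z) * C)"
        using F by simp
      show "AE z in lborel. (\<lambda>k. F z * of_real (A k z)) \<longlonglongrightarrow> F z * of_real (h z * C)"
        by (intro AE_I2 tendsto_mult tendsto_of_real tendsto_const A_lim)
      show "AE z in lborel. norm (F z * of_real (A k z)) \<le> norm (F z) * C" for k
        using A_bound by (intro AE_I2) (simp add: norm_mult mult_left_mono)
    qed measurable
    then have "(LINT z|lborel. F z * of_real (h z * C)) = 0"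
      by (simp add: zero LIMSEQ_const_iff)
    moreover have "(LINT z|lborel. F z * of_real (h z * C)) = (LINT z|lborel. F z * of_real (h z)) * of_real C"
      by (simp flip: integral_mult_left_zero add: mult.assoc)
    ultimately show ?thesis
      using Cpos by simp
  qed
  fix A :: "'a set" assume A: "closed A"
  show "(LINT z:A|lborel. F z) = 0"
  proof (cases "A = {}")
    case False
    define h where "h k z = max 0 (1 - real k * infdist z A)" for k z
    have h: "continuous_on UNIV (h k)" "0 \<le> h k z" "h k z \<le> 1" for k z
      unfolding h_def by (auto intro!: continuous_intros simp: infdist_nonneg)
    have hm [measurable]: "h k \<in> borel_measurable borel" for k
      by (rule borel_measurable_continuous_onI[OF h(1)])
    have Am [measurable]: "A \<in> sets borel"
      using A by (rule borel_closed)
    have h_lim: "(\<lambda>k. h k z) \<longlonglongrightarrow> indicator A z" for z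
    proof (cases "z \<in> A")
      case True
      then show ?thesis
        by (simp add: h_def)
    next
      case False
      then have d: "infdist z A > 0"
        using in_closed_iff_infdist_zero[OF A \<open>A \<noteq> {}\<close>, of z] infdist_nonneg[of z A] by simp
      then obtain K where K: "1 < real K * infdist z A"
        using reals_Archimedean3 by blast
      have "h k z = 0" if "k \<ge> K" for k
      proof -
        have "real K * infdist z A \<le> real k * infdist z A"
          using that d by (intro mult_right_mono) auto
        then show ?thesis
          using K by (simp add: h_def)
      qed
      then have "\<forall>\<^sub>F k in sequentially. h k z = indicator A z"
        using False by (auto simp: eventually_sequentially)
      then show ?thesis
        by (rule tendsto_eventually)
    qed
    have "(\<lambda>k. LINT z|lborel. F z * of_real (h k z)) \<longlonglongrightarrow> (LINT z|lborel. F z * of_real (indicator A z))"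
    proof (rule integral_dominated_convergence)
      show "integrable lborel (\<lambda>z. norm (F z))"
        using F by simp
      show "AE z in lborel. (\<lambda>k. F z * of_real (h k z)) \<longlonglongrightarrow> F z * of_real (indicator A z)"
        by (intro AE_I2 tendsto_mult tendsto_of_real tendsto_const h_lim)
      show "AE z in lborel. norm (F z * of_real (h k z)) \<le> norm (F z)" for k
        using h by (intro AE_I2) (simp add: norm_mult mult_left_le)
    qed measurable
    moreover have "(LINT z|lborel. F z * of_real (h k z)) = 0" for k
      by (rule bounded_continuous) (rule h)+
    ultimately have "(LINT z|lborel. F z * of_real (indicator A z)) = 0"
      by (simp add: LIMSEQ_const_iff)
    then show ?thesis
      unfolding set_lebesgue_integral_def by (simp add: scaleR_conv_of_real mult.commute)
  qed (simp add: set_lebesgue_integral_def)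
qed

text \<open>The span of the Hermite polynomials.  It is the space of all polynomials in the coordinates and
  their conjugates, because it is closed under multiplication by them.\<close>

inductive Hermite_span :: "(complex ^ 'n::finite \<Rightarrow> complex) \<Rightarrow> bool" where
  Hermite: "Hermite_span (Hermite \<alpha> \<beta>)"
| add: "Hermite_span p \<Longrightarrow> Hermite_span r \<Longrightarrow> Hermite_span (\<lambda>z. p z + r z)"
| scale: "Hermite_span p \<Longrightarrow> Hermite_span (\<lambda>z. c * p z)"

definition span_multiplier :: "(complex ^ 'n::finite \<Rightarrow> complex) \<Rightarrow> bool" where
  "span_multiplier L \<longleftrightarrow> (\<forall>p. Hermite_span p \<longrightarrow> Hermite_span (\<lambda>z. L z * p z))"

lemma span_multiplier_component: "span_multiplier (\<lambda>z. z $ j)"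
  unfolding span_multiplier_def
proof (intro allI impI)
  fix p :: "complex ^ 'a \<Rightarrow> complex" assume "Hermite_span p"
  then show "Hermite_span (\<lambda>z. z $ j * p z)"
  proof (induction rule: Hermite_span.induct)
    case (Hermite \<alpha> \<beta>)
    show ?case
      unfolding mult_Hermite by (intro Hermite_span.intros)
  next
    case (add p r)
    then show ?case
      unfolding distrib_left by (intro Hermite_span.add)
  next
    case (scale p c)
    then show ?case
      unfolding mult.left_commute[of _ c] by (intro Hermite_span.scale)
  qed
qed

lemma span_multiplier_cnj_component: "span_multiplier (\<lambda>z. cnj (z $ j))"
  unfolding span_multiplier_def
proof (intro allI impI)
  fix p :: "complex ^ 'a \<Rightarrow> complex" assume "Hermite_span p"
  then show "Hermite_span (\<lambda>z. cnj (z $ j) * p z)"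
  proof (induction rule: Hermite_span.induct)
    case (Hermite \<alpha> \<beta>)
    show ?case
      unfolding cnj_mult_Hermite by (intro Hermite_span.intros)
  next
    case (add p r)
    then show ?case
      unfolding distrib_left by (intro Hermite_span.add)
  next
    case (scale p c)
    then show ?case
      unfolding mult.left_commute[of _ c] by (intro Hermite_span.scale)
  qed
qed

lemma span_multiplier_const: "span_multiplier (\<lambda>z. c)"
  by (simp add: span_multiplier_def Hermite_span.scale)

lemma span_multiplier_mult: "span_multiplier L \<Longrightarrow> span_multiplier K \<Longrightarrow> span_multiplier (\<lambda>z. L z * K z)"
  by (simp add: span_multiplier_def mult.assoc)

lemma span_multiplier_add: "span_multiplier L \<Longrightarrow> span_multiplier K \<Longrightarrow> span_multiplier (\<lambda>z. L z + K z)"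
  by (simp add: span_multiplier_def distrib_right Hermite_span.add)

lemma span_multiplier_sum:
  "finite I \<Longrightarrow> (\<And>i. i \<in> I \<Longrightarrow> span_multiplier (L i)) \<Longrightarrow> span_multiplier (\<lambda>z. \<Sum>i\<in>I. L i z)"
  by (induction I rule: finite_induct) (auto intro: span_multiplier_add span_multiplier_const[of 0, simplified])

lemma span_multiplier_power: "span_multiplier L \<Longrightarrow> span_multiplier (\<lambda>z. L z ^ k)"
  by (induction k) (auto intro: span_multiplier_mult span_multiplier_const[of 1, simplified])

lemma Hermite_span_smooth: "Hermite_span p \<Longrightarrow> smooth p"
  by (induction rule: Hermite_span.induct) (auto intro: smooth_Hermite smooth_add smooth_mult)

lemma Hermite_span_poly_bounded: "Hermite_span p \<Longrightarrow> poly_bounded p"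
  by (induction rule: Hermite_span.induct)
    (auto intro: poly_bounded_Hermite poly_bounded_add poly_bounded_mult poly_bounded_const)

lemma Hermite_span_1: "Hermite_span (\<lambda>z. 1)"
  using Hermite_span.Hermite[of "\<lambda>_. 0" "\<lambda>_. 0"] by (simp add: Hermite_def[abs_def])

text \<open>The partial sums of the exponential series are polynomials, and \<open>exp (\<bar>z\<bar>\<^sup>2/4 + C)\<close> dominates all of them, so
  that the series may be integrated term by term.\<close>

lemma orthogonal_exp:
  fixes F :: "complex ^ 'n::finite \<Rightarrow> complex"
  assumes [measurable]: "F \<in> borel_measurable borel"
    and int: "\<And>p. Hermite_span p \<Longrightarrow> integrable lborel (\<lambda>z. F z * p z * of_real (exp (weight z / 4)))"
    and orth: "\<And>p. Hermite_span p \<Longrightarrow> (LINT z|lborel. F z * p z) = 0"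
    and L: "span_multiplier L" "\<And>z. cmod (L z) \<le> weight z / 4 + C"
    and p: "Hermite_span p"
  shows "(LINT z|lborel. F z * p z * exp (L z)) = 0"
proof -
  have [measurable]: "p \<in> borel_measurable borel"
    by (rule smooth_measurable[OF Hermite_span_smooth[OF p]])
  have [measurable]: "L \<in> borel_measurable borel"
    using smooth_measurable[OF Hermite_span_smooth[OF L(1)[unfolded span_multiplier_def, rule_format, OF Hermite_span_1]]]
    by simp
  define S where "S k z = (\<Sum>i<k. L z ^ i /\<^sub>R fact i)" for k z
  have [measurable]: "S k \<in> borel_measurable borel" for k
    unfolding S_def by measurable
  have "(\<lambda>k. LINT z|lborel. F z * p z * S k z) \<longlonglongrightarrow> (LINT z|lborel. F z * p z * exp (L z))"
  proof (rule integral_dominated_convergence)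
    show "integrable lborel (\<lambda>z. exp C * norm (F z * p z * of_real (exp (weight z / 4))))"
      by (intro integrable_mult_right integrable_norm int p)
    show "AE z in lborel. (\<lambda>k. F z * p z * S k z) \<longlonglongrightarrow> F z * p z * exp (L z)"
      using exp_converges[of "L z" for z] unfolding S_def sums_def by (intro AE_I2 tendsto_mult tendsto_const) blast
    have "cmod (S k z) \<le> exp C * exp (weight z / 4)" for k z
    proof -
      have "cmod (S k z) \<le> (\<Sum>i<k. cmod (L z) ^ i /\<^sub>R fact i)"
        unfolding S_def by (rule order_trans[OF norm_sum]) (simp add: norm_power norm_mult norm_inverse)
      also have "\<dots> \<le> (\<Sum>i. cmod (L z) ^ i /\<^sub>R fact i)"
        by (intro sum_le_suminf sums_summable[OF exp_converges]) auto
      also have "\<dots> = exp (cmod (L z))"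
        using sums_unique[OF exp_converges[of "cmod (L z)"]] by simp
      also have "\<dots> \<le> exp (weight z / 4 + C)"
        using L(2) by simp
      finally show ?thesis
        by (simp add: exp_add mult.commute)
    qed
    then show "AE z in lborel. norm (F z * p z * S k z) \<le> exp C * norm (F z * p z * of_real (exp (weight z / 4)))" for k
    proof (intro AE_I2)
      fix z
      assume b: "\<And>k z. cmod (S k z) \<le> exp C * exp (weight z / 4)"
      have "norm (F z * p z) * cmod (S k z) \<le> norm (F z * p z) * (exp C * exp (weight z / 4))"
        by (intro mult_left_mono b norm_ge_zero)
      then show "norm (F z * p z * S k z) \<le> exp C * norm (F z * p z * of_real (exp (weight z / 4)))"
        by (simp add: norm_mult mult_ac)
    qed
  qed measurable
  moreover have "(LINT z|lborel. F z * p z * S k z) = 0" for k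
  proof -
    have "span_multiplier (S k)"
      unfolding S_def[abs_def] scaleR_conv_of_real
      by (intro span_multiplier_sum span_multiplier_mult span_multiplier_const span_multiplier_power L) simp
    then have "Hermite_span (\<lambda>z. S k z * p z)"
      using p by (simp add: span_multiplier_def)
    from orth[OF this] show ?thesis
      by (simp add: mult_ac)
  qed
  ultimately show ?thesis
    by (simp add: LIMSEQ_const_iff)
qed

text \<open>The exponential series gives
  orthogonality to \<open>e\<^bsup>-\<bar>z\<bar>\<^sup>2/4\<^esup> p\<close> only, since it has to be dominated by the Gaussian weight; but then the
  argument applies again to \<open>e\<^bsup>-\<bar>z\<bar>\<^sup>2/4\<^esup> f\<close>, and so on, which gives arbitrarily narrow Gaussians.  A last
  application with a linear exponent moves their centres.\<close>

theorem Hermite_complete: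
  fixes f :: "complex ^ 'n::finite \<Rightarrow> complex"
  assumes f: "f \<in> L2 gauss" and orth: "\<And>\<alpha> \<beta>. inner_L2 gauss f (Hermite \<alpha> \<beta>) = 0"
  shows "AE z in gauss. f z = 0"
proof -
  have fm [measurable]: "f \<in> borel_measurable borel"
    by (rule L2_gauss_measurable[OF f])
  define F where "F m z = f z * of_real (exp (- weight z)) * of_real (exp (- (real m / 4 * weight z)))" for m z
  have Fm [measurable]: "F m \<in> borel_measurable borel" for m
    unfolding F_def by measurable
  have w0: "0 \<le> weight z" for z :: "complex ^ 'n"
    by (simp add: weight_eq_norm)
  have int: "integrable lborel (\<lambda>z. F m z * p z * of_real (exp (weight z / 4)))" if p: "Hermite_span p" for m p
  proof -
    have [measurable]: "p \<in> borel_measurable borel"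
      by (rule smooth_measurable[OF Hermite_span_smooth[OF p]])
    have "(\<lambda>z. p z * of_real (exp (1 / 4 * weight z))) \<in> L2 gauss"
      by (intro poly_bounded_times_Gaussian_L2 Hermite_span_poly_bounded p) auto
    then have "integrable gauss (\<lambda>z. f z * (p z * of_real (exp (1 / 4 * weight z))))"
      by (rule integrable_L2_mult[OF f])
    then have "integrable lborel (\<lambda>z. exp (- weight z) *\<^sub>R (f z * (p z * of_real (exp (1 / 4 * weight z)))))"
      by (subst (asm) integrable_gauss) auto
    then show ?thesis
    proof (rule Bochner_Integration.integrable_bound)
      have "norm (F m z * p z * of_real (exp (weight z / 4)))
          = norm (exp (- weight z) *\<^sub>R (f z * (p z * of_real (exp (1 / 4 * weight z))))) * exp (- (real m / 4 * weight z))" for z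
        by (simp add: F_def norm_mult mult_ac)
      then show "AE z in lborel. norm (F m z * p z * of_real (exp (weight z / 4)))
          \<le> norm (exp (- weight z) *\<^sub>R (f z * (p z * of_real (exp (1 / 4 * weight z)))))"
        using w0 by (intro AE_I2) (simp only:, intro mult_left_le, auto)
    qed measurable
  qed
  have int0: "integrable lborel (\<lambda>z. F m z * p z)" if p: "Hermite_span p" for m p
    using int[OF p, of m]
  proof (rule Bochner_Integration.integrable_bound)
    have [measurable]: "p \<in> borel_measurable borel"
      by (rule smooth_measurable[OF Hermite_span_smooth[OF p]])
    show "(\<lambda>z. F m z * p z) \<in> borel_measurable lborel"
      by measurable
    have "norm (F m z * p z) * 1 \<le> norm (F m z * p z) * exp (weight z / 4)" for z
      using w0[of z] by (intro mult_left_mono) auto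
    then show "AE z in lborel. norm (F m z * p z) \<le> norm (F m z * p z * of_real (exp (weight z / 4)))"
      by (intro AE_I2) (simp add: norm_mult)
  qed
  have orth_F: "(LINT z|lborel. F m z * p z) = 0" if p: "Hermite_span p" for m p
    using p
  proof (induction m arbitrary: p)
    case 0
    then show ?case
    proof (induction rule: Hermite_span.induct)
      case (Hermite \<alpha> \<beta>)
      have "(\<lambda>z. f z * cnj (Hermite \<beta> \<alpha> z)) \<in> borel_measurable borel"
        by (intro borel_measurable_mult_cnj fm smooth_measurable smooth_Hermite)
      then have "(LINT z|lborel. F 0 z * Hermite \<alpha> \<beta> z) = inner_L2 gauss f (Hermite \<beta> \<alpha>)"
        unfolding inner_L2_def by (subst integral_gauss) (auto simp: F_def cnj_Hermite mult_ac)
      then show ?case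
        by (simp add: orth)
    next
      case (add p r)
      then show ?case
        using int0[of p 0] int0[of r 0] by (simp add: distrib_left)
    next
      case (scale p c)
      then show ?case
        by (simp add: mult.left_commute[of _ c])
    qed
  next
    case (Suc m)
    let ?L = "\<lambda>z::complex ^ 'n. of_real (- 1 / 4) * (\<Sum>k\<in>UNIV. z $ k * cnj (z $ k))"
    have L: "?L z = of_real (- (weight z / 4))" for z
      unfolding weight_eq_complex[symmetric] by simp
    have zero: "(LINT z|lborel. F m z * p z * exp (?L z)) = 0"
    proof (rule orthogonal_exp[where C = 0])
      show "span_multiplier ?L"
        by (intro span_multiplier_mult span_multiplier_sum span_multiplier_const span_multiplier_component
            span_multiplier_cnj_component) simp
      show "cmod (?L z) \<le> weight z / 4 + 0" for z
        unfolding L norm_of_real using w0[of z] by simp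
    qed (use int Suc in auto)
    have eq: "F m z * p z * exp (?L z) = F (Suc m) z * p z" for z
    proof -
      have "- (real (Suc m) / 4 * weight z) = - (real m / 4 * weight z) + - (weight z / 4)"
        by (simp add: field_simps)
      then have "exp (- (real (Suc m) / 4 * weight z)) = exp (- (real m / 4 * weight z)) * exp (- (weight z / 4))"
        by (simp only: exp_add)
      then show ?thesis
        unfolding L exp_of_real F_def by (simp add: mult_ac)
    qed
    show ?case
      by (rule zero[unfolded eq])
  qed
  have "(LINT z|lborel. F 0 z * of_real (exp (- (real m / 4 * (norm (z - y))\<^sup>2)))) = 0" for m y
  proof -
    let ?s = "complex_of_real (real m / 4)"
    let ?L = "\<lambda>z. ?s * (\<Sum>k\<in>UNIV. z $ k * cnj (y $ k) + cnj (z $ k) * y $ k)"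
    have Leq: "(\<Sum>k\<in>UNIV. z $ k * cnj (y $ k) + cnj (z $ k) * y $ k) = of_real (2 * (z \<bullet> y))" for z :: "complex ^ 'n"
      unfolding inner_vec_def sum_distrib_left of_real_sum
      by (intro sum.cong refl) (simp add: complex_eq_iff inner_complex_def)
    have L: "?L z = of_real (real m / 2 * (z \<bullet> y))" for z
      unfolding Leq by simp
    have zero: "(LINT z|lborel. F m z * 1 * exp (?L z)) = 0"
    proof (rule orthogonal_exp[where C = "(real m)\<^sup>2 / 4 * (norm y)\<^sup>2"])
      show "span_multiplier ?L"
        by (intro span_multiplier_mult span_multiplier_sum span_multiplier_add span_multiplier_const
            span_multiplier_component span_multiplier_cnj_component) simp
      show "cmod (?L z) \<le> weight z / 4 + (real m)\<^sup>2 / 4 * (norm y)\<^sup>2" for z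
      proof -
        have "cmod (?L z) = real m / 2 * \<bar>z \<bullet> y\<bar>"
          unfolding L norm_of_real by (simp add: abs_mult)
        also have "\<dots> \<le> real m / 2 * (norm z * norm y)"
          by (intro mult_left_mono Cauchy_Schwarz_ineq2) simp
        also have "\<dots> = 2 * (norm z / 2) * (real m * norm y / 2)"
          by simp
        also have "\<dots> \<le> (norm z / 2)\<^sup>2 + (real m * norm y / 2)\<^sup>2"
          by (rule sum_squares_bound)
        finally show ?thesis
          by (simp add: weight_eq_norm power_divide power_mult_distrib)
      qed
    qed (use int orth_F Hermite_span_1 in auto)
    have eq: "F m z * 1 * exp (?L z) = of_real (exp (real m / 4 * (norm y)\<^sup>2)) *
        (F 0 z * of_real (exp (- (real m / 4 * (norm (z - y))\<^sup>2))))" for z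
    proof -
      have n: "(norm (z - y))\<^sup>2 = (norm z)\<^sup>2 - 2 * (z \<bullet> y) + (norm y)\<^sup>2"
        by (simp add: power2_norm_eq_inner inner_diff_left inner_diff_right inner_commute)
      have "- (real m / 4 * weight z) + real m / 2 * (z \<bullet> y) =
          real m / 4 * (norm y)\<^sup>2 + - (real m / 4 * (norm (z - y))\<^sup>2)"
        unfolding weight_eq_norm n by (simp add: field_simps)
      then have "exp (- (real m / 4 * weight z)) * exp (real m / 2 * (z \<bullet> y)) =
          exp (real m / 4 * (norm y)\<^sup>2) * exp (- (real m / 4 * (norm (z - y))\<^sup>2))"
        unfolding exp_add[symmetric] by (simp only:)
      from arg_cong[OF this, of complex_of_real] show ?thesis
        unfolding L exp_of_real F_def by (simp add: mult_ac)
    qed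
    show ?thesis
      using zero unfolding eq by simp
  qed
  then have "AE z in lborel. F 0 z = 0"
    using int0[OF Hermite_span_1, of 0] by (intro Gaussian_convolutions_zero_imp_AE_zero) auto
  then show ?thesis
    by (simp add: AE_gauss F_def)
qed

interpretation hermite: orthogonal_basis gauss "\<lambda>(\<alpha>, \<beta>). Hermite \<alpha> \<beta>" "\<lambda>(\<alpha>, \<beta>). Hermite_norm \<alpha> \<beta>"
proof
  fix f :: "complex ^ 'n \<Rightarrow> complex"
  assume "f \<in> L2 gauss" "\<And>i. inner_L2 gauss f (case i of (\<alpha>, \<beta>) \<Rightarrow> Hermite \<alpha> \<beta>) = 0"
  then show "AE z in gauss. f z = 0"
    by (intro Hermite_complete) (auto dest: spec[of _ "(\<alpha>, \<beta>)" for \<alpha> \<beta>])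
qed (auto simp: Hermite_L2 inner_Hermite Hermite_norm_pos split: prod.splits)

section \<open>A Koszul complex\<close>

text \<open>The operator \<open>dbar\<close> maps \<open>Hermite \<alpha> \<beta>\<close> times the form with index \<open>J\<close> to a combination of such terms
  with indices \<open>J \<union> {j}\<close>, lowering \<open>\<alpha> j\<close> by one.  So it preserves \<open>\<beta>\<close> and the sum \<open>\<gamma>\<close> of \<open>\<alpha>\<close> and the indicator
  of \<open>J\<close>, and it acts on each of the finite-dimensional blocks with fixed \<open>\<gamma>\<close> and \<open>\<beta>\<close> as the
  differential of a Koszul complex.  In terms of the (unnormalized) Fourier coefficients \<open>U J\<close>, it is
  the following operator, and the \<open>L\<^sup>2\<close> inner product becomes, up to the factor
  \<open>1 / Hermite_norm \<gamma> \<beta>\<close>, the weighted inner product below, whose weights vanish unless \<open>J\<close> is contained in the support of \<open>\<gamma>\<close>, that is, unless there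
  is an \<open>\<alpha>\<close>.\<close>

definition wedge_sign :: "'n::linorder \<Rightarrow> 'n set \<Rightarrow> complex" where
  "wedge_sign j K = (-1) ^ card {i\<in>K. i < j}"

definition koszul_d :: "('n::{finite,linorder} set \<Rightarrow> complex) \<Rightarrow> 'n set \<Rightarrow> complex" where
  "koszul_d U K = (\<Sum>j\<in>K. wedge_sign j K * U (K - {j}))"

definition koszul_adj :: "('n::{finite,linorder} \<Rightarrow> nat) \<Rightarrow> ('n set \<Rightarrow> complex) \<Rightarrow> 'n set \<Rightarrow> complex" where
  "koszul_adj \<gamma> W J = (\<Sum>j\<in>- J. wedge_sign j (insert j J) * of_nat (\<gamma> j) * W (insert j J))"

definition koszul_inner ::
  "nat \<Rightarrow> ('n::finite \<Rightarrow> nat) \<Rightarrow> ('n set \<Rightarrow> complex) \<Rightarrow> ('n set \<Rightarrow> complex) \<Rightarrow> complex" where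
  "koszul_inner q \<gamma> U V = (\<Sum>J | card J = q. of_nat (\<Prod>j\<in>J. \<gamma> j) * (U J * cnj (V J)))"

definition koszul_norm :: "nat \<Rightarrow> ('n::finite \<Rightarrow> nat) \<Rightarrow> ('n set \<Rightarrow> complex) \<Rightarrow> real" where
  "koszul_norm q \<gamma> U = (\<Sum>J | card J = q. real (\<Prod>j\<in>J. \<gamma> j) * (cmod (U J))\<^sup>2)"

lemma koszul_inner_self: "koszul_inner q \<gamma> U U = of_real (koszul_norm q \<gamma> U)"
  unfolding koszul_inner_def koszul_norm_def of_real_sum of_real_mult complex_norm_square of_real_of_nat_eq ..

lemma koszul_norm_nonneg: "0 \<le> koszul_norm q \<gamma> U"
  unfolding koszul_norm_def by (intro sum_nonneg mult_nonneg_nonneg of_nat_0_le_iff zero_le_power2)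

lemma koszul_inner_cnj: "cnj (koszul_inner q \<gamma> U V) = koszul_inner q \<gamma> V U"
  by (simp add: koszul_inner_def mult_ac)

lemma koszul_inner_cong:
  assumes "\<And>J. card J = q \<Longrightarrow> (\<And>j. j \<in> J \<Longrightarrow> \<gamma> j > 0) \<Longrightarrow> U J = U' J"
    and "\<And>J. card J = q \<Longrightarrow> (\<And>j. j \<in> J \<Longrightarrow> \<gamma> j > 0) \<Longrightarrow> V J = V' J"
  shows "koszul_inner q \<gamma> U V = koszul_inner q \<gamma> U' V'"
  unfolding koszul_inner_def
proof (rule sum.cong[OF refl])
  fix J :: "'a set" assume "J \<in> {J. card J = q}"
  then show "of_nat (\<Prod>j\<in>J. \<gamma> j) * (U J * cnj (V J)) = of_nat (\<Prod>j\<in>J. \<gamma> j) * (U' J * cnj (V' J))"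
    using assms[of J] by (cases "\<forall>j\<in>J. \<gamma> j > 0") auto
qed

lemma koszul_norm_cong:
  assumes "\<And>J. card J = q \<Longrightarrow> (\<And>j. j \<in> J \<Longrightarrow> \<gamma> j > 0) \<Longrightarrow> U J = U' J"
  shows "koszul_norm q \<gamma> U = koszul_norm q \<gamma> U'"
proof -
  have "koszul_inner q \<gamma> U U = koszul_inner q \<gamma> U' U'"
    by (rule koszul_inner_cong) (rule assms; assumption)+
  then show ?thesis
    unfolding koszul_inner_self of_real_eq_iff .
qed

lemma koszul_inner_add_left:
  "koszul_inner q \<gamma> (\<lambda>J. U J + U' J) V = koszul_inner q \<gamma> U V + koszul_inner q \<gamma> U' V"
  by (simp add: koszul_inner_def distrib_left distrib_right sum.distrib)

lemma koszul_inner_scale_left: "koszul_inner q \<gamma> (\<lambda>J. c * U J) V = c * koszul_inner q \<gamma> U V"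
  by (simp add: koszul_inner_def sum_distrib_left mult_ac)

lemma wedge_sign_square: "wedge_sign j K * wedge_sign j K = 1"
  by (simp add: wedge_sign_def flip: power_add)

lemma cnj_wedge_sign: "cnj (wedge_sign j K) = wedge_sign j K"
  by (simp add: wedge_sign_def)

lemma wedge_sign_insert:
  fixes J :: "'n::{finite,linorder} set"
  assumes "k \<notin> J"
  shows "wedge_sign j (insert k J) = (if k < j then - wedge_sign j J else wedge_sign j J)"
proof -
  have "{i \<in> insert k J. i < j} = (if k < j then insert k {i\<in>J. i < j} else {i\<in>J. i < j})"
    by auto
  then show ?thesis
    using assms by (simp add: wedge_sign_def)
qed

text \<open>The anticommutation relation of multiplication by and contraction with basis covectors.\<close>

lemma wedge_sign_swap:
  fixes J :: "'n::{finite,linorder} set"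
  assumes "i \<in> J" "j \<notin> J"
  shows "wedge_sign i J * wedge_sign j (insert j (J - {i})) = - (wedge_sign j (insert j J) * wedge_sign i (insert j J))"
proof -
  define A where "A = J - {i}"
  have J: "J = insert i A" "i \<notin> A" "j \<notin> A" "i \<noteq> j"
    using assms by (auto simp: A_def)
  have "wedge_sign j (insert j (insert i A)) = (if i < j then - wedge_sign j A else wedge_sign j A)"
    using J by (subst wedge_sign_insert) (auto simp: wedge_sign_insert)
  moreover have "wedge_sign i (insert j (insert i A)) = (if j < i then - wedge_sign i A else wedge_sign i A)"
    using J by (subst wedge_sign_insert) (auto simp: wedge_sign_insert)
  moreover have "wedge_sign i (insert i A) = wedge_sign i A" "wedge_sign j (insert j A) = wedge_sign j A"
    using J by (auto simp: wedge_sign_insert)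
  ultimately show ?thesis
    using J(4) unfolding A_def[symmetric] unfolding J(1) by (cases "i < j") (auto simp: mult.commute)
qed

lemma koszul_adjoint:
  "koszul_inner (Suc q) \<gamma> (koszul_d U) W = koszul_inner q \<gamma> U (koszul_adj \<gamma> W)"
proof -
  let ?t = "\<lambda>J j. of_nat (\<Prod>i\<in>J. \<gamma> i) * of_nat (\<gamma> j) * wedge_sign j (insert j J) * U J * cnj (W (insert j J))"
  have "koszul_inner (Suc q) \<gamma> (koszul_d U) W = (\<Sum>K | card K = Suc q. \<Sum>j\<in>K. ?t (K - {j}) j)"
    unfolding koszul_inner_def
  proof (rule sum.cong[OF refl])
    fix K :: "'a set"
    have "of_nat (\<Prod>i\<in>K. \<gamma> i) * (wedge_sign j K * U (K - {j}) * cnj (W K)) = ?t (K - {j}) j" if "j \<in> K" for j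
      using that by (simp add: prod.remove[of K j] insert_absorb mult_ac)
    then show "of_nat (\<Prod>i\<in>K. \<gamma> i) * (koszul_d U K * cnj (W K)) = (\<Sum>j\<in>K. ?t (K - {j}) j)"
      unfolding koszul_d_def sum_distrib_left sum_distrib_right by (intro sum.cong) auto
  qed
  also have "\<dots> = (\<Sum>(K, j)\<in>Sigma {K. card K = Suc q} (\<lambda>K. K). ?t (K - {j}) j)"
    by (rule sum.Sigma) auto
  also have "\<dots> = (\<Sum>(J, j)\<in>Sigma {J. card J = q} (\<lambda>J. - J). ?t J j)"
    by (rule sum.reindex_bij_witness[where i = "\<lambda>(J, j). (insert j J, j)" and j = "\<lambda>(K, j). (K - {j}, j)"])
      (auto simp: card_insert_if card_Diff_singleton)
  also have "\<dots> = (\<Sum>J | card J = q. \<Sum>j\<in>- J. ?t J j)"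
    by (rule sum.Sigma[symmetric]) auto
  also have "\<dots> = koszul_inner q \<gamma> U (koszul_adj \<gamma> W)"
    unfolding koszul_inner_def koszul_adj_def
    by (intro sum.cong refl) (simp add: sum_distrib_left cnj_wedge_sign mult_ac)
  finally show ?thesis .
qed

definition multi_degree :: "('n::finite \<Rightarrow> nat) \<Rightarrow> nat" where
  "multi_degree \<gamma> = (\<Sum>j\<in>UNIV. \<gamma> j)"

text \<open>In the sum of the two compositions, the terms that exchange two different indices cancel by
  anticommutation.  The remaining ones are \<open>\<gamma> j U\<close>, for \<open>j \<in> J\<close> in the first composition and for \<open>j \<notin> J\<close> in
  the second.\<close>

lemma koszul_Laplacian:
  "koszul_d (koszul_adj \<gamma> U) J + koszul_adj \<gamma> (koszul_d U) J = of_nat (multi_degree \<gamma>) * U J"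
proof -
  let ?x = "\<lambda>i j. wedge_sign i J * wedge_sign j (insert j (J - {i})) * of_nat (\<gamma> j) * U (insert j (J - {i}))"
  have "koszul_d (koszul_adj \<gamma> U) J = (\<Sum>i\<in>J. of_nat (\<gamma> i) * U J + (\<Sum>j\<in>- J. ?x i j))"
    unfolding koszul_d_def
  proof (rule sum.cong[OF refl])
    fix i assume i: "i \<in> J"
    have "- (J - {i}) = insert i (- J)"
      using i by auto
    then have "koszul_adj \<gamma> U (J - {i}) = wedge_sign i J * of_nat (\<gamma> i) * U J
        + (\<Sum>j\<in>- J. wedge_sign j (insert j (J - {i})) * of_nat (\<gamma> j) * U (insert j (J - {i})))"
      using i by (simp add: koszul_adj_def insert_absorb)
    then have "wedge_sign i J * koszul_adj \<gamma> U (J - {i}) = (wedge_sign i J * wedge_sign i J) * (of_nat (\<gamma> i) * U J)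
        + (\<Sum>j\<in>- J. ?x i j)"
      by (simp add: distrib_left sum_distrib_left mult_ac)
    then show "wedge_sign i J * koszul_adj \<gamma> U (J - {i}) = of_nat (\<gamma> i) * U J + (\<Sum>j\<in>- J. ?x i j)"
      by (simp add: wedge_sign_square)
  qed
  also have "\<dots> = (\<Sum>i\<in>J. of_nat (\<gamma> i) * U J) + (\<Sum>i\<in>J. \<Sum>j\<in>- J. ?x i j)"
    by (rule sum.distrib)
  finally have d: "koszul_d (koszul_adj \<gamma> U) J = (\<Sum>i\<in>J. of_nat (\<gamma> i) * U J) + (\<Sum>i\<in>J. \<Sum>j\<in>- J. ?x i j)" .
  have "koszul_adj \<gamma> (koszul_d U) J = (\<Sum>j\<in>- J. of_nat (\<gamma> j) * U J - (\<Sum>i\<in>J. ?x i j))"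
    unfolding koszul_adj_def
  proof (rule sum.cong[OF refl])
    fix j assume "j \<in> - J"
    then have j: "j \<notin> J" by simp
    let ?s = "wedge_sign j (insert j J)"
    have "koszul_d U (insert j J) = ?s * U J + (\<Sum>i\<in>J. wedge_sign i (insert j J) * U (insert j J - {i}))"
      using j by (simp add: koszul_d_def)
    then have "?s * of_nat (\<gamma> j) * koszul_d U (insert j J) = (?s * ?s) * (of_nat (\<gamma> j) * U J)
        + (\<Sum>i\<in>J. ?s * wedge_sign i (insert j J) * of_nat (\<gamma> j) * U (insert j J - {i}))"
      by (simp add: distrib_left sum_distrib_left mult_ac)
    also have "(\<Sum>i\<in>J. ?s * wedge_sign i (insert j J) * of_nat (\<gamma> j) * U (insert j J - {i})) = (\<Sum>i\<in>J. - ?x i j)"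
    proof (rule sum.cong[OF refl])
      fix i assume i: "i \<in> J"
      have "insert j J - {i} = insert j (J - {i})"
        using i j by auto
      then show "?s * wedge_sign i (insert j J) * of_nat (\<gamma> j) * U (insert j J - {i}) = - ?x i j"
        unfolding wedge_sign_swap[OF i j] by simp
    qed
    finally show "?s * of_nat (\<gamma> j) * koszul_d U (insert j J) = of_nat (\<gamma> j) * U J - (\<Sum>i\<in>J. ?x i j)"
      by (simp add: wedge_sign_square sum_negf)
  qed
  also have "\<dots> = (\<Sum>j\<in>- J. of_nat (\<gamma> j) * U J) - (\<Sum>j\<in>- J. \<Sum>i\<in>J. ?x i j)"
    by (rule sum_subtractf)
  also have "(\<Sum>j\<in>- J. \<Sum>i\<in>J. ?x i j) = (\<Sum>i\<in>J. \<Sum>j\<in>- J. ?x i j)"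
    by (rule sum.swap)
  finally have a: "koszul_adj \<gamma> (koszul_d U) J = (\<Sum>j\<in>- J. of_nat (\<gamma> j) * U J) - (\<Sum>i\<in>J. \<Sum>j\<in>- J. ?x i j)" .
  have "(\<Sum>i\<in>J. of_nat (\<gamma> i) * U J) + (\<Sum>j\<in>- J. of_nat (\<gamma> j) * U J) = (\<Sum>j\<in>J \<union> - J. of_nat (\<gamma> j) * U J)"
    by (rule sum.union_disjoint[symmetric]) auto
  then show ?thesis
    unfolding d a by (simp add: multi_degree_def sum_distrib_right)
qed

text \<open>The inner product of \<open>(d d\<^sup>* + d\<^sup>* d) U\<close> with \<open>U\<close> is \<open>\<parallel>d\<^sup>* U\<parallel>\<^sup>2 + \<parallel>d U\<parallel>\<^sup>2\<close>, which bounds both operators.\<close>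

lemma koszul_norm_adj_le:
  "koszul_norm q \<gamma> (koszul_adj \<gamma> W) \<le> real (multi_degree \<gamma>) * koszul_norm (Suc q) \<gamma> W"
proof -
  have "of_nat (multi_degree \<gamma>) * koszul_inner (Suc q) \<gamma> W W =
      koszul_inner (Suc q) \<gamma> (koszul_d (koszul_adj \<gamma> W)) W + koszul_inner (Suc q) \<gamma> (koszul_adj \<gamma> (koszul_d W)) W"
    unfolding koszul_inner_add_left[symmetric] koszul_inner_scale_left[symmetric] koszul_Laplacian ..
  also have "koszul_inner (Suc q) \<gamma> (koszul_adj \<gamma> (koszul_d W)) W = koszul_inner (Suc (Suc q)) \<gamma> (koszul_d W) (koszul_d W)"
    unfolding koszul_inner_cnj[of "Suc q" \<gamma> W, symmetric] koszul_adjoint[symmetric] koszul_inner_cnj ..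
  finally have "complex_of_real (real (multi_degree \<gamma>) * koszul_norm (Suc q) \<gamma> W) =
      of_real (koszul_norm q \<gamma> (koszul_adj \<gamma> W) + koszul_norm (Suc (Suc q)) \<gamma> (koszul_d W))"
    unfolding koszul_adjoint koszul_inner_self by simp
  then show ?thesis
    unfolding of_real_eq_iff using koszul_norm_nonneg[of "Suc (Suc q)" \<gamma> "koszul_d W"] by simp
qed

lemma koszul_norm_d_le:
  "koszul_norm (Suc q) \<gamma> (koszul_d U) \<le> real (multi_degree \<gamma>) * koszul_norm q \<gamma> U"
proof -
  have "of_nat (multi_degree \<gamma>) * koszul_inner q \<gamma> U U =
      koszul_inner q \<gamma> (koszul_d (koszul_adj \<gamma> U)) U + koszul_inner q \<gamma> (koszul_adj \<gamma> (koszul_d U)) U"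
    unfolding koszul_inner_add_left[symmetric] koszul_inner_scale_left[symmetric] koszul_Laplacian ..
  also have "koszul_inner q \<gamma> (koszul_adj \<gamma> (koszul_d U)) U = koszul_inner (Suc q) \<gamma> (koszul_d U) (koszul_d U)"
    unfolding koszul_inner_cnj[of q \<gamma> U, symmetric] koszul_adjoint[symmetric] koszul_inner_cnj ..
  finally have eq: "of_nat (multi_degree \<gamma>) * koszul_inner q \<gamma> U U =
      koszul_inner q \<gamma> (koszul_d (koszul_adj \<gamma> U)) U + of_real (koszul_norm (Suc q) \<gamma> (koszul_d U))"
    unfolding koszul_inner_self .
  obtain r where r: "koszul_inner q \<gamma> (koszul_d (koszul_adj \<gamma> U)) U = of_real r" "r \<ge> 0"
  proof (cases q)
    case 0
    then have "koszul_inner q \<gamma> (koszul_d (koszul_adj \<gamma> U)) U = of_real 0"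
      by (simp add: koszul_inner_def koszul_d_def)
    then show thesis
      using that by blast
  next
    case (Suc p)
    then show thesis
      by (intro that[of "koszul_norm p \<gamma> (koszul_adj \<gamma> U)"])
        (simp_all add: koszul_adjoint koszul_inner_self koszul_norm_nonneg)
  qed
  have "complex_of_real (real (multi_degree \<gamma>) * koszul_norm q \<gamma> U) =
      of_real (r + koszul_norm (Suc q) \<gamma> (koszul_d U))"
    using eq unfolding r(1) koszul_inner_self by simp
  then show ?thesis
    unfolding of_real_eq_iff using r(2) by simp
qed

lemma koszul_adj_cong:
  assumes "\<And>j. j \<notin> J \<Longrightarrow> \<gamma> j > 0 \<Longrightarrow> W (insert j J) = W' (insert j J)"
  shows "koszul_adj \<gamma> W J = koszul_adj \<gamma> W' J"
  unfolding koszul_adj_def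
proof (rule sum.cong[OF refl])
  fix j assume "j \<in> - J"
  then show "wedge_sign j (insert j J) * of_nat (\<gamma> j) * W (insert j J) =
      wedge_sign j (insert j J) * of_nat (\<gamma> j) * W' (insert j J)"
    using assms[of j] by (cases "\<gamma> j = 0") simp_all
qed

lemma koszul_d_cong:
  "(\<And>j. j \<in> K \<Longrightarrow> U (K - {j}) = U' (K - {j})) \<Longrightarrow> koszul_d U K = koszul_d U' K"
  unfolding koszul_d_def by (intro sum.cong refl) simp

section \<open>Fourier coefficients of forms\<close>

text \<open>In the block of \<open>\<gamma>\<close> and \<open>\<beta>\<close>, the basis form with index \<open>J\<close> has the coefficient function
  \<open>Hermite (lower J \<gamma>) \<beta>\<close>.\<close>

definition lower :: "'n set \<Rightarrow> ('n \<Rightarrow> nat) \<Rightarrow> 'n \<Rightarrow> nat" where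
  "lower J \<gamma> = (\<lambda>k. if k \<in> J then \<gamma> k - 1 else \<gamma> k)"

definition raise :: "'n set \<Rightarrow> ('n \<Rightarrow> nat) \<Rightarrow> 'n \<Rightarrow> nat" where
  "raise J \<alpha> = (\<lambda>k. if k \<in> J then Suc (\<alpha> k) else \<alpha> k)"

lemma lower_raise [simp]: "lower J (raise J \<alpha>) = \<alpha>"
  by (auto simp: lower_def raise_def)

lemma raise_lower: "(\<And>j. j \<in> J \<Longrightarrow> \<gamma> j > 0) \<Longrightarrow> raise J (lower J \<gamma>) = \<gamma>"
  by (auto simp: lower_def raise_def fun_eq_iff)

lemma lower_remove: "j \<in> K \<Longrightarrow> \<gamma> j > 0 \<Longrightarrow> (lower K \<gamma>)(j := Suc (lower K \<gamma> j)) = lower (K - {j}) \<gamma>"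
  by (auto simp: lower_def fun_eq_iff)

lemma lower_insert: "j \<notin> J \<Longrightarrow> (lower J \<gamma>)(j := lower J \<gamma> j - 1) = lower (insert j J) \<gamma>"
  by (auto simp: lower_def fun_eq_iff)

lemma multi_degree_raise: "multi_degree (raise J \<alpha>) = multi_degree \<alpha> + card J"
proof -
  have "multi_degree (raise J \<alpha>) = (\<Sum>k\<in>UNIV. \<alpha> k + (if k \<in> J then 1 else 0))"
    unfolding multi_degree_def raise_def by (intro sum.cong) auto
  also have "\<dots> = multi_degree \<alpha> + card J"
    by (simp add: multi_degree_def sum.distrib sum.If_cases)
  finally show ?thesis .
qed

lemma card_le_multi_degree:
  assumes "\<And>j. j \<in> J \<Longrightarrow> \<gamma> j > 0"
  shows "card J \<le> multi_degree \<gamma>"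
  using multi_degree_raise[of J "lower J \<gamma>"] raise_lower[of J \<gamma>] assms by simp

lemma multi_fact_raise: "multi_fact (raise J \<alpha>) = (\<Prod>j\<in>J. raise J \<alpha> j) * multi_fact \<alpha>"
proof -
  have "multi_fact (raise J \<alpha>) = (\<Prod>k\<in>UNIV. (if k \<in> J then raise J \<alpha> k else 1) * fact (\<alpha> k))"
    unfolding multi_fact_def raise_def by (intro prod.cong) auto
  also have "\<dots> = (\<Prod>j\<in>J. raise J \<alpha> j) * multi_fact \<alpha>"
    by (simp add: multi_fact_def prod.distrib prod.If_cases)
  finally show ?thesis .
qed

lemma Hermite_norm_raise:
  "Hermite_norm (raise J \<alpha>) \<beta> = real (\<Prod>j\<in>J. raise J \<alpha> j) * Hermite_norm \<alpha> \<beta>"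
  by (simp add: Hermite_norm_def multi_fact_raise)

definition coefficient ::
  "'n::finite form \<Rightarrow> ('n \<Rightarrow> nat) \<Rightarrow> ('n \<Rightarrow> nat) \<Rightarrow> 'n set \<Rightarrow> complex" where
  "coefficient u \<gamma> \<beta> J = inner_L2 gauss (u J) (Hermite (lower J \<gamma>) \<beta>)"

lemma L2_forms_L2:
  assumes "u \<in> L2_forms q"
  shows "u J \<in> L2 gauss"
proof -
  have "if card J = q then u J \<in> L2 gauss else u J = (\<lambda>z. 0)"
    using assms unfolding L2_forms_def L2_weighted_eq by blast
  then show ?thesis
    by (cases "card J = q") simp_all
qed

lemma L2_formsI:
  "(\<And>J. card J = q \<Longrightarrow> u J \<in> L2 gauss) \<Longrightarrow> (\<And>J. card J \<noteq> q \<Longrightarrow> u J = (\<lambda>z. 0)) \<Longrightarrow> u \<in> L2_forms q"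
  by (simp add: L2_forms_def L2_weighted_eq)

lemma L2_forms_0: "u \<in> L2_forms q \<Longrightarrow> card J \<noteq> q \<Longrightarrow> u J = (\<lambda>z. 0)"
  by (simp add: L2_forms_def)

lemma form_inner_eq:
  "u \<in> L2_forms q \<Longrightarrow> v \<in> L2_forms q \<Longrightarrow> form_inner q u v = (\<Sum>J | card J = q. inner_L2 gauss (u J) (v J))"
  unfolding form_inner_def by (intro sum.cong refl L2_inner_eq L2_forms_L2)

lemma L2_forms_add:
  assumes "u \<in> L2_forms q" "v \<in> L2_forms q"
  shows "form_add u v \<in> L2_forms q"
  unfolding form_add_def
  by (rule L2_formsI)
    (simp_all add: L2_add[OF L2_forms_L2[OF assms(1)] L2_forms_L2[OF assms(2)]]
      L2_forms_0[OF assms(1)] L2_forms_0[OF assms(2)])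

lemma L2_forms_scale:
  assumes "u \<in> L2_forms q"
  shows "form_scale c u \<in> L2_forms q"
  unfolding form_scale_def
  by (rule L2_formsI) (simp_all add: L2_scale[OF L2_forms_L2[OF assms]] L2_forms_0[OF assms])

lemma coefficient_add:
  "u \<in> L2_forms q \<Longrightarrow> v \<in> L2_forms q \<Longrightarrow>
    coefficient (form_add u v) \<gamma> \<beta> J = coefficient u \<gamma> \<beta> J + coefficient v \<gamma> \<beta> J"
  by (simp add: coefficient_def form_add_def inner_L2_add_left L2_forms_L2 Hermite_L2)

lemma coefficient_scale: "coefficient (form_scale c u) \<gamma> \<beta> J = c * coefficient u \<gamma> \<beta> J"
  by (simp add: coefficient_def form_scale_def inner_L2_scale_left)

lemma bij_betw_lower:
  "bij_betw (\<lambda>(\<gamma>, \<beta>). (lower J \<gamma>, \<beta>)) {(\<gamma>, \<beta>). \<forall>j\<in>J. \<gamma> j > 0} UNIV"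
  by (rule bij_betw_byWitness[where f' = "\<lambda>(\<alpha>, \<beta>). (raise J \<alpha>, \<beta>)"])
    (auto simp: raise_lower, auto simp: raise_def)

lemma divide_Hermite_norm_lower:
  fixes x :: complex
  assumes "\<And>j. j \<in> J \<Longrightarrow> \<gamma> j > 0"
  shows "x / of_real (Hermite_norm (lower J \<gamma>) \<beta>) = of_nat (\<Prod>j\<in>J. \<gamma> j) * x / of_real (Hermite_norm \<gamma> \<beta>)"
proof -
  have "Hermite_norm \<gamma> \<beta> = real (\<Prod>j\<in>J. \<gamma> j) * Hermite_norm (lower J \<gamma>) \<beta>"
    using Hermite_norm_raise[of J "lower J \<gamma>" \<beta>] raise_lower[of J \<gamma>] assms by simp
  moreover have "(\<Prod>j\<in>J. \<gamma> j) \<noteq> 0"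
    using assms by (auto simp: prod_zero_iff dest: less_imp_neq)
  moreover have "x / of_real N = of_nat p * x / of_real (real p * N)" if "p \<noteq> 0" for p and N :: real
    using that by simp
  ultimately show ?thesis
    by (simp only:)
qed

lemma has_sum_finite_sum:
  fixes f :: "'j \<Rightarrow> 'i \<Rightarrow> complex"
  shows "finite A \<Longrightarrow> (\<And>a. a \<in> A \<Longrightarrow> (f a has_sum s a) I) \<Longrightarrow> ((\<lambda>i. \<Sum>a\<in>A. f a i) has_sum (\<Sum>a\<in>A. s a)) I"
  by (induction A rule: finite_induct) (auto intro: has_sum_add)

text \<open>Parseval's identity for each coefficient function is a sum over \<open>\<alpha> = lower J \<gamma>\<close>.  Reindexing it by \<open>\<gamma>\<close>
  replaces the squared norms by those with index \<open>\<gamma>\<close> at the cost of the weights of \<^const>\<open>koszul_inner\<close>, which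
  extend the sum by zero to the \<open>\<gamma>\<close> that do not come from any \<open>\<alpha>\<close>.\<close>

lemma Parseval_forms:
  fixes u v :: "'n::finite form"
  assumes u: "u \<in> L2_forms q" and v: "v \<in> L2_forms q"
  shows "((\<lambda>(\<gamma>, \<beta>). koszul_inner q \<gamma> (coefficient u \<gamma> \<beta>) (coefficient v \<gamma> \<beta>) / of_real (Hermite_norm \<gamma> \<beta>))
    has_sum form_inner q u v) UNIV"
proof -
  define t where "t J = (\<lambda>(\<gamma>, \<beta>). of_nat (\<Prod>j\<in>J. \<gamma> j) * (coefficient u \<gamma> \<beta> J * cnj (coefficient v \<gamma> \<beta> J))
      / of_real (Hermite_norm \<gamma> \<beta>))" for J
  have "(t J has_sum inner_L2 gauss (u J) (v J)) UNIV" for J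
  proof -
    let ?h = "\<lambda>(\<gamma>, \<beta>). (lower J \<gamma>, \<beta>)" and ?P = "{(\<gamma> :: 'n \<Rightarrow> nat, \<beta> :: 'n \<Rightarrow> nat). \<forall>j\<in>J. \<gamma> j > 0}"
    let ?g = "\<lambda>i. inner_L2 gauss (u J) (case i of (\<alpha>, \<beta>) \<Rightarrow> Hermite \<alpha> \<beta>) *
        cnj (inner_L2 gauss (v J) (case i of (\<alpha>, \<beta>) \<Rightarrow> Hermite \<alpha> \<beta>)) /
        of_real (case i of (\<alpha>, \<beta>) \<Rightarrow> Hermite_norm \<alpha> \<beta>)"
    have "(?g has_sum inner_L2 gauss (u J) (v J)) (?h ` ?P)"
      unfolding bij_betw_imp_surj_on[OF bij_betw_lower]
      by (rule hermite.Parseval[OF L2_forms_L2[OF u] L2_forms_L2[OF v]])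
    then have "((?g \<circ> ?h) has_sum inner_L2 gauss (u J) (v J)) ?P"
      by (subst (asm) has_sum_reindex[OF bij_betw_imp_inj_on[OF bij_betw_lower]])
    also have "((?g \<circ> ?h) has_sum inner_L2 gauss (u J) (v J)) ?P \<longleftrightarrow> (t J has_sum inner_L2 gauss (u J) (v J)) UNIV"
    proof (rule has_sum_cong_neutral)
      fix x assume x: "x \<in> UNIV - ?P"
      obtain \<gamma> \<beta> where x_eq: "x = (\<gamma>, \<beta>)"
        by (cases x)
      then obtain j where "j \<in> J" "\<gamma> j = 0"
        using x by auto
      then have "(\<Prod>j\<in>J. \<gamma> j) = 0"
        by (intro prod_zero) auto
      then show "t J x = 0"
        unfolding x_eq t_def by (simp del: of_nat_prod)
    next
      fix x assume "x \<in> ?P \<inter> UNIV"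
      then obtain \<gamma> \<beta> where x: "x = (\<gamma>, \<beta>)" and pos: "\<And>j. j \<in> J \<Longrightarrow> \<gamma> j > 0"
        by (cases x) auto
      show "(?g \<circ> ?h) x = t J x"
        using divide_Hermite_norm_lower[of J \<gamma> _ \<beta>, OF pos]
        by (simp add: x t_def coefficient_def del: of_nat_prod)
    qed auto
    finally show ?thesis .
  qed
  then have "((\<lambda>i. \<Sum>J | card J = q. t J i) has_sum (\<Sum>J | card J = q. inner_L2 gauss (u J) (v J))) UNIV"
    by (intro has_sum_finite_sum) auto
  moreover have "(\<Sum>J | card J = q. t J i) = (case i of (\<gamma>, \<beta>) \<Rightarrow>
      koszul_inner q \<gamma> (coefficient u \<gamma> \<beta>) (coefficient v \<gamma> \<beta>) / of_real (Hermite_norm \<gamma> \<beta>))" for i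
    by (cases i) (simp add: t_def koszul_inner_def sum_divide_distrib del: of_nat_prod)
  ultimately show ?thesis
    by (simp add: form_inner_eq[OF u v])
qed

lemma form_norm_has_sum:
  assumes u: "u \<in> L2_forms q"
  shows "((\<lambda>(\<gamma>, \<beta>). koszul_norm q \<gamma> (coefficient u \<gamma> \<beta>) / Hermite_norm \<gamma> \<beta>) has_sum (form_norm q u)\<^sup>2) UNIV"
proof -
  let ?k = "\<lambda>(\<gamma>, \<beta>). koszul_norm q \<gamma> (coefficient u \<gamma> \<beta>) / Hermite_norm \<gamma> \<beta>"
  have "((\<lambda>i. complex_of_real (?k i)) has_sum form_inner q u u) UNIV"
    using Parseval_forms[OF u u] by (simp add: koszul_inner_self case_prod_unfold)
  then have "((\<lambda>i. Re (complex_of_real (?k i))) has_sum Re (form_inner q u u)) UNIV"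
    using has_sum_Re by blast
  then have s: "(?k has_sum Re (form_inner q u u)) UNIV"
    by simp
  have "0 \<le> Re (form_inner q u u)"
    by (rule has_sum_nonneg[OF s]) (auto simp: koszul_norm_nonneg less_imp_le[OF Hermite_norm_pos])
  then show ?thesis
    using s by (simp add: form_norm_def)
qed

text \<open>The Riesz-Fischer theorem, applied to each coefficient function.  Values of \<open>c\<close> at \<open>\<gamma>\<close> that vanish somewhere
  on \<open>J\<close> do not belong to any basis form, so they cannot be prescribed.\<close>

lemma form_with_coefficients:
  fixes c :: "('n::{finite,linorder} \<Rightarrow> nat) \<Rightarrow> ('n \<Rightarrow> nat) \<Rightarrow> 'n set \<Rightarrow> complex"
  assumes sum: "(\<lambda>(\<gamma>, \<beta>). koszul_norm q \<gamma> (c \<gamma> \<beta>) / Hermite_norm \<gamma> \<beta>) summable_on UNIV"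
  shows "\<exists>u\<in>L2_forms q. \<forall>J \<gamma> \<beta>. card J = q \<longrightarrow> (\<forall>j\<in>J. \<gamma> j > 0) \<longrightarrow> coefficient u \<gamma> \<beta> J = c \<gamma> \<beta> J"
proof -
  have "\<exists>f. f \<in> L2 gauss \<and> (\<forall>\<alpha> \<beta>. inner_L2 gauss f (Hermite \<alpha> \<beta>) = c (raise J \<alpha>) \<beta> J)" if J: "card J = q" for J
  proof -
    let ?h = "\<lambda>(\<gamma>, \<beta>). (lower J \<gamma>, \<beta>)" and ?P = "{(\<gamma> :: 'n \<Rightarrow> nat, \<beta> :: 'n \<Rightarrow> nat). \<forall>j\<in>J. \<gamma> j > 0}"
    let ?c = "\<lambda>(\<alpha>, \<beta>). c (raise J \<alpha>) \<beta> J"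
    let ?N = "\<lambda>(\<alpha>, \<beta>). Hermite_norm \<alpha> \<beta>"
    have "(\<lambda>i. (cmod (?c (?h i)))\<^sup>2 / ?N (?h i)) summable_on ?P"
    proof (rule summable_on_comparison_test)
      show "(\<lambda>(\<gamma>, \<beta>). koszul_norm q \<gamma> (c \<gamma> \<beta>) / Hermite_norm \<gamma> \<beta>) summable_on ?P"
        using sum by (rule summable_on_subset_banach) simp
      fix i assume "i \<in> ?P"
      then obtain \<gamma> \<beta> where i: "i = (\<gamma>, \<beta>)" and pos: "\<And>j. j \<in> J \<Longrightarrow> \<gamma> j > 0"
        by (cases i) auto
      have "complex_of_real ((cmod (c \<gamma> \<beta> J))\<^sup>2 / Hermite_norm (lower J \<gamma>) \<beta>) =
          complex_of_real (real (\<Prod>j\<in>J. \<gamma> j) * (cmod (c \<gamma> \<beta> J))\<^sup>2 / Hermite_norm \<gamma> \<beta>)"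
        using divide_Hermite_norm_lower[of J \<gamma> "of_real ((cmod (c \<gamma> \<beta> J))\<^sup>2)" \<beta>, OF pos]
        by (simp del: of_nat_prod of_real_power)
      then have "(cmod (c \<gamma> \<beta> J))\<^sup>2 / Hermite_norm (lower J \<gamma>) \<beta> =
          real (\<Prod>j\<in>J. \<gamma> j) * (cmod (c \<gamma> \<beta> J))\<^sup>2 / Hermite_norm \<gamma> \<beta>"
        by (simp only: of_real_eq_iff)
      moreover have "real (\<Prod>j\<in>J. \<gamma> j) * (cmod (c \<gamma> \<beta> J))\<^sup>2 \<le> koszul_norm q \<gamma> (c \<gamma> \<beta>)"
        unfolding koszul_norm_def
        by (rule member_le_sum[of J "{J. card J = q}" "\<lambda>J. real (\<Prod>j\<in>J. \<gamma> j) * (cmod (c \<gamma> \<beta> J))\<^sup>2"])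
          (simp_all add: J prod_nonneg)
      ultimately have le: "(cmod (c \<gamma> \<beta> J))\<^sup>2 / Hermite_norm (lower J \<gamma>) \<beta> \<le> koszul_norm q \<gamma> (c \<gamma> \<beta>) / Hermite_norm \<gamma> \<beta>"
        by (simp only: divide_right_mono less_imp_le[OF Hermite_norm_pos])
      have rl: "raise J (lower J \<gamma>) = \<gamma>"
        by (rule raise_lower[OF pos])
      show "(cmod (?c (?h i)))\<^sup>2 / ?N (?h i)
          \<le> (case i of (\<gamma>, \<beta>) \<Rightarrow> koszul_norm q \<gamma> (c \<gamma> \<beta>) / Hermite_norm \<gamma> \<beta>)"
        unfolding i prod.case rl by (rule le)
      show "0 \<le> (cmod (?c (?h i)))\<^sup>2 / ?N (?h i)"
        unfolding i prod.case by (intro divide_nonneg_pos zero_le_power2 Hermite_norm_pos)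
    qed
    then have "(\<lambda>i. (cmod (?c i))\<^sup>2 / ?N i) summable_on UNIV"
      by (subst (asm) summable_on_reindex_bij_betw[OF bij_betw_lower])
    then obtain f where f: "f \<in> L2 gauss" and fc: "\<And>i. inner_L2 gauss f (case i of (\<alpha>, \<beta>) \<Rightarrow> Hermite \<alpha> \<beta>) = ?c i"
      by (rule hermite.Riesz_Fischer) (rule that)
    have "inner_L2 gauss f (Hermite \<alpha> \<beta>) = c (raise J \<alpha>) \<beta> J" for \<alpha> \<beta>
      using fc[of "(\<alpha>, \<beta>)"] by simp
    with f show ?thesis
      by (intro exI[of _ f]) simp
  qed
  then have "\<forall>J. \<exists>f. card J = q \<longrightarrow> f \<in> L2 gauss \<and> (\<forall>\<alpha> \<beta>. inner_L2 gauss f (Hermite \<alpha> \<beta>) = c (raise J \<alpha>) \<beta> J)"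
    by simp
  from choice[OF this] obtain f where
    f: "\<forall>J. card J = q \<longrightarrow> f J \<in> L2 gauss \<and>
      (\<forall>\<alpha> \<beta>. inner_L2 gauss (f J) (Hermite \<alpha> \<beta>) = c (raise J \<alpha>) \<beta> J)" ..
  define u where "u J = (if card J = q then f J else (\<lambda>z. 0))" for J
  have "u \<in> L2_forms q"
    by (rule L2_formsI) (auto simp: u_def f)
  moreover have "coefficient u \<gamma> \<beta> J = c \<gamma> \<beta> J" if "card J = q" "\<And>j. j \<in> J \<Longrightarrow> \<gamma> j > 0" for J \<gamma> \<beta>
    using that by (simp add: coefficient_def u_def f raise_lower)
  ultimately show ?thesis
    by (intro bexI[of _ u]) simp_all
qed

section \<open>The operators in terms of Fourier coefficients\<close>

lemma form_inner_adjoint: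
  fixes u v w t :: "'n::{finite,linorder} form"
  assumes u: "u \<in> L2_forms q" and v: "v \<in> L2_forms (Suc q)"
    and w: "w \<in> L2_forms (Suc q)" and t: "t \<in> L2_forms q"
    and vu: "\<And>K \<gamma> \<beta>. card K = Suc q \<Longrightarrow> (\<And>j. j \<in> K \<Longrightarrow> \<gamma> j > 0) \<Longrightarrow>
      coefficient v \<gamma> \<beta> K = koszul_d (coefficient u \<gamma> \<beta>) K"
    and tw: "\<And>J \<gamma> \<beta>. card J = q \<Longrightarrow> (\<And>j. j \<in> J \<Longrightarrow> \<gamma> j > 0) \<Longrightarrow>
      coefficient t \<gamma> \<beta> J = koszul_adj \<gamma> (coefficient w \<gamma> \<beta>) J"
  shows "form_inner (Suc q) v w = form_inner q u t"
proof -
  have "koszul_inner (Suc q) \<gamma> (coefficient v \<gamma> \<beta>) (coefficient w \<gamma> \<beta>) =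
      koszul_inner q \<gamma> (coefficient u \<gamma> \<beta>) (coefficient t \<gamma> \<beta>)" for \<gamma> \<beta>
  proof -
    have "koszul_inner (Suc q) \<gamma> (coefficient v \<gamma> \<beta>) (coefficient w \<gamma> \<beta>) =
        koszul_inner (Suc q) \<gamma> (koszul_d (coefficient u \<gamma> \<beta>)) (coefficient w \<gamma> \<beta>)"
      by (rule koszul_inner_cong) (simp_all add: vu)
    also have "\<dots> = koszul_inner q \<gamma> (coefficient u \<gamma> \<beta>) (koszul_adj \<gamma> (coefficient w \<gamma> \<beta>))"
      by (rule koszul_adjoint)
    also have "\<dots> = koszul_inner q \<gamma> (coefficient u \<gamma> \<beta>) (coefficient t \<gamma> \<beta>)"
      by (rule koszul_inner_cong) (simp_all add: tw)
    finally show ?thesis .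
  qed
  then have "((\<lambda>(\<gamma>, \<beta>). koszul_inner q \<gamma> (coefficient u \<gamma> \<beta>) (coefficient t \<gamma> \<beta>) / of_real (Hermite_norm \<gamma> \<beta>))
      has_sum form_inner (Suc q) v w) UNIV"
    using Parseval_forms[OF v w] by (simp only:)
  then show ?thesis
    using Parseval_forms[OF u t] by (rule has_sum_unique)
qed

lemma dbar_L2_forms: "(u, v) \<in> dbar q \<Longrightarrow> u \<in> L2_forms q" "(u, v) \<in> dbar q \<Longrightarrow> v \<in> L2_forms (Suc q)"
  by (simp_all add: dbar_def)

lemma dbar_adj_L2_forms:
  "(w, t) \<in> dbar_adj q \<Longrightarrow> w \<in> L2_forms (Suc q)" "(w, t) \<in> dbar_adj q \<Longrightarrow> t \<in> L2_forms q"
  by (simp_all add: dbar_adj_def)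

text \<open>Raising \<open>\<alpha> = lower K \<gamma>\<close> at \<open>j \<in> K\<close> gives \<open>lower (K - {j}) \<gamma>\<close>: the adjoint of the weak derivative stays in the
  block of \<open>\<gamma>\<close>.\<close>

lemma dbar_coefficient:
  fixes u v :: "'n::{finite,linorder} form"
  assumes uv: "(u, v) \<in> dbar q" and K: "card K = Suc q" "\<And>j. j \<in> K \<Longrightarrow> \<gamma> j > 0"
  shows "coefficient v \<gamma> \<beta> K = koszul_d (coefficient u \<gamma> \<beta>) K"
proof -
  have "coefficient v \<gamma> \<beta> K = (\<Sum>j\<in>K. wedge_sign j K *
      inner_L2 gauss (u (K - {j})) (Hermite ((lower K \<gamma>)(j := Suc (lower K \<gamma> j))) \<beta>))"
    unfolding coefficient_def
  proof (rule weak_derivative_inner_Hermite)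
    show "u (K - {j}) \<in> L2 gauss" for j
      by (rule L2_forms_L2[OF dbar_L2_forms(1)[OF uv]])
    show "v K \<in> L2 gauss"
      by (rule L2_forms_L2[OF dbar_L2_forms(2)[OF uv]])
    fix \<eta> :: "(complex, 'n) vec \<Rightarrow> complex" assume "test_function \<eta>"
    then show "(\<Sum>j\<in>K. wedge_sign j K * (- (LINT z|lborel. u (K - {j}) z * d_zbar j \<eta> z))) = (LINT z|lborel. v K z * \<eta> z)"
      using uv K(1) unfolding dbar_def dbar_distribution_def wedge_sign_def by blast
  qed
  also have "\<dots> = koszul_d (coefficient u \<gamma> \<beta>) K"
    unfolding koszul_d_def coefficient_def by (intro sum.cong refl) (simp add: lower_remove K(2))
  finally show ?thesis .
qed

text \<open>The converse of the last lemma is obtained by expanding test functions \<open>\<eta>\<close> in Hermite polynomials, after turning integration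
  against \<open>\<eta>\<close> into an inner product of \<open>L\<^sup>2\<close> with the following function.\<close>

definition dual_function :: "(complex ^ 'n::finite \<Rightarrow> complex) \<Rightarrow> complex ^ 'n \<Rightarrow> complex" where
  "dual_function \<eta> z = cnj (\<eta> z * of_real (exp (weight z)))"

lemma smooth_exp_weight: "smooth (\<lambda>z. complex_of_real (exp (weight z)))"
proof -
  have "smooth (\<lambda>z. exp (\<Sum>k\<in>UNIV. z $ k * cnj (z $ k)))"
    by (intro smooth_exp smooth_weight_complex)
  then show ?thesis
    unfolding weight_eq_complex[symmetric] exp_of_real .
qed

lemma dual_function_L2:
  assumes "test_function \<eta>"
  shows "dual_function \<eta> \<in> L2 gauss"
proof -
  have t: "test_function (\<lambda>z. \<eta> z * of_real (exp (weight z)))"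
    by (rule test_function_mult_smooth[OF assms smooth_exp_weight])
  obtain B where B: "\<And>z. cmod (\<eta> z * of_real (exp (weight z))) \<le> B"
    by (rule test_function_bounded[OF t]) (rule that)
  have "poly_bounded (\<lambda>z. \<eta> z * of_real (exp (weight z)))"
    by (rule poly_boundedI[where C = B and m = 0]) (simp only: power_0 mult_1_right B)
  then have "(\<lambda>z. \<eta> z * of_real (exp (weight z))) \<in> L2 gauss"
    by (intro poly_bounded_L2 smooth_measurable test_function_smooth t)
  then show ?thesis
    unfolding dual_function_def[abs_def] by (rule L2_cnj)
qed

lemma inner_dual_function:
  assumes "f \<in> L2 gauss" "test_function \<eta>"
  shows "inner_L2 gauss f (dual_function \<eta>) = (LINT z|lborel. f z * \<eta> z)"
proof -
  have "(\<lambda>z. f z * cnj (dual_function \<eta> z)) \<in> borel_measurable borel"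
    by (intro borel_measurable_mult_cnj L2_gauss_measurable assms dual_function_L2)
  then have "inner_L2 gauss f (dual_function \<eta>) =
      (LINT z|lborel. f z * cnj (dual_function \<eta> z) * of_real (exp (- weight z)))"
    unfolding inner_L2_def by (rule integral_gauss)
  also have "\<dots> = (LINT z|lborel. f z * \<eta> z)"
    by (intro Bochner_Integration.integral_cong refl)
      (simp add: dual_function_def mult.assoc flip: of_real_mult exp_add)
  finally show ?thesis .
qed

lemma inner_dual_function_d_zbar:
  assumes "test_function \<eta>"
  shows "inner_L2 gauss (dual_function (d_zbar j \<eta>)) (Hermite \<alpha> \<beta>) =
    - of_nat (\<alpha> j) * inner_L2 gauss (dual_function \<eta>) (Hermite (\<alpha>(j := \<alpha> j - 1)) \<beta>)"
proof -
  have "inner_L2 gauss (Hermite \<alpha> \<beta>) (dual_function (d_zbar j \<eta>)) = (LINT z|lborel. Hermite \<alpha> \<beta> z * d_zbar j \<eta> z)"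
    by (intro inner_dual_function Hermite_L2 test_function_d_zbar assms)
  also have "\<dots> = - (LINT z|lborel. \<eta> z * d_zbar j (Hermite \<alpha> \<beta>) z)"
    by (intro integration_by_parts_d_zbar assms smooth_Hermite)
  also have "\<dots> = - (LINT z|lborel. of_nat (\<alpha> j) * (Hermite (\<alpha>(j := \<alpha> j - 1)) \<beta> z * \<eta> z))"
    unfolding d_zbar_Hermite by (simp only: mult_ac)
  also have "\<dots> = - of_nat (\<alpha> j) * inner_L2 gauss (Hermite (\<alpha>(j := \<alpha> j - 1)) \<beta>) (dual_function \<eta>)"
    unfolding inner_dual_function[OF Hermite_L2 assms] by (simp only: integral_mult_right_zero mult_minus_left)
  finally have "cnj (inner_L2 gauss (Hermite \<alpha> \<beta>) (dual_function (d_zbar j \<eta>))) =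
      cnj (- of_nat (\<alpha> j) * inner_L2 gauss (Hermite (\<alpha>(j := \<alpha> j - 1)) \<beta>) (dual_function \<eta>))"
    by (simp only:)
  then show ?thesis
    by (simp add: inner_L2_cnj)
qed

lemma sum_cofaces:
  fixes f :: "'n::finite set \<Rightarrow> 'n \<Rightarrow> complex"
  assumes "card J = q"
  shows "(\<Sum>K | card K = Suc q. \<Sum>j\<in>K. if K - {j} = J then f K j else 0) = (\<Sum>j\<in>- J. f (insert j J) j)"
proof -
  have "(\<Sum>K | card K = Suc q. \<Sum>j\<in>K. if K - {j} = J then f K j else 0) =
      (\<Sum>p\<in>Sigma {K. card K = Suc q} (\<lambda>K. K). if fst p - {snd p} = J then f (fst p) (snd p) else 0)"
    by (subst sum.Sigma) (auto simp: case_prod_unfold)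
  also have "\<dots> = (\<Sum>p\<in>{p \<in> Sigma {K. card K = Suc q} (\<lambda>K. K). fst p - {snd p} = J}. f (fst p) (snd p))"
    by (rule sum.inter_filter[symmetric]) simp
  also have "\<dots> = (\<Sum>j\<in>- J. f (insert j J) j)"
  proof (rule sum.reindex_bij_witness[where i = "\<lambda>j. (insert j J, j)" and j = snd])
    fix p assume "p \<in> {p \<in> Sigma {K. card K = Suc q} (\<lambda>K. K). fst p - {snd p} = J}"
    then have p: "insert (snd p) J = fst p" "snd p \<notin> J"
      by auto
    show "(insert (snd p) J, snd p) = p" "f (insert (snd p) J) (snd p) = f (fst p) (snd p)"
      unfolding p(1) by simp_all
    show "snd p \<in> - J"
      using p(2) by simp
  next
    fix j assume j: "j \<in> - J"
    then have "insert j J - {j} = J" "card (insert j J) = Suc q"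
      using assms by auto
    then show "(insert j J, j) \<in> {p \<in> Sigma {K. card K = Suc q} (\<lambda>K. K). fst p - {snd p} = J}"
      by simp
  qed simp
  finally show ?thesis .
qed

lemma dbarI:
  fixes u v :: "'n::{finite,linorder} form"
  assumes u: "u \<in> L2_forms q" and v: "v \<in> L2_forms (Suc q)"
    and vu: "\<And>K \<gamma> \<beta>. card K = Suc q \<Longrightarrow> (\<And>j. j \<in> K \<Longrightarrow> \<gamma> j > 0) \<Longrightarrow>
      coefficient v \<gamma> \<beta> K = koszul_d (coefficient u \<gamma> \<beta>) K"
  shows "(u, v) \<in> dbar q"
proof -
  have "dbar_distribution u K \<eta> = (LINT z|lborel. v K z * \<eta> z)"
    if K: "card K = Suc q" and \<eta>: "test_function \<eta>" for K and \<eta> :: "(complex, 'n) vec \<Rightarrow> complex"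
  proof -
    \<comment> \<open>\<open>t\<close> is the formal adjoint of \<open>dbar\<close> applied to the form \<open>w\<close>.\<close>
    define w where "w = (\<lambda>L. if L = K then dual_function \<eta> else (\<lambda>z. 0))"
    define d where "d j = (\<lambda>z. - wedge_sign j K * dual_function (d_zbar j \<eta>) z)" for j
    define t where "t = (\<lambda>J z. \<Sum>j\<in>K. if J = K - {j} then d j z else 0)"
    have d_L2: "d j \<in> L2 gauss" for j
      unfolding d_def by (intro L2_scale dual_function_L2 test_function_d_zbar \<eta>)
    have w: "w \<in> L2_forms (Suc q)"
      by (rule L2_formsI) (auto simp: w_def K dual_function_L2[OF \<eta>])
    have if_L2: "(\<lambda>z. if J = K - {j} then d j z else 0) \<in> L2 gauss" for J j
      using d_L2[of j] by (cases "J = K - {j}") simp_all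
    have t: "t \<in> L2_forms q"
    proof (rule L2_formsI)
      show "t J \<in> L2 gauss" for J
        unfolding t_def by (intro L2_sum if_L2) simp
      show "t J = (\<lambda>z. 0)" if "card J \<noteq> q" for J
      proof -
        have "J \<noteq> K - {j}" if "j \<in> K" for j
          using K that \<open>card J \<noteq> q\<close> by (auto simp: card_Diff_singleton)
        then show ?thesis
          by (auto simp: t_def fun_eq_iff intro!: sum.neutral)
      qed
    qed
    have inner_t: "inner_L2 gauss (t J) f = (\<Sum>j\<in>K. if J = K - {j} then inner_L2 gauss (d j) f else 0)"
      if "f \<in> L2 gauss" for J f
      unfolding t_def using that by (subst inner_L2_sum_left) (auto simp: if_L2 intro!: sum.cong)
    have "form_inner (Suc q) v w = form_inner q u t"
    proof (rule form_inner_adjoint[OF u v w t vu])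
      fix J :: "'n set" and \<gamma> \<beta>
      assume J: "card J = q"
      show "coefficient t \<gamma> \<beta> J = koszul_adj \<gamma> (coefficient w \<gamma> \<beta>) J"
      proof (cases "\<exists>i\<in>K. J = K - {i}")
        case True
        then obtain i where i: "i \<in> K" "J = K - {i}"
          by blast
        then have K_eq: "insert i J = K" "i \<notin> J"
          by auto
        have same: "J = K - {j} \<longleftrightarrow> j = i" if "j \<in> K" for j
          using i that by auto
        have "coefficient t \<gamma> \<beta> J = (\<Sum>j\<in>K. if j = i then inner_L2 gauss (d j) (Hermite (lower J \<gamma>) \<beta>) else 0)"
          unfolding coefficient_def inner_t[OF Hermite_L2] by (intro sum.cong refl) (simp add: same)
        also have "\<dots> = inner_L2 gauss (d i) (Hermite (lower J \<gamma>) \<beta>)"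
          using i(1) by (simp add: sum.delta)
        also have "\<dots> = wedge_sign i K * of_nat (lower J \<gamma> i) *
            inner_L2 gauss (dual_function \<eta>) (Hermite ((lower J \<gamma>)(i := lower J \<gamma> i - 1)) \<beta>)"
          unfolding d_def inner_L2_scale_left inner_dual_function_d_zbar[OF \<eta>] by simp
        also have "(lower J \<gamma>)(i := lower J \<gamma> i - 1) = lower K \<gamma>"
          unfolding lower_insert[OF K_eq(2)] K_eq(1) ..
        also have "lower J \<gamma> i = \<gamma> i"
          using K_eq(2) by (simp add: lower_def)
        finally have c: "coefficient t \<gamma> \<beta> J = wedge_sign i K * of_nat (\<gamma> i) *
            inner_L2 gauss (dual_function \<eta>) (Hermite (lower K \<gamma>) \<beta>)" .
        have same': "insert j J = K \<longleftrightarrow> j = i" if "j \<in> - J" for j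
          using K_eq that by auto
        have "koszul_adj \<gamma> (coefficient w \<gamma> \<beta>) J = (\<Sum>j\<in>- J. if j = i then
            wedge_sign i K * of_nat (\<gamma> i) * inner_L2 gauss (dual_function \<eta>) (Hermite (lower K \<gamma>) \<beta>) else 0)"
          unfolding koszul_adj_def coefficient_def w_def
        proof (rule sum.cong[OF refl])
          fix j assume "j \<in> - J"
          then show "wedge_sign j (insert j J) * of_nat (\<gamma> j) * inner_L2 gauss
              (if insert j J = K then dual_function \<eta> else (\<lambda>z. 0)) (Hermite (lower (insert j J) \<gamma>) \<beta>) =
              (if j = i then wedge_sign i K * of_nat (\<gamma> i) *
                inner_L2 gauss (dual_function \<eta>) (Hermite (lower K \<gamma>) \<beta>) else 0)"
            using same'[of j] K_eq(1) by (cases "j = i") simp_all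
        qed
        also have "\<dots> = coefficient t \<gamma> \<beta> J"
          unfolding c using K_eq(2) by (simp add: sum.delta)
        finally show ?thesis ..
      next
        case False
        then have "coefficient t \<gamma> \<beta> J = 0"
          unfolding coefficient_def inner_t[OF Hermite_L2] by (intro sum.neutral) auto
        moreover have "koszul_adj \<gamma> (coefficient w \<gamma> \<beta>) J = 0"
          unfolding koszul_adj_def
        proof (rule sum.neutral, rule ballI)
          fix j assume "j \<in> - J"
          then have "insert j J \<noteq> K"
            using False by auto
          then show "wedge_sign j (insert j J) * of_nat (\<gamma> j) * coefficient w \<gamma> \<beta> (insert j J) = 0"
            by (simp add: coefficient_def w_def)
        qed
        ultimately show ?thesis
          by simp
      qed
    qed
    moreover have "form_inner (Suc q) v w = (LINT z|lborel. v K z * \<eta> z)"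
    proof -
      have "form_inner (Suc q) v w = (\<Sum>L | card L = Suc q. if L = K then inner_L2 gauss (v K) (dual_function \<eta>) else 0)"
        unfolding form_inner_eq[OF v w] by (intro sum.cong refl) (simp add: w_def)
      also have "\<dots> = inner_L2 gauss (v K) (dual_function \<eta>)"
        using K by (simp add: sum.delta)
      finally show ?thesis
        unfolding inner_dual_function[OF L2_forms_L2[OF v] \<eta>] .
    qed
    moreover have "form_inner q u t = dbar_distribution u K \<eta>"
    proof -
      have swap: "inner_L2 gauss (u J) (t J) = (\<Sum>j\<in>K. if J = K - {j} then inner_L2 gauss (u J) (d j) else 0)" for J
      proof -
        have "cnj (inner_L2 gauss (t J) (u J)) = (\<Sum>j\<in>K. if J = K - {j} then cnj (inner_L2 gauss (d j) (u J)) else 0)"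
          unfolding inner_t[OF L2_forms_L2[OF u]] cnj_sum by (intro sum.cong refl) simp
        then show ?thesis
          unfolding inner_L2_cnj .
      qed
      have "form_inner q u t = (\<Sum>J | card J = q. \<Sum>j\<in>K. if J = K - {j} then inner_L2 gauss (u J) (d j) else 0)"
        unfolding form_inner_eq[OF u t] swap ..
      also have "\<dots> = (\<Sum>j\<in>K. \<Sum>J | card J = q. if J = K - {j} then inner_L2 gauss (u J) (d j) else 0)"
        by (rule sum.swap)
      also have "\<dots> = (\<Sum>j\<in>K. wedge_sign j K * (- (LINT z|lborel. u (K - {j}) z * d_zbar j \<eta> z)))"
      proof (rule sum.cong[OF refl])
        fix j assume j: "j \<in> K"
        have "(\<Sum>J | card J = q. if J = K - {j} then inner_L2 gauss (u J) (d j) else 0) = inner_L2 gauss (u (K - {j})) (d j)"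
          using K j by (simp add: sum.delta card_Diff_singleton)
        also have "\<dots> = - wedge_sign j K * inner_L2 gauss (u (K - {j})) (dual_function (d_zbar j \<eta>))"
          unfolding d_def inner_L2_scale_right by (simp add: cnj_wedge_sign)
        finally show "(\<Sum>J | card J = q. if J = K - {j} then inner_L2 gauss (u J) (d j) else 0) =
            wedge_sign j K * (- (LINT z|lborel. u (K - {j}) z * d_zbar j \<eta> z))"
          unfolding inner_dual_function[OF L2_forms_L2[OF u] test_function_d_zbar[OF \<eta>]] by simp
      qed
      finally show ?thesis
        by (simp add: dbar_distribution_def wedge_sign_def)
    qed
    ultimately show ?thesis
      by simp
  qed
  then show ?thesis
    using u v by (simp add: dbar_def)
qed

definition basis_form :: "'n set \<Rightarrow> ('n \<Rightarrow> nat) \<Rightarrow> ('n \<Rightarrow> nat) \<Rightarrow> 'n::finite form" where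
  "basis_form J \<alpha> \<beta> = (\<lambda>L. if L = J then Hermite \<alpha> \<beta> else (\<lambda>z. 0))"

lemma basis_form_L2: "basis_form J \<alpha> \<beta> \<in> L2_forms (card J)"
  by (rule L2_formsI) (auto simp: basis_form_def Hermite_L2)

lemma form_inner_basis_form:
  assumes "u \<in> L2_forms (card J)"
  shows "form_inner (card J) (basis_form J \<alpha> \<beta>) u = inner_L2 gauss (Hermite \<alpha> \<beta>) (u J)"
proof -
  have "form_inner (card J) (basis_form J \<alpha> \<beta>) u =
      (\<Sum>L | card L = card J. if L = J then inner_L2 gauss (Hermite \<alpha> \<beta>) (u J) else 0)"
    unfolding form_inner_eq[OF basis_form_L2 assms] by (intro sum.cong refl) (simp add: basis_form_def)
  then show ?thesis
    by (simp add: sum.delta)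
qed

lemma dbar_basis_form:
  fixes J :: "'n::{finite,linorder} set" and \<gamma> \<beta> :: "'n \<Rightarrow> nat"
  defines "a \<equiv> \<lambda>K z. \<Sum>j\<in>K. if K - {j} = J then wedge_sign j K * of_nat (\<gamma> j) * Hermite (lower K \<gamma>) \<beta> z else 0"
  shows "(basis_form J (lower J \<gamma>) \<beta>, a) \<in> dbar (card J)"
proof (rule dbarI[OF basis_form_L2])
  let ?b = "\<lambda>K j z. if K - {j} = J then wedge_sign j K * of_nat (\<gamma> j) * Hermite (lower K \<gamma>) \<beta> z else 0"
  have b_L2: "?b K j \<in> L2 gauss" for K j
    by (cases "K - {j} = J") (simp_all add: L2_scale Hermite_L2)
  show "a \<in> L2_forms (Suc (card J))"
  proof (rule L2_formsI)
    show "a K \<in> L2 gauss" for K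
      unfolding a_def by (intro L2_sum b_L2) simp
    show "a K = (\<lambda>z. 0)" if "card K \<noteq> Suc (card J)" for K
    proof -
      have "K - {j} \<noteq> J" if "j \<in> K" for j
        using that \<open>card K \<noteq> Suc (card J)\<close> card_Suc_Diff1[of K j] by auto
      then show ?thesis
        by (auto simp: a_def fun_eq_iff intro!: sum.neutral)
    qed
  qed
  fix K :: "'n set" and \<gamma>' \<beta>' :: "'n \<Rightarrow> nat"
  assume pos: "\<And>j. j \<in> K \<Longrightarrow> \<gamma>' j > 0"
  have "coefficient a \<gamma>' \<beta>' K = (\<Sum>j\<in>K. inner_L2 gauss (?b K j) (Hermite (lower K \<gamma>') \<beta>'))"
    unfolding coefficient_def a_def by (rule inner_L2_sum_left) (simp_all only: b_L2 Hermite_L2 finite_code)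
  also have "\<dots> = koszul_d (coefficient (basis_form J (lower J \<gamma>) \<beta>) \<gamma>' \<beta>') K"
    unfolding koszul_d_def
  proof (rule sum.cong[OF refl])
    fix j assume j: "j \<in> K"
    show "inner_L2 gauss (?b K j) (Hermite (lower K \<gamma>') \<beta>') =
        wedge_sign j K * coefficient (basis_form J (lower J \<gamma>) \<beta>) \<gamma>' \<beta>' (K - {j})"
    proof (cases "K - {j} = J")
      case True
      then have K: "insert j J = K" "j \<notin> J"
        using j by auto
      have l: "lower J \<gamma> j = \<gamma> j"
        using K(2) by (simp add: lower_def)
      have "(lower J \<gamma>)(j := \<gamma> j - 1) = lower K \<gamma>"
        by (rule lower_insert[OF K(2), of \<gamma>, unfolded l K(1)])
      moreover have "(lower K \<gamma>')(j := Suc (lower K \<gamma>' j)) = lower J \<gamma>'"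
        using lower_remove[of j K \<gamma>'] j pos[OF j] True by simp
      ultimately have "of_nat (\<gamma> j) * inner_L2 gauss (Hermite (lower K \<gamma>) \<beta>) (Hermite (lower K \<gamma>') \<beta>') =
          inner_L2 gauss (Hermite (lower J \<gamma>) \<beta>) (Hermite (lower J \<gamma>') \<beta>')"
        using Hermite_lower_raise[of "lower J \<gamma>" j \<beta> "lower K \<gamma>'" \<beta>'] l by simp
      then show ?thesis
        using True by (simp add: inner_L2_scale_left coefficient_def basis_form_def mult.assoc)
    next
      case False
      then show ?thesis
        by (simp add: coefficient_def basis_form_def)
    qed
  qed
  finally show "coefficient a \<gamma>' \<beta>' K = koszul_d (coefficient (basis_form J (lower J \<gamma>) \<beta>) \<gamma>' \<beta>') K" .
qed

text \<open>The definition of the adjoint is tested on the basis forms; the inner product with \<open>dbar\<close> of a basis form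
  with index \<open>J\<close> is a sum over the index sets \<open>insert j J\<close>.\<close>

lemma dbar_adj_coefficient:
  assumes wt: "(w, t) \<in> dbar_adj q" and J: "card J = q"
  shows "coefficient t \<gamma> \<beta> J = koszul_adj \<gamma> (coefficient w \<gamma> \<beta>) J"
proof -
  let ?e = "basis_form J (lower J \<gamma>) \<beta>"
  let ?b = "\<lambda>K j z. if K - {j} = J then wedge_sign j K * of_nat (\<gamma> j) * Hermite (lower K \<gamma>) \<beta> z else 0"
  let ?a = "\<lambda>K z. \<Sum>j\<in>K. ?b K j z"
  have w: "w \<in> L2_forms (Suc q)" and t: "t \<in> L2_forms q"
    using dbar_adj_L2_forms[OF wt] .
  have ea: "(?e, ?a) \<in> dbar q"
    using dbar_basis_form[of J \<gamma> \<beta>] J by simp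
  then have "form_inner (Suc q) ?a w = form_inner q ?e t"
    using wt unfolding dbar_adj_def by blast
  also have "\<dots> = inner_L2 gauss (Hermite (lower J \<gamma>) \<beta>) (t J)"
    using form_inner_basis_form[of t J] t J by simp
  finally have 1: "form_inner (Suc q) ?a w = inner_L2 gauss (Hermite (lower J \<gamma>) \<beta>) (t J)" .
  let ?f = "\<lambda>K j. wedge_sign j K * of_nat (\<gamma> j) * inner_L2 gauss (Hermite (lower K \<gamma>) \<beta>) (w K)"
  have "inner_L2 gauss (?a K) (w K) = (\<Sum>j\<in>K. if K - {j} = J then ?f K j else 0)" for K
  proof -
    have b: "?b K j \<in> L2 gauss" for j
      by (cases "K - {j} = J") (simp_all add: L2_scale Hermite_L2)
    have "inner_L2 gauss (?a K) (w K) = (\<Sum>j\<in>K. inner_L2 gauss (?b K j) (w K))"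
      by (rule inner_L2_sum_left) (simp_all only: b L2_forms_L2[OF w] finite_code)
    also have "\<dots> = (\<Sum>j\<in>K. if K - {j} = J then ?f K j else 0)"
      by (intro sum.cong refl) (simp add: inner_L2_scale_left)
    finally show ?thesis .
  qed
  then have "form_inner (Suc q) ?a w = (\<Sum>K | card K = Suc q. \<Sum>j\<in>K. if K - {j} = J then ?f K j else 0)"
    unfolding form_inner_eq[OF dbar_L2_forms(2)[OF ea] w] by (simp only:)
  also have "\<dots> = (\<Sum>j\<in>- J. ?f (insert j J) j)"
    by (rule sum_cofaces[OF J])
  finally have "inner_L2 gauss (Hermite (lower J \<gamma>) \<beta>) (t J) = (\<Sum>j\<in>- J. ?f (insert j J) j)"
    unfolding 1 .
  then have "cnj (inner_L2 gauss (Hermite (lower J \<gamma>) \<beta>) (t J)) = (\<Sum>j\<in>- J. cnj (?f (insert j J) j))"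
    by (simp only: cnj_sum)
  then show ?thesis
    unfolding koszul_adj_def coefficient_def complex_cnj_mult inner_L2_cnj cnj_wedge_sign complex_cnj_of_nat .
qed

lemma dbar_adjI:
  fixes w t :: "'n::{finite,linorder} form"
  assumes w: "w \<in> L2_forms (Suc q)" and t: "t \<in> L2_forms q"
    and tw: "\<And>J \<gamma> \<beta>. card J = q \<Longrightarrow> (\<And>j. j \<in> J \<Longrightarrow> \<gamma> j > 0) \<Longrightarrow>
      coefficient t \<gamma> \<beta> J = koszul_adj \<gamma> (coefficient w \<gamma> \<beta>) J"
  shows "(w, t) \<in> dbar_adj q"
proof -
  have "form_inner (Suc q) a w = form_inner q u t" if ua: "(u, a) \<in> dbar q" for u a
    by (rule form_inner_adjoint[OF dbar_L2_forms[OF ua] w t dbar_coefficient[OF ua] tw])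
  then show ?thesis
    using w t by (auto simp: dbar_adj_def)
qed

section \<open>The Laplacian in terms of Fourier coefficients\<close>

lemma adj_dbar_coefficient:
  assumes ua: "(u, a) \<in> dbar q" and av: "(a, v) \<in> dbar_adj q"
    and J: "card J = q" "\<And>j. j \<in> J \<Longrightarrow> \<gamma> j > 0"
  shows "coefficient v \<gamma> \<beta> J = koszul_adj \<gamma> (koszul_d (coefficient u \<gamma> \<beta>)) J"
proof -
  have "koszul_adj \<gamma> (coefficient a \<gamma> \<beta>) J = koszul_adj \<gamma> (koszul_d (coefficient u \<gamma> \<beta>)) J"
  proof (rule koszul_adj_cong)
    fix j assume "j \<notin> J" "\<gamma> j > 0"
    then show "coefficient a \<gamma> \<beta> (insert j J) = koszul_d (coefficient u \<gamma> \<beta>) (insert j J)"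
      using J by (intro dbar_coefficient[OF ua]) auto
  qed
  then show ?thesis
    using dbar_adj_coefficient[OF av J(1)] by simp
qed

lemma dbar_adj_dbar_coefficient:
  assumes ub: "(u, b) \<in> dbar_adj p" and bv: "(b, v) \<in> dbar p"
    and J: "card J = Suc p" "\<And>j. j \<in> J \<Longrightarrow> \<gamma> j > 0"
  shows "coefficient v \<gamma> \<beta> J = koszul_d (koszul_adj \<gamma> (coefficient u \<gamma> \<beta>)) J"
proof -
  have "koszul_d (coefficient b \<gamma> \<beta>) J = koszul_d (koszul_adj \<gamma> (coefficient u \<gamma> \<beta>)) J"
  proof (rule koszul_d_cong)
    fix j assume "j \<in> J"
    then show "coefficient b \<gamma> \<beta> (J - {j}) = koszul_adj \<gamma> (coefficient u \<gamma> \<beta>) (J - {j})"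
      using J(1) by (intro dbar_adj_coefficient[OF ub]) (simp add: card_Diff_singleton)
  qed
  then show ?thesis
    using dbar_coefficient[OF bv J] by simp
qed

lemma Laplacian_coefficient:
  assumes "(u, v) \<in> dbar_Laplacian q"
  shows "u \<in> L2_forms q" "v \<in> L2_forms q"
    and "\<And>J \<gamma> \<beta>. card J = q \<Longrightarrow> (\<And>j. j \<in> J \<Longrightarrow> \<gamma> j > 0) \<Longrightarrow>
      coefficient v \<gamma> \<beta> J = of_nat (multi_degree \<gamma>) * coefficient u \<gamma> \<beta> J"
proof -
  have "u \<in> L2_forms q \<and> v \<in> L2_forms q \<and> (\<forall>J \<gamma> \<beta>. card J = q \<longrightarrow> (\<forall>j\<in>J. \<gamma> j > 0) \<longrightarrow>
      coefficient v \<gamma> \<beta> J = of_nat (multi_degree \<gamma>) * coefficient u \<gamma> \<beta> J)"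
  proof (cases q)
    case 0
    then obtain a where ua: "(u, a) \<in> dbar 0" and av: "(a, v) \<in> dbar_adj 0"
      using assms by auto
    have "coefficient v \<gamma> \<beta> J = of_nat (multi_degree \<gamma>) * coefficient u \<gamma> \<beta> J"
      if J: "card J = q" "\<forall>j\<in>J. \<gamma> j > 0" for J \<gamma> \<beta>
    proof -
      have "J = {}"
        using J 0 by simp
      then have "koszul_d (koszul_adj \<gamma> (coefficient u \<gamma> \<beta>)) J = 0"
        by (simp add: koszul_d_def)
      then show ?thesis
        using koszul_Laplacian[of \<gamma> "coefficient u \<gamma> \<beta>" J] adj_dbar_coefficient[OF ua av, of J \<gamma> \<beta>] J 0 by simp
    qed
    then show ?thesis
      using dbar_L2_forms(1)[OF ua] dbar_adj_L2_forms(2)[OF av] 0 by simp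
  next
    case (Suc p)
    then obtain a b v1 v2 where ua: "(u, a) \<in> dbar q" and av: "(a, v1) \<in> dbar_adj q"
      and ub: "(u, b) \<in> dbar_adj p" and bv: "(b, v2) \<in> dbar p" and v: "v = form_add v1 v2"
      using assms by (auto simp: op_sum_def)
    have v12: "v1 \<in> L2_forms q" "v2 \<in> L2_forms q"
      using dbar_adj_L2_forms(2)[OF av] dbar_L2_forms(2)[OF bv] Suc by simp_all
    have "coefficient v \<gamma> \<beta> J = of_nat (multi_degree \<gamma>) * coefficient u \<gamma> \<beta> J"
      if J: "card J = q" "\<forall>j\<in>J. \<gamma> j > 0" for J \<gamma> \<beta>
      using koszul_Laplacian[of \<gamma> "coefficient u \<gamma> \<beta>" J] adj_dbar_coefficient[OF ua av, of J \<gamma> \<beta>]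
        dbar_adj_dbar_coefficient[OF ub bv, of J \<gamma> \<beta>] J Suc coefficient_add[OF v12, of \<gamma> \<beta> J]
      by (simp add: v add.commute)
    then show ?thesis
      using dbar_L2_forms(1)[OF ua] L2_forms_add[OF v12] v by simp
  qed
  then show "u \<in> L2_forms q" "v \<in> L2_forms q"
    and "\<And>J \<gamma> \<beta>. card J = q \<Longrightarrow> (\<And>j. j \<in> J \<Longrightarrow> \<gamma> j > 0) \<Longrightarrow>
      coefficient v \<gamma> \<beta> J = of_nat (multi_degree \<gamma>) * coefficient u \<gamma> \<beta> J"
    by simp_all
qed

text \<open>Conversely, the coefficients determine the Laplacian completely.  The intermediate forms \<open>dbar u\<close> and
  \<open>dbar\<^sup>* u\<close>, and the two summands of \<open>v\<close>, are constructed from their coefficients.  These are square summable,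
  because on the block of \<open>\<gamma>\<close> both Koszul operators have norm at most the square root of \<open>\<bar>\<gamma>\<bar>\<close>, and \<open>U\<close> and \<open>\<bar>\<gamma>\<bar> U\<close>
  are the coefficients of \<open>u\<close> and \<open>v\<close>.\<close>

lemma dbar_LaplacianI:
  fixes u v :: "'n::{finite,linorder} form"
  assumes u: "u \<in> L2_forms q" and v: "v \<in> L2_forms q"
    and vu: "\<And>J \<gamma> \<beta>. card J = q \<Longrightarrow> (\<And>j. j \<in> J \<Longrightarrow> \<gamma> j > 0) \<Longrightarrow>
      coefficient v \<gamma> \<beta> J = of_nat (multi_degree \<gamma>) * coefficient u \<gamma> \<beta> J"
  shows "(u, v) \<in> dbar_Laplacian q"
proof -
  let ?U = "\<lambda>\<gamma> \<beta>. coefficient u \<gamma> \<beta>"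
  let ?n = "\<lambda>(\<gamma>, \<beta>). koszul_norm q \<gamma> (?U \<gamma> \<beta>) / Hermite_norm \<gamma> \<beta>"
  let ?deg = "\<lambda>\<gamma>::'n \<Rightarrow> nat. real (multi_degree \<gamma>)"
  have sum0: "?n summable_on UNIV"
    using form_norm_has_sum[OF u] by (rule has_sum_imp_summable)
  have "koszul_norm q \<gamma> (coefficient v \<gamma> \<beta>) = (?deg \<gamma>)\<^sup>2 * koszul_norm q \<gamma> (?U \<gamma> \<beta>)" for \<gamma> \<beta>
  proof -
    have "koszul_norm q \<gamma> (coefficient v \<gamma> \<beta>) = koszul_norm q \<gamma> (\<lambda>J. of_nat (multi_degree \<gamma>) * ?U \<gamma> \<beta> J)"
      by (rule koszul_norm_cong) (rule vu)
    then show ?thesis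
      by (simp add: koszul_norm_def norm_mult power_mult_distrib sum_distrib_left mult_ac)
  qed
  then have sum2: "(\<lambda>(\<gamma>, \<beta>). (?deg \<gamma>)\<^sup>2 * koszul_norm q \<gamma> (?U \<gamma> \<beta>) / Hermite_norm \<gamma> \<beta>) summable_on UNIV"
    using has_sum_imp_summable[OF form_norm_has_sum[OF v]] by simp
  have bounded_summable: "(\<lambda>(\<gamma>, \<beta>). koszul_norm r \<gamma> (C \<gamma> \<beta>) / Hermite_norm \<gamma> \<beta>) summable_on UNIV"
    if C: "\<And>\<gamma> \<beta>. koszul_norm r \<gamma> (C \<gamma> \<beta>) \<le> (1 + (?deg \<gamma>)\<^sup>2) * koszul_norm q \<gamma> (?U \<gamma> \<beta>)" for r C
  proof (rule summable_on_comparison_test)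
    show "(\<lambda>i. ?n i + (case i of (\<gamma>, \<beta>) \<Rightarrow> (?deg \<gamma>)\<^sup>2 * koszul_norm q \<gamma> (?U \<gamma> \<beta>) / Hermite_norm \<gamma> \<beta>)) summable_on UNIV"
      by (rule summable_on_add[OF sum0 sum2])
    fix i :: "('n \<Rightarrow> nat) \<times> ('n \<Rightarrow> nat)"
    obtain \<gamma> \<beta> where i: "i = (\<gamma>, \<beta>)"
      by (cases i)
    show "(case i of (\<gamma>, \<beta>) \<Rightarrow> koszul_norm r \<gamma> (C \<gamma> \<beta>) / Hermite_norm \<gamma> \<beta>) \<le>
        ?n i + (case i of (\<gamma>, \<beta>) \<Rightarrow> (?deg \<gamma>)\<^sup>2 * koszul_norm q \<gamma> (?U \<gamma> \<beta>) / Hermite_norm \<gamma> \<beta>)"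
      unfolding i prod.case add_divide_distrib[symmetric]
      using C[of \<gamma> \<beta>] by (intro divide_right_mono less_imp_le[OF Hermite_norm_pos]) (simp add: distrib_right)
    show "0 \<le> (case i of (\<gamma>, \<beta>) \<Rightarrow> koszul_norm r \<gamma> (C \<gamma> \<beta>) / Hermite_norm \<gamma> \<beta>)"
      unfolding i prod.case by (intro divide_nonneg_pos koszul_norm_nonneg Hermite_norm_pos)
  qed
  have deg_le: "?deg \<gamma> * x \<le> (1 + (?deg \<gamma>)\<^sup>2) * x" if "x \<ge> 0" for \<gamma> and x :: real
  proof (rule mult_right_mono[OF _ that])
    show "?deg \<gamma> \<le> 1 + (?deg \<gamma>)\<^sup>2"
      using sum_squares_bound[of 1 "?deg \<gamma>"] by simp
  qed
  have dU: "koszul_norm (Suc q) \<gamma> (koszul_d (?U \<gamma> \<beta>)) \<le> (1 + (?deg \<gamma>)\<^sup>2) * koszul_norm q \<gamma> (?U \<gamma> \<beta>)" for \<gamma> \<beta>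
    using koszul_norm_d_le deg_le[OF koszul_norm_nonneg] by (rule order_trans)
  obtain a where a: "a \<in> L2_forms (Suc q)" and a_all: "\<forall>K \<gamma> \<beta>. card K = Suc q \<longrightarrow>
      (\<forall>j\<in>K. \<gamma> j > 0) \<longrightarrow> coefficient a \<gamma> \<beta> K = koszul_d (?U \<gamma> \<beta>) K"
    using form_with_coefficients[OF bounded_summable[OF dU]] by blast
  have a_coeff: "coefficient a \<gamma> \<beta> K = koszul_d (?U \<gamma> \<beta>) K"
    if "card K = Suc q" "\<And>j. j \<in> K \<Longrightarrow> \<gamma> j > 0" for K \<gamma> \<beta>
    using a_all that by simp
  have ua: "(u, a) \<in> dbar q"
    by (rule dbarI[OF u a a_coeff])
  have adU: "koszul_norm q \<gamma> (koszul_adj \<gamma> (koszul_d (?U \<gamma> \<beta>))) \<le> (1 + (?deg \<gamma>)\<^sup>2) * koszul_norm q \<gamma> (?U \<gamma> \<beta>)" for \<gamma> \<beta>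
  proof -
    have "koszul_norm q \<gamma> (koszul_adj \<gamma> (koszul_d (?U \<gamma> \<beta>))) \<le> ?deg \<gamma> * koszul_norm (Suc q) \<gamma> (koszul_d (?U \<gamma> \<beta>))"
      by (rule koszul_norm_adj_le)
    also have "\<dots> \<le> ?deg \<gamma> * (?deg \<gamma> * koszul_norm q \<gamma> (?U \<gamma> \<beta>))"
      by (intro mult_left_mono koszul_norm_d_le) simp
    also have "\<dots> \<le> (1 + (?deg \<gamma>)\<^sup>2) * koszul_norm q \<gamma> (?U \<gamma> \<beta>)"
      using koszul_norm_nonneg[of q \<gamma> "?U \<gamma> \<beta>"] by (simp add: power2_eq_square distrib_right)
    finally show ?thesis .
  qed
  obtain v1 where v1: "v1 \<in> L2_forms q" and v1_all: "\<forall>J \<gamma> \<beta>. card J = q \<longrightarrow>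
      (\<forall>j\<in>J. \<gamma> j > 0) \<longrightarrow> coefficient v1 \<gamma> \<beta> J = koszul_adj \<gamma> (koszul_d (?U \<gamma> \<beta>)) J"
    using form_with_coefficients[OF bounded_summable[OF adU]] by blast
  have v1_coeff: "coefficient v1 \<gamma> \<beta> J = koszul_adj \<gamma> (koszul_d (?U \<gamma> \<beta>)) J"
    if "card J = q" "\<And>j. j \<in> J \<Longrightarrow> \<gamma> j > 0" for J \<gamma> \<beta>
    using v1_all that by simp
  have a_adj: "koszul_adj \<gamma> (coefficient a \<gamma> \<beta>) J = koszul_adj \<gamma> (koszul_d (?U \<gamma> \<beta>)) J"
    if "card J = q" "\<And>j. j \<in> J \<Longrightarrow> \<gamma> j > 0" for J \<gamma> \<beta>
  proof (rule koszul_adj_cong)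
    fix j assume "j \<notin> J" "\<gamma> j > 0"
    then show "coefficient a \<gamma> \<beta> (insert j J) = koszul_d (?U \<gamma> \<beta>) (insert j J)"
      using that by (intro a_coeff) auto
  qed
  show ?thesis
  proof (cases q)
    case 0
    have "(a, v) \<in> dbar_adj q"
    proof (rule dbar_adjI[OF a v])
      fix J :: "'n set" and \<gamma> \<beta> :: "'n \<Rightarrow> nat"
      assume J: "card J = q" "\<And>j. j \<in> J \<Longrightarrow> \<gamma> j > 0"
      have "J = {}"
        using J 0 by simp
      then have "koszul_d (koszul_adj \<gamma> (?U \<gamma> \<beta>)) J = 0"
        by (simp add: koszul_d_def)
      then show "coefficient v \<gamma> \<beta> J = koszul_adj \<gamma> (coefficient a \<gamma> \<beta>) J"
        using koszul_Laplacian[of \<gamma> "?U \<gamma> \<beta>" J] vu[of J \<gamma> \<beta>, OF J] a_adj[of J \<gamma> \<beta>, OF J] by simp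
    qed
    then show ?thesis
      using ua 0 by auto
  next
    case (Suc p)
    have aU: "koszul_norm p \<gamma> (koszul_adj \<gamma> (?U \<gamma> \<beta>)) \<le> (1 + (?deg \<gamma>)\<^sup>2) * koszul_norm q \<gamma> (?U \<gamma> \<beta>)" for \<gamma> \<beta>
      using koszul_norm_adj_le deg_le[OF koszul_norm_nonneg] unfolding Suc by (rule order_trans)
    obtain b where b: "b \<in> L2_forms p" and b_all: "\<forall>J \<gamma> \<beta>. card J = p \<longrightarrow>
        (\<forall>j\<in>J. \<gamma> j > 0) \<longrightarrow> coefficient b \<gamma> \<beta> J = koszul_adj \<gamma> (?U \<gamma> \<beta>) J"
      using form_with_coefficients[OF bounded_summable[OF aU]] by blast
    have b_coeff: "coefficient b \<gamma> \<beta> J = koszul_adj \<gamma> (?U \<gamma> \<beta>) J"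
      if "card J = p" "\<And>j. j \<in> J \<Longrightarrow> \<gamma> j > 0" for J \<gamma> \<beta>
      using b_all that by simp
    have ub: "(u, b) \<in> dbar_adj p"
      by (rule dbar_adjI[OF u[unfolded Suc] b b_coeff])
    define v2 where "v2 = form_add v (form_scale (-1) v1)"
    have v2: "v2 \<in> L2_forms q"
      unfolding v2_def by (intro L2_forms_add L2_forms_scale v v1)
    have "(b, v2) \<in> dbar p"
    proof (rule dbarI[OF b v2[unfolded Suc]])
      fix K :: "'n set" and \<gamma> \<beta> :: "'n \<Rightarrow> nat"
      assume K: "card K = Suc p" "\<And>j. j \<in> K \<Longrightarrow> \<gamma> j > 0"
      have "koszul_d (coefficient b \<gamma> \<beta>) K = koszul_d (koszul_adj \<gamma> (?U \<gamma> \<beta>)) K"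
      proof (rule koszul_d_cong)
        fix j assume "j \<in> K"
        then show "coefficient b \<gamma> \<beta> (K - {j}) = koszul_adj \<gamma> (?U \<gamma> \<beta>) (K - {j})"
          using K by (intro b_coeff) (auto simp: card_Diff_singleton)
      qed
      moreover have "coefficient v2 \<gamma> \<beta> K = coefficient v \<gamma> \<beta> K - coefficient v1 \<gamma> \<beta> K"
        unfolding v2_def coefficient_add[OF v L2_forms_scale[OF v1]] coefficient_scale by simp
      moreover have "coefficient v \<gamma> \<beta> K = of_nat (multi_degree \<gamma>) * ?U \<gamma> \<beta> K"
        using K Suc by (intro vu) auto
      moreover have "coefficient v1 \<gamma> \<beta> K = koszul_adj \<gamma> (koszul_d (?U \<gamma> \<beta>)) K"
        using K Suc by (intro v1_coeff) auto
      ultimately show "coefficient v2 \<gamma> \<beta> K = koszul_d (coefficient b \<gamma> \<beta>) K"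
        by (simp only: koszul_Laplacian[of \<gamma> "?U \<gamma> \<beta>" K, symmetric] add_diff_cancel_right')
    qed
    moreover have "(a, v1) \<in> dbar_adj q"
      by (rule dbar_adjI[OF a v1]) (simp add: v1_coeff a_adj)
    moreover have "v = form_add v1 v2"
      by (simp add: v2_def form_add_def form_scale_def)
    ultimately show ?thesis
      using ua ub unfolding Suc by (auto simp: op_sum_def)
  qed
qed

section \<open>The spectrum\<close>

lemma integer_distance_pos:
  assumes "\<mu> \<notin> {of_nat k | k. q \<le> k}"
  obtains d where "d > 0" "\<And>k. q \<le> k \<Longrightarrow> d \<le> cmod (of_nat k - \<mu>)"
proof -
  define m where "m = nat \<lceil>cmod \<mu> + 1\<rceil>"
  have far: "1 \<le> cmod (of_nat k - \<mu>)" if "k \<ge> m" for k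
  proof -
    have "real k \<ge> cmod \<mu> + 1"
      using that unfolding m_def by linarith
    then show ?thesis
      using norm_triangle_ineq2[of "of_nat k" \<mu>] by simp
  qed
  define D where "D = insert 1 ((\<lambda>k. cmod (of_nat k - \<mu>)) ` {q..m})"
  have D: "finite D" "D \<noteq> {}"
    by (auto simp: D_def)
  show thesis
  proof (rule that)
    have "x > 0" if "x \<in> D" for x
      using that assms by (auto simp: D_def)
    then show "Min D > 0"
      using D by simp
    fix k assume "q \<le> k"
    show "Min D \<le> cmod (of_nat k - \<mu>)"
    proof (cases "k \<le> m")
      case True
      then show ?thesis
        using \<open>q \<le> k\<close> D by (intro Min_le) (auto simp: D_def)
    next
      case False
      then have "1 \<le> cmod (of_nat k - \<mu>)"
        by (intro far) simp
      moreover have "Min D \<le> 1"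
        using D by (intro Min_le) (auto simp: D_def)
      ultimately show ?thesis
        by simp
    qed
  qed
qed

text \<open>The resolvent divides the coefficients by \<open>\<bar>\<gamma>\<bar> - \<mu>\<close>.  On the blocks that occur in degree \<open>q\<close>, some \<open>J\<close> with
  \<open>q\<close> elements lies in the support of \<open>\<gamma>\<close>, hence \<open>\<bar>\<gamma>\<bar> \<ge> q\<close>.\<close>

lemma resolvent_set_contains:
  fixes q :: nat
  assumes "\<mu> \<notin> {of_nat k | k. q \<le> k}"
  shows "\<mu> \<in> resolvent_set q (dbar_Laplacian q :: 'n::{finite,linorder} form rel)"
proof -
  obtain d where d: "d > 0" "\<And>k. q \<le> k \<Longrightarrow> d \<le> cmod (of_nat k - \<mu>)"
    using integer_distance_pos[OF assms] by blast
  have degree: "d \<le> cmod (of_nat (multi_degree \<gamma>) - \<mu>)"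
    if "card J = q" "\<And>j. j \<in> J \<Longrightarrow> \<gamma> j > 0" for J and \<gamma> :: "'n \<Rightarrow> nat"
    using card_le_multi_degree[of J \<gamma>] that by (intro d(2)) auto
  \<comment> \<open>On each block that occurs, \<open>d\<close> bounds the distance of \<open>\<mu>\<close> from the eigenvalue.\<close>
  have norm_le: "koszul_norm q \<gamma> U \<le> koszul_norm q \<gamma> V / d\<^sup>2"
    if UV: "\<And>J. card J = q \<Longrightarrow> (\<And>j. j \<in> J \<Longrightarrow> \<gamma> j > 0) \<Longrightarrow> V J = (of_nat (multi_degree \<gamma>) - \<mu>) * U J"
    for U V and \<gamma> :: "'n \<Rightarrow> nat"
    unfolding koszul_norm_def sum_divide_distrib
  proof (rule sum_mono)
    fix J :: "'n set" assume "J \<in> {J. card J = q}"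
    then have J: "card J = q" by simp
    show "real (\<Prod>j\<in>J. \<gamma> j) * (cmod (U J))\<^sup>2 \<le> real (\<Prod>j\<in>J. \<gamma> j) * (cmod (V J))\<^sup>2 / d\<^sup>2"
    proof (cases "\<forall>j\<in>J. \<gamma> j > 0")
      case True
      then have "d * cmod (U J) \<le> cmod (V J)"
        using UV[of J] degree[of J \<gamma>] J by (simp add: norm_mult mult_right_mono)
      then have "(d * cmod (U J))\<^sup>2 \<le> (cmod (V J))\<^sup>2"
        using d(1) by (intro power_mono) auto
      then have "(cmod (U J))\<^sup>2 \<le> (cmod (V J))\<^sup>2 / d\<^sup>2"
        using d(1) by (simp add: power_mult_distrib pos_le_divide_eq mult.commute)
      then show ?thesis
        unfolding times_divide_eq_right[symmetric] by (rule mult_left_mono[OF _ of_nat_0_le_iff])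
    next
      case False
      then have "(\<Prod>j\<in>J. \<gamma> j) = 0"
        by (intro prod_zero) auto
      then show ?thesis
        by (simp only: of_nat_0 mult_zero_left div_0)
    qed
  qed
  have solvable: "\<exists>(u, v)\<in>dbar_Laplacian q. form_eq (form_add v (form_scale (- \<mu>) u)) f"
    if f: "f \<in> L2_forms q" for f :: "'n form"
  proof -
    define c where "c \<gamma> \<beta> J = coefficient f \<gamma> \<beta> J / (of_nat (multi_degree \<gamma>) - \<mu>)" for \<gamma> \<beta> and J :: "'n set"
    have c: "coefficient f \<gamma> \<beta> J = (of_nat (multi_degree \<gamma>) - \<mu>) * c \<gamma> \<beta> J"
      if "card J = q" "\<And>j. j \<in> J \<Longrightarrow> \<gamma> j > 0" for J \<gamma> \<beta>
    proof -
      have "of_nat (multi_degree \<gamma>) - \<mu> \<noteq> 0"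
        using degree[of J \<gamma>] that d(1) by auto
      then show ?thesis
        by (simp add: c_def)
    qed
    have c_summable: "(\<lambda>(\<gamma>, \<beta>). koszul_norm q \<gamma> (c \<gamma> \<beta>) / Hermite_norm \<gamma> \<beta>) summable_on UNIV"
    proof (rule summable_on_comparison_test)
      show "(\<lambda>i. (case i of (\<gamma>, \<beta>) \<Rightarrow> koszul_norm q \<gamma> (coefficient f \<gamma> \<beta>) / Hermite_norm \<gamma> \<beta>) * (1 / d\<^sup>2)) summable_on UNIV"
        by (intro summable_on_cmult_left has_sum_imp_summable[OF form_norm_has_sum[OF f]])
      fix i :: "('n \<Rightarrow> nat) \<times> ('n \<Rightarrow> nat)"
      obtain \<gamma> \<beta> where i: "i = (\<gamma>, \<beta>)"
        by (cases i)
      have "koszul_norm q \<gamma> (c \<gamma> \<beta>) / Hermite_norm \<gamma> \<beta> \<le> koszul_norm q \<gamma> (coefficient f \<gamma> \<beta>) / d\<^sup>2 / Hermite_norm \<gamma> \<beta>"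
        by (intro divide_right_mono norm_le c less_imp_le[OF Hermite_norm_pos])
      then show "(case i of (\<gamma>, \<beta>) \<Rightarrow> koszul_norm q \<gamma> (c \<gamma> \<beta>) / Hermite_norm \<gamma> \<beta>) \<le>
          (case i of (\<gamma>, \<beta>) \<Rightarrow> koszul_norm q \<gamma> (coefficient f \<gamma> \<beta>) / Hermite_norm \<gamma> \<beta>) * (1 / d\<^sup>2)"
        by (simp add: i mult.commute)
      show "0 \<le> (case i of (\<gamma>, \<beta>) \<Rightarrow> koszul_norm q \<gamma> (c \<gamma> \<beta>) / Hermite_norm \<gamma> \<beta>)"
        unfolding i prod.case by (intro divide_nonneg_pos koszul_norm_nonneg Hermite_norm_pos)
    qed
    obtain u where u: "u \<in> L2_forms q" and u_all: "\<forall>J \<gamma> \<beta>. card J = q \<longrightarrow>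
        (\<forall>j\<in>J. \<gamma> j > 0) \<longrightarrow> coefficient u \<gamma> \<beta> J = c \<gamma> \<beta> J"
      using form_with_coefficients[OF c_summable] by blast
    have u_coeff: "coefficient u \<gamma> \<beta> J = c \<gamma> \<beta> J"
      if "card J = q" "\<And>j. j \<in> J \<Longrightarrow> \<gamma> j > 0" for J \<gamma> \<beta>
      using u_all that by simp
    define v where "v = form_add f (form_scale \<mu> u)"
    have "(u, v) \<in> dbar_Laplacian q"
    proof (rule dbar_LaplacianI[OF u])
      show "v \<in> L2_forms q"
        unfolding v_def by (intro L2_forms_add L2_forms_scale f u)
      fix J :: "'n set" and \<gamma> \<beta> :: "'n \<Rightarrow> nat"
      assume J: "card J = q" "\<And>j. j \<in> J \<Longrightarrow> \<gamma> j > 0"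
      have "coefficient v \<gamma> \<beta> J = coefficient f \<gamma> \<beta> J + \<mu> * coefficient u \<gamma> \<beta> J"
        unfolding v_def coefficient_add[OF f L2_forms_scale[OF u]] coefficient_scale ..
      also have "\<dots> = of_nat (multi_degree \<gamma>) * coefficient u \<gamma> \<beta> J"
        using u_coeff[of J \<gamma> \<beta>] c[of J \<gamma> \<beta>] J by (simp add: algebra_simps)
      finally show "coefficient v \<gamma> \<beta> J = of_nat (multi_degree \<gamma>) * coefficient u \<gamma> \<beta> J" .
    qed
    moreover have "form_eq (form_add v (form_scale (- \<mu>) u)) f"
      by (simp add: form_eq_def v_def form_add_def form_scale_def)
    ultimately show ?thesis
      by blast
  qed
  have estimate: "form_norm q u \<le> (1 / d) * form_norm q (form_add v (form_scale (- \<mu>) u))"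
    if uv: "(u, v) \<in> dbar_Laplacian q" for u v :: "'n form"
  proof -
    let ?g = "form_add v (form_scale (- \<mu>) u)"
    note u = Laplacian_coefficient(1)[OF uv] and v = Laplacian_coefficient(2)[OF uv]
    have g: "?g \<in> L2_forms q"
      by (intro L2_forms_add L2_forms_scale u v)
    have g_coeff: "coefficient ?g \<gamma> \<beta> J = (of_nat (multi_degree \<gamma>) - \<mu>) * coefficient u \<gamma> \<beta> J"
      if "card J = q" "\<And>j. j \<in> J \<Longrightarrow> \<gamma> j > 0" for J \<gamma> \<beta>
      unfolding coefficient_add[OF v L2_forms_scale[OF u]] coefficient_scale
      using Laplacian_coefficient(3)[OF uv, of J \<gamma> \<beta>] that by (simp add: algebra_simps)
    have "(form_norm q u)\<^sup>2 \<le> (form_norm q ?g)\<^sup>2 * (1 / d\<^sup>2)"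
    proof (rule has_sum_mono[OF form_norm_has_sum[OF u] has_sum_cmult_left[OF form_norm_has_sum[OF g]]])
      fix i :: "('n \<Rightarrow> nat) \<times> ('n \<Rightarrow> nat)"
      obtain \<gamma> \<beta> where i: "i = (\<gamma>, \<beta>)"
        by (cases i)
      have "koszul_norm q \<gamma> (coefficient u \<gamma> \<beta>) / Hermite_norm \<gamma> \<beta> \<le>
          koszul_norm q \<gamma> (coefficient ?g \<gamma> \<beta>) / d\<^sup>2 / Hermite_norm \<gamma> \<beta>"
        by (intro divide_right_mono norm_le g_coeff less_imp_le[OF Hermite_norm_pos])
      then show "(case i of (\<gamma>, \<beta>) \<Rightarrow> koszul_norm q \<gamma> (coefficient u \<gamma> \<beta>) / Hermite_norm \<gamma> \<beta>) \<le>
          (case i of (\<gamma>, \<beta>) \<Rightarrow> koszul_norm q \<gamma> (coefficient ?g \<gamma> \<beta>) / Hermite_norm \<gamma> \<beta>) * (1 / d\<^sup>2)"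
        by (simp add: i mult.commute)
    qed
    also have "\<dots> = ((1 / d) * form_norm q ?g)\<^sup>2"
      by (simp add: power_mult_distrib power_divide)
    finally show ?thesis
    proof (rule power2_le_imp_le)
      have "0 \<le> Re (form_inner q ?g ?g)"
        unfolding form_inner_eq[OF g g] Re_sum inner_L2_self
        by (intro sum_nonneg) (simp add: integral_nonneg_AE)
      then show "0 \<le> (1 / d) * form_norm q ?g"
        using d(1) by (simp add: form_norm_def)
    qed
  qed
  show ?thesis
    unfolding resolvent_set_def using solvable estimate by blast
qed

lemma basis_form_eigenform:
  fixes J :: "'n::{finite,linorder} set" and \<alpha> \<beta> :: "'n \<Rightarrow> nat"
  defines "k \<equiv> multi_degree \<alpha> + card J"
  shows "(basis_form J \<alpha> \<beta>, form_scale (of_nat k) (basis_form J \<alpha> \<beta>)) \<in> dbar_Laplacian (card J)"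
proof (rule dbar_LaplacianI[OF basis_form_L2 L2_forms_scale[OF basis_form_L2]])
  fix L :: "'n set" and \<gamma> \<beta>' :: "'n \<Rightarrow> nat"
  assume L: "card L = card J" "\<And>j. j \<in> L \<Longrightarrow> \<gamma> j > 0"
  have "multi_degree \<gamma> = k" if "L = J" "\<alpha> = lower L \<gamma>"
    using that multi_degree_raise[of L "lower L \<gamma>"] raise_lower[of L \<gamma>, OF L(2)] by (simp add: k_def)
  moreover have "coefficient (basis_form J \<alpha> \<beta>) \<gamma> \<beta>' L = 0" if "\<not> (L = J \<and> \<alpha> = lower L \<gamma>)"
    using that by (auto simp: coefficient_def basis_form_def inner_Hermite)
  ultimately show "coefficient (form_scale (of_nat k) (basis_form J \<alpha> \<beta>)) \<gamma> \<beta>' L =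
      of_nat (multi_degree \<gamma>) * coefficient (basis_form J \<alpha> \<beta>) \<gamma> \<beta>' L"
    unfolding coefficient_scale by (cases "L = J \<and> \<alpha> = lower L \<gamma>") auto
qed

lemma basis_form_in_eigenspace:
  fixes J :: "'n::{finite,linorder} set"
  shows "basis_form J \<alpha> \<beta> \<in> eigenspace (dbar_Laplacian (card J)) (of_nat (multi_degree \<alpha> + card J))"
  using basis_form_eigenform[of J \<alpha> \<beta>] by (auto simp: eigenspace_def form_eq_def)

lemma sum_fun_apply: "(\<Sum>a\<in>A. f a) x = (\<Sum>a\<in>A. f a x)"
  for f :: "'a \<Rightarrow> 'b \<Rightarrow> 'c::comm_monoid_add"
  by (induction A rule: infinite_finite_induct) simp_all

text \<open>Infinitely many orthogonal forms cannot lie in the span of a finite set: the rows of their inner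
  products with each other would be infinitely many independent vectors, spanned by finitely many.\<close>

lemma infinite_dimensionalI:
  fixes e :: "nat \<Rightarrow> complex ^ 'n::finite \<Rightarrow> complex" and E :: "'n form set"
  assumes e_L2: "\<And>m. e m \<in> L2 gauss"
    and orth: "\<And>m l. inner_L2 gauss (e m) (e l) = 0 \<longleftrightarrow> m \<noteq> l"
    and E_L2: "\<And>u. u \<in> E \<Longrightarrow> u J \<in> L2 gauss"
    and eE: "\<And>m. \<exists>u\<in>E. u J = e m"
  shows "infinite_dimensional E"
  unfolding infinite_dimensional_def
proof
  assume "\<exists>B. finite B \<and> B \<subseteq> E \<and> (\<forall>u\<in>E. \<exists>c. form_eq u (\<lambda>J z. \<Sum>b\<in>B. c b * b J z))"
  then obtain B where B: "finite B" "B \<subseteq> E" and span: "\<forall>u\<in>E. \<exists>c. form_eq u (\<lambda>J z. \<Sum>b\<in>B. c b * b J z)"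
    by blast
  interpret vs: vector_space "\<lambda>(c::complex) (x::nat \<Rightarrow> complex) m. c * x m"
    by unfold_locales (auto simp: fun_eq_iff algebra_simps)
  define r where "r f = (\<lambda>l. inner_L2 gauss f (e l))" for f
  have in_span: "r (e m) \<in> vs.span ((\<lambda>b. r (b J)) ` B)" for m
  proof -
    obtain u where u: "u \<in> E" "u J = e m"
      using eE by blast
    then obtain c where "form_eq u (\<lambda>J z. \<Sum>b\<in>B. c b * b J z)"
      using span by blast
    then have "AE z in gauss. e m z = (\<Sum>b\<in>B. c b * b J z)"
      unfolding AE_gauss form_eq_def u(2)[symmetric] by (rule spec)
    moreover have bL: "b J \<in> L2 gauss" if "b \<in> B" for b
      using that B(2) E_L2 by blast
    moreover have sL: "(\<lambda>z. \<Sum>b\<in>B. c b * b J z) \<in> L2 gauss"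
      by (intro L2_sum B L2_scale bL)
    ultimately have "inner_L2 gauss (e m) (e l) = inner_L2 gauss (\<lambda>z. \<Sum>b\<in>B. c b * b J z) (e l)" for l
      by (intro inner_L2_cong_AE L2_measurable e_L2) auto
    also have "inner_L2 gauss (\<lambda>z. \<Sum>b\<in>B. c b * b J z) (e l) = (\<Sum>b\<in>B. c b * inner_L2 gauss (b J) (e l))" for l
      by (subst inner_L2_sum_left) (auto simp: B bL e_L2 inner_L2_scale_left)
    finally have "r (e m) = (\<Sum>b\<in>B. (\<lambda>l. c b * r (b J) l))"
      by (simp add: r_def fun_eq_iff sum_fun_apply)
    also have "\<dots> \<in> vs.span ((\<lambda>b. r (b J)) ` B)"
      by (intro vs.span_sum vs.span_scale vs.span_base) auto
    finally show ?thesis .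
  qed
  have r0: "r (e m) l = 0 \<longleftrightarrow> m \<noteq> l" for m l
    by (simp add: r_def orth)
  have inj: "inj (\<lambda>m. r (e m))"
  proof (rule injI)
    fix m l assume eq: "r (e m) = r (e l)"
    have "r (e l) m \<noteq> 0"
      unfolding eq[symmetric] r0 by (rule notI) (erule notE, rule refl)
    then show "m = l"
      unfolding r0 by (rule sym[OF notnotD])
  qed
  have "vs.independent (range (\<lambda>m. r (e m)))"
    unfolding vs.independent_explicit_module
  proof (intro allI impI)
    fix T c v
    assume T: "finite T" "T \<subseteq> range (\<lambda>m. r (e m))" and s: "(\<Sum>x\<in>T. (\<lambda>m. c x * x m)) = 0" and v: "v \<in> T"
    obtain m where m: "v = r (e m)"
      using T(2) v by blast
    have "x m = 0" if "x \<in> T - {v}" for x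
      using that T(2) r0 m by auto
    then have "(\<Sum>x\<in>T - {v}. c x * x m) = 0"
      by (intro sum.neutral) auto
    moreover have "(\<Sum>x\<in>T. c x * x m) = 0"
      using fun_cong[OF s, of m] by (simp add: sum_fun_apply)
    ultimately have "c v * v m = 0"
      using sum.remove[OF T(1) v, of "\<lambda>x. c x * x m"] by simp
    then show "c v = 0"
      using r0[of m m] m by simp
  qed
  then have "finite (range (\<lambda>m. r (e m)))"
    using vs.independent_span_bound[of "(\<lambda>b. r (b J)) ` B" "range (\<lambda>m. r (e m))"] B(1) in_span by auto
  then show False
    using inj finite_imageD infinite_UNIV_nat by blast
qed

theorem theorem2p4:
  fixes q :: nat
  assumes "CARD('n::{finite,linorder}) > 1"
    and "q \<le> CARD('n)"
  shows "op_spectrum q (dbar_Laplacian q :: 'n form rel) = {of_nat k | k. q \<le> k} \<and>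
    (\<forall>k\<ge>q. eigenvalue (dbar_Laplacian q :: 'n form rel) (of_nat k) \<and>
      infinite_dimensional (eigenspace (dbar_Laplacian q :: 'n form rel) (of_nat k)))"
proof -
  let ?T = "dbar_Laplacian q :: 'n form rel"
  obtain J :: "'n set" where J: "card J = q"
    using assms(2) by (metis obtain_subset_with_card_n)
  obtain i :: 'n where True
    by simp
  \<comment> \<open>The eigenvalue \<open>k\<close> only fixes the total degree of \<open>\<alpha>\<close>, so \<open>\<beta>\<close> may run through an infinite set.\<close>
  define \<alpha> where "\<alpha> k = (\<lambda>j. if j = i then k - q else 0)" for k
  define \<beta> where "\<beta> m = (\<lambda>j. if j = i then m else 0)" for m :: nat
  define u where "u k m = basis_form J (\<alpha> k) (\<beta> m)" for k m
  have u: "(u k m, form_scale (of_nat k) (u k m)) \<in> ?T" "u k m \<in> eigenspace ?T (of_nat k)" if "q \<le> k" for k m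
  proof -
    have "multi_degree (\<alpha> k) + card J = k"
      using that J by (simp add: multi_degree_def \<alpha>_def)
    then show "(u k m, form_scale (of_nat k) (u k m)) \<in> ?T" "u k m \<in> eigenspace ?T (of_nat k)"
      using basis_form_eigenform[of J "\<alpha> k" "\<beta> m"] basis_form_in_eigenspace[of J "\<alpha> k" "\<beta> m"] J
      by (simp_all add: u_def)
  qed
  have uJ: "u k m J = Hermite (\<alpha> k) (\<beta> m)" for k m
    by (simp add: u_def basis_form_def)
  have \<beta>_inj: "\<beta> m = \<beta> l \<longleftrightarrow> m = l" for m l
    by (auto simp: \<beta>_def fun_eq_iff)
  have eigen: "eigenvalue ?T (of_nat k)" if "q \<le> k" for k
  proof -
    have "\<not> form_eq (u k 0) (\<lambda>J z. 0)"
    proof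
      assume "form_eq (u k 0) (\<lambda>J z. 0)"
      then have "AE z in gauss. Hermite (\<alpha> k) (\<beta> 0) z = 0"
        unfolding AE_gauss form_eq_def uJ[symmetric] by (rule spec)
      then have "inner_L2 gauss (Hermite (\<alpha> k) (\<beta> 0)) (Hermite (\<alpha> k) (\<beta> 0)) =
          inner_L2 gauss (\<lambda>z::(complex, 'n) vec. 0) (\<lambda>z. 0)"
        by (intro inner_L2_cong_AE L2_measurable Hermite_L2 L2_zero)
      then show False
        using Hermite_norm_pos[of "\<alpha> k" "\<beta> 0"] by (simp add: inner_Hermite)
    qed
    then show ?thesis
      unfolding eigenvalue_def using u(2)[OF that] by blast
  qed
  have infdim: "infinite_dimensional (eigenspace ?T (of_nat k))" if "q \<le> k" for k
  proof (rule infinite_dimensionalI[where J = J and e = "\<lambda>m. Hermite (\<alpha> k) (\<beta> m)"])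
    show "Hermite (\<alpha> k) (\<beta> m) \<in> L2 gauss" for m
      by (rule Hermite_L2)
    show "inner_L2 gauss (Hermite (\<alpha> k) (\<beta> m)) (Hermite (\<alpha> k) (\<beta> l)) = 0 \<longleftrightarrow> m \<noteq> l" for m l
      using Hermite_norm_pos[of "\<alpha> k" "\<beta> l"] by (simp add: inner_Hermite \<beta>_inj)
    show "w J \<in> L2 gauss" if "w \<in> eigenspace ?T (of_nat k)" for w
    proof -
      obtain v where "(w, v) \<in> ?T"
        using \<open>w \<in> eigenspace ?T (of_nat k)\<close> unfolding eigenspace_def by blast
      then show ?thesis
        by (rule L2_forms_L2[OF Laplacian_coefficient(1)])
    qed
    show "\<exists>w\<in>eigenspace ?T (of_nat k). w J = Hermite (\<alpha> k) (\<beta> m)" for m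
      using u(2)[OF that] uJ by blast
  qed
  have "of_nat k \<in> op_spectrum q ?T" if k: "q \<le> k" for k
    unfolding op_spectrum_def Compl_iff
  proof
    assume "of_nat k \<in> resolvent_set q ?T"
    then obtain C where C: "\<And>u v. (u, v) \<in> ?T \<Longrightarrow>
        form_norm q u \<le> C * form_norm q (form_add v (form_scale (- of_nat k) u))"
      unfolding resolvent_set_def by blast
    have "form_add (form_scale (of_nat k) (u k 0)) (form_scale (- of_nat k) (u k 0)) = (\<lambda>J z. 0)"
      by (simp add: form_add_def form_scale_def)
    then have "form_norm q (u k 0) \<le> 0"
      using C[OF u(1)[OF k, of 0]] by (simp add: form_norm_def form_inner_def L2_inner_def)
    moreover have "form_inner q (u k 0) (u k 0) = of_real (Hermite_norm (\<alpha> k) (\<beta> 0))"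
      using form_inner_basis_form[OF basis_form_L2, of J "\<alpha> k" "\<beta> 0" "\<alpha> k" "\<beta> 0"] uJ[of k 0] J
      by (simp add: u_def inner_Hermite)
    ultimately show False
      using Hermite_norm_pos[of "\<alpha> k" "\<beta> 0"] by (simp add: form_norm_def)
  qed
  moreover have "\<mu> \<in> {of_nat k | k. q \<le> k}" if "\<mu> \<in> op_spectrum q ?T" for \<mu>
    using resolvent_set_contains[of \<mu> q] that unfolding op_spectrum_def by blast
  ultimately have "op_spectrum q ?T = {of_nat k | k. q \<le> k}"
    by blast
  then show ?thesis
    using eigen infdim by blast
qed

end
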